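(* Let $d\ge1$ and $N\ge2$ be integers, $\lambda_1,\dots,\lambda_N>0$, and $p>0$. Assume $v\in\mathcal X$ and $P^0=(\alpha^0,\beta^0)\in C^1(\mathbb R_+,\mathcal X\times\mathcal X)$ satisfy: (1) for any $I\in M_v$, $\{P^0_i\mid i\in I\}$ solves the $|I|$-body problem, that is, $$\dot\alpha_i^0=\beta_i^0,\qquad \lambda_i\dot\beta_i^0=-\sum_{j\in I\setminus\{i\}}\frac{\lambda_i\lambda_j(\alpha_i^0-\alpha_j^0)}{|\alpha_i^0-\alpha_j^0|^{p+2}},\qquad\forall i\in I;$$ (2) there exist $a\in\mathcal X$ with $a_i\ne a_j$ whenever $i\ne j$ and $v_i=v_j$, and $q<\min\big\{\frac2{p+2}+p-1,\frac2{p+2}\big\}$, such that $$\alpha^0(t)=at^{\frac2{p+2}}+O(t^q)\quad\text{as }t\to+\infty.$$ Then there exist $\delta>0$, $T_0>0$, a solution $P(t)=(\alpha(t),\beta(t))$ of the $N$-body system for $t>T_0$, and $f\in S_{1-p}$ such that $$\alpha(t)=vt+\alpha^0(t)+f(t)+o(t^{-\delta+})\quad\text{as }t\to+\infty.$$ In particular, if $p>1$, we have $$\alpha(t)=vt+\alpha^0(t)+o(t^{1-p+})\quad\text{as }t\to+\infty.$$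
   Context: $\mathbb N$ includes $0$; $\mathbb R_+=(0,+\infty)$. $\mathcal X=\mathbb R^{dN}=(\mathbb R^d)^N$, with elements written $\alpha=(\alpha_1,\dots,\alpha_N)$, $\alpha_i\in\mathbb R^d$; $P_i^0=(\alpha_i^0,\beta_i^0)$. The $N$-body system is the system for $P=(\alpha,\beta)$, $\alpha(t),\beta(t)\in\mathcal X$, $$\dot\alpha_i=\beta_i,\qquad \lambda_i\dot\beta_i=-\sum_{j\ne i}\frac{\lambda_i\lambda_j(\alpha_i-\alpha_j)}{|\alpha_i-\alpha_j|^{p+2}},\qquad i=1,\dots,N.$$ For $v\in\mathcal X$, $M_v$ is the set of equivalence classes (clusters) of $\{1,\dots,N\}$ under the relation $i\sim j\iff v_i=v_j$. For $\gamma\in\mathbb R$, $S_\gamma$ is the space of functions of $t\in(0,+\infty)$ $$S_\gamma=\Big\{\sum_{i=1}^m y_it^{q_i}\log^{k_i}(t)\ \Big|\ m\in\mathbb N,\ y_i\in\mathcal X,\ q_i\le\gamma\ (q_i\in\mathbb R),\ k_i\in\mathbb N\Big\}.$$ For a function $g$ of $t$ and $\mu\in\mathbb R$, $g(t)=o(t^{\mu+})$ as $t\to+\infty$ means $\lim_{t\to+\infty}g(t)/t^{\mu+\epsilon}=0$ for all $\epsilon>0$. *)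

theory Defs
  imports "HOL-Analysis.Analysis" "HOL-Library.Landau_Symbols"
begin

text \<open>
  The configuration space \<open>(\<real>\<^sup>d)\<^sup>N\<close> is \<open>real^'d^'n\<close>, with \<open>d = CARD('d)\<close>, \<open>N = CARD('n)\<close>
  and the bodies indexed by the elements of \<open>'n\<close>.
\<close>

type_synonym ('d, 'n) config = "real^'d^'n"

definition clusters :: "('d::finite, 'n::finite) config \<Rightarrow> 'n set set" where
  "clusters v = UNIV // {(i, j). v $ i = v $ j}"

text \<open>
  The trajectory \<open>P = (\<alpha>, \<beta>)\<close>, restricted to the bodies in \<open>I\<close>, solves the \<open>card I\<close>-body
  system at all times in \<open>T\<close>. The absence of collisions is stated explicitly because
  the right-hand side is undefined at a collision, whereas division by zero is total here.
\<close>

definition solves_body_system ::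
    "('n \<Rightarrow> real) \<Rightarrow> real \<Rightarrow> 'n set \<Rightarrow> real set
      \<Rightarrow> (real \<Rightarrow> ('d::finite, 'n::finite) config \<times> ('d, 'n) config) \<Rightarrow> bool" where
  "solves_body_system lam p I T P \<longleftrightarrow>
    (\<forall>t\<in>T. \<forall>i\<in>I.
      (\<forall>j\<in>I - {i}. fst (P t) $ i \<noteq> fst (P t) $ j) \<and>
      ((\<lambda>s. fst (P s) $ i) has_vector_derivative snd (P t) $ i) (at t) \<and>
      (\<exists>D. ((\<lambda>s. snd (P s) $ i) has_vector_derivative D) (at t) \<and>
        lam i *\<^sub>R D =
          - (\<Sum>j\<in>I - {i}.
              (lam i * lam j / norm (fst (P t) $ i - fst (P t) $ j) powr (p + 2))
                *\<^sub>R (fst (P t) $ i - fst (P t) $ j))))"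

text \<open>Only the values at \<open>t > 0\<close> are constrained.\<close>

definition power_log_space :: "real \<Rightarrow> (real \<Rightarrow> ('d::finite, 'n::finite) config) set" where
  "power_log_space \<gamma> =
    {f. \<exists>(m::nat) (y :: nat \<Rightarrow> ('d, 'n) config) (q :: nat \<Rightarrow> real) (k :: nat \<Rightarrow> nat).
          (\<forall>i\<in>{1..m}. q i \<le> \<gamma>) \<and>
          (\<forall>t>0. f t = (\<Sum>i=1..m. (t powr q i * ln t ^ k i) *\<^sub>R y i))}"

text \<open>\<open>g(t) = o(t\<^bsup>\<mu>+\<^esup>)\<close> as \<open>t \<rightarrow> +\<infinity>\<close>.\<close>

definition smallo_plus :: "(real \<Rightarrow> 'a::real_normed_vector) \<Rightarrow> real \<Rightarrow> bool" where
  "smallo_plus g \<mu> \<longleftrightarrow> (\<forall>\<epsilon>>0. ((\<lambda>t. g t /\<^sub>R (t powr (\<mu> + \<epsilon>))) \<longlongrightarrow> 0) at_top)"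

end

theory Submission imports Defs begin

text \<open>
  Put \<open>\<tau> = ln t\<close>, \<open>r = 2 / (p + 2)\<close>, \<open>\<alpha>\<^sup>0(t) = t powr r *\<^sub>R (a + b(\<tau>))\<close> and \<open>\<alpha>(t) = t v + \<alpha>\<^sup>0(t) + W(\<tau>)\<close>.
  The equations of motion become \<open>W'' = W' - A W + H(\<tau>, W)\<close>, where \<open>A\<close> is the linearised attraction
  inside the clusters. It is self-adjoint for the mass inner product, hence diagonalizable, and the
  constant-coefficient equation \<open>u'' = u' - A u + h\<close> can be solved among exponential polynomials (the
  power-log functions of \<open>t\<close>) and, for all but finitely many \<open>\<delta>\<close>, among functions of size \<open>O(exp(-\<delta>\<tau>))\<close>.
  The difference \<open>H(\<tau>, f + g) - H(\<tau>, f)\<close> is smaller than \<open>g\<close> by a factor \<open>exp(-\<kappa>\<tau>)\<close>, and it is an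
  exponential polynomial up to an error \<open>O(exp(\<eta>\<tau>))\<close> with \<open>\<eta> < min 0 (1 - p)\<close>, which stems from the
  unknown remainder \<open>O(t powr q)\<close> of \<open>\<alpha>\<^sup>0\<close>. So finitely many iterations give an exponential polynomial
  \<open>f\<close> with residual \<open>O(exp(\<eta>\<tau>))\<close>, and a contraction in the space with weight \<open>exp(-\<delta>\<tau>)\<close>,
  \<open>\<eta> < -\<delta> < min 0 (1 - p)\<close>, corrects \<open>f\<close> to a solution.
\<close>

text \<open>Logarithmic time is dictated by the exponent \<open>r = 2 / (p + 2)\<close>: along
  \<open>t powr r *\<^sub>R a\<close> the derivative of the attraction scales like
  \<open>t powr (- r * (p + 2)) = t powr (- 2)\<close>, just as two time derivatives do, so the
  linearised cluster equation is of Euler type and becomes autonomous in \<open>ln t\<close>. The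
  obstacle is that the forces between clusters, of size \<open>t powr (- p - 1)\<close>, drive a
  correction of size \<open>t powr (1 - p)\<close> up to logarithms. For \<open>p \<le> 1\<close> it
  need not decay, so a contraction among decaying functions cannot start from \<open>W = 0\<close>;
  the part that is not small has to be computed first. Resonance of a driving exponent with a
  characteristic root merely adds a power of \<open>ln t\<close> there, whereas in a weighted space
  it has to be avoided by the choice of the weight. The contraction needs no small data: the
  Lipschitz constant of \<open>H\<close> tends to 0 with time, and the linear solution operator from
  time \<open>T\<close> on has a norm independent of \<open>T\<close>, so a late start
  suffices.\<close>

section \<open>Function classes in logarithmic time\<close>

text \<open>In terms of \<open>t = exp x\<close> this is the class o(t^(\<theta>+)); the slack
  \<open>\<epsilon>\<close> absorbs powers of \<open>x\<close>, that is, of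
  \<open>ln t\<close>.\<close>

definition exp_order :: "real \<Rightarrow> (real \<Rightarrow> 'a::real_normed_vector) \<Rightarrow> bool" where
  "exp_order \<theta> f \<longleftrightarrow> (\<forall>\<epsilon>>0. (\<lambda>x. norm (f x)) \<in> O(\<lambda>x. exp ((\<theta> + \<epsilon>) * x)))"

text \<open>Read at \<open>x = ln t\<close> these are the power-log functions with exponents at most
  \<open>\<gamma>\<close>. Generating them term by term turns closure properties and linear
  equations into inductions whose only real case is a single term.\<close>

inductive exp_poly :: "real \<Rightarrow> (real \<Rightarrow> 'a::real_normed_vector) \<Rightarrow> bool" for \<gamma> where
  exp_poly_zero: "exp_poly \<gamma> (\<lambda>_. 0)"
| exp_poly_step: "exp_poly \<gamma> f \<Longrightarrow> q \<le> \<gamma> \<Longrightarrow> exp_poly \<gamma> (\<lambda>x. f x + (exp (q * x) * x ^ k) *\<^sub>R y)"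

text \<open>Two levels are tracked because they behave differently: the iteration lowers
  \<open>\<gamma>\<close> step by step, while \<open>\<theta>\<close>, the level of the unknown
  remainder, stays where it is.\<close>

definition exp_asymp :: "real \<Rightarrow> real \<Rightarrow> (real \<Rightarrow> 'a::real_normed_vector) \<Rightarrow> bool" where
  "exp_asymp \<gamma> \<theta> f \<longleftrightarrow> (\<exists>g. exp_poly \<gamma> g \<and> exp_order \<theta> (\<lambda>x. f x - g x))"

subsection \<open>Exponential order\<close>

lemma exp_order_iff: "exp_order \<theta> f \<longleftrightarrow>
    (\<forall>\<epsilon>>0. \<exists>C. \<forall>\<^sub>F x in at_top. norm (f x) \<le> C * exp ((\<theta> + \<epsilon>) * x))"
  unfolding exp_order_def bigo_def
proof (intro iff_allI imp_cong refl, safe)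
  fix \<epsilon> c :: real
  assume "\<forall>\<^sub>F x in at_top. norm (norm (f x)) \<le> c * norm (exp ((\<theta> + \<epsilon>) * x))"
  then show "\<exists>C. \<forall>\<^sub>F x in at_top. norm (f x) \<le> C * exp ((\<theta> + \<epsilon>) * x)"
    by auto
next
  fix \<epsilon> C :: real
  assume "\<forall>\<^sub>F x in at_top. norm (f x) \<le> C * exp ((\<theta> + \<epsilon>) * x)"
  \<comment> \<open>The constant in \<open>bigo_def\<close> has to be positive, hence
    \<open>max C 1\<close>.\<close>
  then have "\<forall>\<^sub>F x in at_top. norm (norm (f x)) \<le> max C 1 * norm (exp ((\<theta> + \<epsilon>) * x))"
  proof eventually_elim
    case (elim x)
    have "C * exp ((\<theta> + \<epsilon>) * x) \<le> max C 1 * exp ((\<theta> + \<epsilon>) * x)"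
      by (intro mult_right_mono) auto
    then have "norm (f x) \<le> max C 1 * exp ((\<theta> + \<epsilon>) * x)" using elim by linarith
    then show ?case by simp
  qed
  then show "\<exists>c>0. \<forall>\<^sub>F x in at_top. norm (norm (f x)) \<le> c * norm (exp ((\<theta> + \<epsilon>) * x))"
    by (intro exI[of _ "max C 1"]) auto
qed

lemma exp_orderD:
  assumes "exp_order \<theta> f" "\<theta> < \<mu>"
  obtains C where "C > 0" "\<forall>\<^sub>F x in at_top. norm (f x) \<le> C * exp (\<mu> * x)"
proof -
  have "(\<lambda>x. norm (f x)) \<in> O(\<lambda>x. exp ((\<theta> + (\<mu> - \<theta>)) * x))"
    using assms unfolding exp_order_def by (metis diff_gt_0_iff_gt)
  then obtain c where "c > 0" "\<forall>\<^sub>F x in at_top. norm (norm (f x)) \<le> c * norm (exp (\<mu> * x))"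
    by (auto elim: landau_o.bigE)
  then show ?thesis using that by simp
qed

lemma exp_orderI:
  assumes "\<forall>\<^sub>F x in at_top. norm (f x) \<le> C * exp (\<theta> * x)"
  shows "exp_order \<theta> f"
  unfolding exp_order_iff
proof (intro allI impI exI)
  fix \<epsilon> :: real assume "\<epsilon> > 0"
  show "\<forall>\<^sub>F x in at_top. norm (f x) \<le> max C 0 * exp ((\<theta> + \<epsilon>) * x)"
    using assms eventually_ge_at_top[of 0]
  proof eventually_elim
    case (elim x)
    have "C * exp (\<theta> * x) \<le> max C 0 * exp ((\<theta> + \<epsilon>) * x)"
      using \<open>\<epsilon> > 0\<close> elim by (intro mult_mono) (auto simp: distrib_right)
    then show ?case using elim by simp
  qed
qed

lemma exp_order_dominated:
  assumes "exp_order \<theta> f" and "\<forall>\<^sub>F x in at_top. norm (g x) \<le> K * norm (f x)"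
  shows "exp_order \<theta> g"
  unfolding exp_order_def
proof (intro allI impI)
  fix \<epsilon> :: real assume "\<epsilon> > 0"
  have "(\<lambda>x. norm (g x)) \<in> O(\<lambda>x. norm (f x))"
    using assms(2) by (intro bigoI[where c = K]) auto
  then show "(\<lambda>x. norm (g x)) \<in> O(\<lambda>x. exp ((\<theta> + \<epsilon>) * x))"
    using assms(1) \<open>\<epsilon> > 0\<close> unfolding exp_order_def by (meson landau_o.big_trans)
qed

lemma exp_order_mono:
  assumes "exp_order \<theta> f" "\<theta> \<le> \<mu>"
  shows "exp_order \<mu> f"
  unfolding exp_order_iff
proof (intro allI impI)
  fix \<epsilon> :: real assume "\<epsilon> > 0"
  then show "\<exists>C. \<forall>\<^sub>F x in at_top. norm (f x) \<le> C * exp ((\<mu> + \<epsilon>) * x)"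
    using exp_orderD[OF assms(1), of "\<mu> + \<epsilon>"] assms(2) by (metis add.commute add_strict_increasing2 add_le_less_mono add.left_neutral less_add_same_cancel2 linorder_not_le order.strict_trans1)
qed

lemma exp_order_add:
  assumes "exp_order \<theta> f" "exp_order \<theta> g"
  shows "exp_order \<theta> (\<lambda>x. f x + g x)"
  unfolding exp_order_def
proof (intro allI impI)
  fix \<epsilon> :: real assume "\<epsilon> > 0"
  have "(\<lambda>x. norm (f x) + norm (g x)) \<in> O(\<lambda>x. exp ((\<theta> + \<epsilon>) * x))"
    using assms \<open>\<epsilon> > 0\<close> unfolding exp_order_def by (intro sum_in_bigo) auto
  moreover have "(\<lambda>x. norm (f x + g x)) \<in> O(\<lambda>x. norm (f x) + norm (g x))"
    by (intro bigoI[where c = 1] always_eventually) (auto intro: norm_triangle_le)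
  ultimately show "(\<lambda>x. norm (f x + g x)) \<in> O(\<lambda>x. exp ((\<theta> + \<epsilon>) * x))"
    by (meson landau_o.big_trans)
qed

lemma exp_order_cong:
  assumes "exp_order \<theta> f" "\<forall>\<^sub>F x in at_top. f x = g x"
  shows "exp_order \<theta> g"
  by (rule exp_order_dominated[OF assms(1), where K = 1])
    (use assms(2) in \<open>auto elim: eventually_mono\<close>)

lemma exp_order_zero: "exp_order \<theta> (\<lambda>_. 0)"
  by (rule exp_orderI[where C = 0]) simp

lemma exp_order_bounded_linear:
  assumes "bounded_linear L" "exp_order \<theta> f"
  shows "exp_order \<theta> (\<lambda>x. L (f x))"
proof -
  obtain K where "\<forall>x. norm (L x) \<le> norm x * K"
    using bounded_linear.bounded[OF assms(1)] by blast
  then show ?thesis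
    by (intro exp_order_dominated[OF assms(2), where K = K]) (simp add: mult.commute)
qed

text \<open>Arbitrary bounded bilinear maps, because products of reals, \<open>scaleR\<close> and
  inner products all occur in the expansion of the attraction.\<close>

lemma exp_order_bilinear:
  assumes "bounded_bilinear pr" "exp_order \<theta> f" "exp_order \<mu> g"
  shows "exp_order (\<theta> + \<mu>) (\<lambda>x. pr (f x) (g x))"
  unfolding exp_order_def
proof (intro allI impI)
  fix \<epsilon> :: real assume "\<epsilon> > 0"
  have "(\<lambda>x. norm (f x) * norm (g x)) \<in> O(\<lambda>x. exp ((\<theta> + \<epsilon>/2) * x) * exp ((\<mu> + \<epsilon>/2) * x))"
    using assms \<open>\<epsilon> > 0\<close> unfolding exp_order_def by (intro landau_o.big.mult) auto
  also have "(\<lambda>x. exp ((\<theta> + \<epsilon>/2) * x) * exp ((\<mu> + \<epsilon>/2) * x)) = (\<lambda>x. exp ((\<theta> + \<mu> + \<epsilon>) * x))"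
    by (auto simp: exp_add[symmetric] algebra_simps)
  finally have 1: "(\<lambda>x. norm (f x) * norm (g x)) \<in> O(\<lambda>x. exp ((\<theta> + \<mu> + \<epsilon>) * x))" .
  obtain K where "\<forall>a b. norm (pr a b) \<le> norm a * norm b * K"
    using bounded_bilinear.bounded[OF assms(1)] by blast
  then have "(\<lambda>x. norm (pr (f x) (g x))) \<in> O(\<lambda>x. norm (f x) * norm (g x))"
    by (intro bigoI[where c = K]) (auto simp: mult.commute intro!: always_eventually)
  then show "(\<lambda>x. norm (pr (f x) (g x))) \<in> O(\<lambda>x. exp ((\<theta> + \<mu> + \<epsilon>) * x))"
    using 1 by (meson landau_o.big_trans)
qed

text \<open>The factor \<open>x ^ k\<close> is absorbed by \<open>exp (\<epsilon> * x)\<close>, at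
  the price of a constant \<open>1 / \<epsilon> ^ k\<close>.\<close>

lemma exp_order_exp_term: "exp_order q (\<lambda>x. (exp (q * x) * x ^ k) *\<^sub>R y)"
  unfolding exp_order_iff
proof (intro allI impI)
  fix \<epsilon> :: real assume "\<epsilon> > 0"
  have "\<forall>\<^sub>F x in at_top. (\<epsilon> * x) ^ k / exp (\<epsilon> * x) < 1"
    by (rule order_tendstoD[OF filterlim_compose[OF tendsto_power_div_exp_0, of "\<lambda>x. \<epsilon> * x"]])
      (use \<open>\<epsilon> > 0\<close> in \<open>auto intro!: filterlim_tendsto_pos_mult_at_top[OF tendsto_const] filterlim_ident\<close>)
  then have "\<forall>\<^sub>F x in at_top. norm ((exp (q * x) * x ^ k) *\<^sub>R y)
      \<le> (norm y / \<epsilon> ^ k) * exp ((q + \<epsilon>) * x)"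
    using eventually_ge_at_top[of 0]
  proof eventually_elim
    case (elim x)
    have "x ^ k \<le> exp (\<epsilon> * x) / \<epsilon> ^ k"
      using elim \<open>\<epsilon> > 0\<close> by (simp add: field_simps power_mult_distrib)
    then have "exp (q * x) * x ^ k * norm y \<le> exp (q * x) * (exp (\<epsilon> * x) / \<epsilon> ^ k) * norm y"
      by (intro mult_right_mono mult_left_mono) auto
    then show ?case using elim by (simp add: distrib_right exp_add mult_ac distrib_left)
  qed
  then show "\<exists>C. \<forall>\<^sub>F x in at_top. norm ((exp (q * x) * x ^ k) *\<^sub>R y) \<le> C * exp ((q + \<epsilon>) * x)"
    by blast
qed

subsection \<open>Exponential polynomials\<close>

lemma exp_poly_term: "q \<le> \<gamma> \<Longrightarrow> exp_poly \<gamma> (\<lambda>x. (exp (q * x) * x ^ k) *\<^sub>R y)"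
  using exp_poly_step[OF exp_poly_zero, of q] by simp

lemma exp_poly_const: "0 \<le> \<gamma> \<Longrightarrow> exp_poly \<gamma> (\<lambda>x. y)"
  using exp_poly_term[of 0 \<gamma> 0] by simp

lemma exp_poly_add:
  assumes "exp_poly \<gamma> f" "exp_poly \<gamma> g"
  shows "exp_poly \<gamma> (\<lambda>x. f x + g x)"
  using assms(2)
proof induction
  case (exp_poly_step g q k y)
  then show ?case
    using exp_poly.exp_poly_step[of \<gamma> "\<lambda>x. f x + g x" q k y] by (simp add: add.assoc)
qed (use assms(1) in simp)

lemma exp_poly_mono: "exp_poly \<gamma> f \<Longrightarrow> \<gamma> \<le> \<gamma>' \<Longrightarrow> exp_poly \<gamma>' f"
  by (induction rule: exp_poly.induct) (auto intro: exp_poly.intros)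

lemma exp_poly_bounded_linear:
  assumes "bounded_linear L" "exp_poly \<gamma> f"
  shows "exp_poly \<gamma> (\<lambda>x. L (f x))"
proof -
  interpret bounded_linear L by fact
  show ?thesis
    using assms(2) by induction (auto simp: add scaleR zero intro: exp_poly.intros)
qed

lemma exp_poly_sum:
  "(\<And>i. i \<in> I \<Longrightarrow> exp_poly \<gamma> (f i)) \<Longrightarrow> exp_poly \<gamma> (\<lambda>x. \<Sum>i\<in>I. f i x)"
  by (induction I rule: infinite_finite_induct) (auto intro: exp_poly_zero exp_poly_add)

lemma exp_poly_bilinear:
  assumes "bounded_bilinear pr" "exp_poly \<gamma> f" "exp_poly \<gamma>' g"
  shows "exp_poly (\<gamma> + \<gamma>') (\<lambda>x. pr (f x) (g x))"
proof -
  interpret bounded_bilinear pr by fact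
  have single: "exp_poly (\<gamma> + \<gamma>') (\<lambda>x. pr (f x) ((exp (q * x) * x ^ k) *\<^sub>R y))" if "q \<le> \<gamma>'" for q k y
    using assms(2)
  proof induction
    case exp_poly_zero
    then show ?case by (simp add: zero_left exp_poly.exp_poly_zero)
  next
    case (exp_poly_step f q' k' y')
    have "exp_poly (\<gamma> + \<gamma>') (\<lambda>x. pr (f x) ((exp (q * x) * x ^ k) *\<^sub>R y) +
        (exp ((q' + q) * x) * x ^ (k' + k)) *\<^sub>R pr y' y)"
      using exp_poly_step that by (intro exp_poly.exp_poly_step) auto
    then show ?case
      by (simp add: add_left scaleR_left scaleR_right scaleR_add_right distrib_right distrib_left exp_add power_add mult_ac)
  qed
  show ?thesis
    using assms(3)
  proof induction
    case exp_poly_zero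
    then show ?case by (simp add: zero_right exp_poly.exp_poly_zero)
  next
    case (exp_poly_step g q k y)
    then show ?case by (simp only: add_right) (intro exp_poly_add single)
  qed
qed

lemma exp_poly_imp_order: "exp_poly \<gamma> f \<Longrightarrow> exp_order \<gamma> f"
proof (induction rule: exp_poly.induct)
  case (exp_poly_step f q k y)
  then show ?case by (intro exp_order_add exp_order_mono[OF exp_order_exp_term])
qed (rule exp_order_zero)

lemma exp_poly_in_power_log_space:
  assumes "exp_poly \<gamma> f"
  shows "(\<lambda>t. f (ln t)) \<in> power_log_space \<gamma>"
  using assms
proof induction
  case exp_poly_zero
  show ?case unfolding power_log_space_def by (auto intro!: exI[of _ 0])
next
  case (exp_poly_step f q k y)
  then obtain m ys qs ks where *: "\<forall>i\<in>{1..m::nat}. qs i \<le> \<gamma>"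
    "\<forall>t>0. f (ln t) = (\<Sum>i=1..m. (t powr qs i * ln t ^ ks i) *\<^sub>R ys i)"
    unfolding power_log_space_def by blast
  have "f (ln t) + (exp (q * ln t) * ln t ^ k) *\<^sub>R y = (\<Sum>i=1..Suc m. (t powr (qs(Suc m := q)) i *
      ln t ^ (ks(Suc m := k)) i) *\<^sub>R (ys(Suc m := y)) i)" if "t > 0" for t
  proof -
    have "(\<Sum>i=1..m. (t powr (qs(Suc m := q)) i * ln t ^ (ks(Suc m := k)) i) *\<^sub>R (ys(Suc m := y)) i)
        = (\<Sum>i=1..m. (t powr qs i * ln t ^ ks i) *\<^sub>R ys i)"
      by (intro sum.cong) auto
    then show ?thesis using * that by (simp add: powr_def)
  qed
  moreover have "\<forall>i\<in>{1..Suc m}. (qs(Suc m := q)) i \<le> \<gamma>"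
    using * exp_poly_step by auto
  ultimately show ?case unfolding power_log_space_def by blast
qed

subsection \<open>Exponential polynomials up to an error\<close>

lemma exp_asymp_poly: "exp_poly \<gamma> f \<Longrightarrow> exp_asymp \<gamma> \<theta> f"
  unfolding exp_asymp_def by (auto intro!: exI[of _ f] exp_order_zero)

lemma exp_asymp_order: "exp_order \<theta> f \<Longrightarrow> exp_asymp \<gamma> \<theta> f"
  unfolding exp_asymp_def by (auto intro!: exI[of _ "\<lambda>_. 0"] exp_poly_zero)

lemma exp_asymp_mono:
  "exp_asymp \<gamma> \<theta> f \<Longrightarrow> \<gamma> \<le> \<gamma>' \<Longrightarrow> \<theta> \<le> \<theta>' \<Longrightarrow> exp_asymp \<gamma>' \<theta>' f"
  unfolding exp_asymp_def using exp_poly_mono exp_order_mono by blast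

lemma exp_asymp_imp_order:
  assumes "exp_asymp \<gamma> \<theta> f" "\<gamma> \<le> \<mu>" "\<theta> \<le> \<mu>"
  shows "exp_order \<mu> f"
proof -
  obtain g where "exp_poly \<gamma> g" "exp_order \<theta> (\<lambda>x. f x - g x)"
    using assms unfolding exp_asymp_def by auto
  then have "exp_order \<mu> g" "exp_order \<mu> (\<lambda>x. f x - g x)"
    using assms exp_poly_imp_order exp_order_mono by blast+
  then show ?thesis using exp_order_add by fastforce
qed

lemma exp_asymp_add:
  assumes "exp_asymp \<gamma> \<theta> f" "exp_asymp \<gamma> \<theta> g"
  shows "exp_asymp \<gamma> \<theta> (\<lambda>x. f x + g x)"
proof -
  obtain f' g' where *: "exp_poly \<gamma> f'" "exp_order \<theta> (\<lambda>x. f x - f' x)"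
      "exp_poly \<gamma> g'" "exp_order \<theta> (\<lambda>x. g x - g' x)"
    using assms unfolding exp_asymp_def by auto
  have "exp_order \<theta> (\<lambda>x. f x + g x - (f' x + g' x))"
    using exp_order_add[OF *(2,4)] by (simp add: algebra_simps)
  then show ?thesis unfolding exp_asymp_def using exp_poly_add[OF *(1,3)] by blast
qed

lemma exp_asymp_bounded_linear:
  assumes "bounded_linear L" "exp_asymp \<gamma> \<theta> f"
  shows "exp_asymp \<gamma> \<theta> (\<lambda>x. L (f x))"
proof -
  interpret bounded_linear L by fact
  obtain g where "exp_poly \<gamma> g" "exp_order \<theta> (\<lambda>x. f x - g x)"
    using assms unfolding exp_asymp_def by auto
  then show ?thesis unfolding exp_asymp_def
    using exp_poly_bounded_linear[OF assms(1), of \<gamma> g]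
      exp_order_bounded_linear[OF assms(1), of \<theta> "\<lambda>x. f x - g x"]
    by (auto simp: diff)
qed

lemma exp_asymp_diff:
  assumes "exp_asymp \<gamma> \<theta> f" "exp_asymp \<gamma> \<theta> g"
  shows "exp_asymp \<gamma> \<theta> (\<lambda>x. f x - g x)"
  using exp_asymp_add[OF assms(1) exp_asymp_bounded_linear[OF bounded_linear_minus[OF bounded_linear_ident] assms(2)]]
  by simp

lemma exp_asymp_zero: "exp_asymp \<gamma> \<theta> (\<lambda>_. 0)"
  by (rule exp_asymp_poly[OF exp_poly_zero])

lemma exp_asymp_sum:
  "(\<And>i. i \<in> I \<Longrightarrow> exp_asymp \<gamma> \<theta> (f i)) \<Longrightarrow> exp_asymp \<gamma> \<theta> (\<lambda>x. \<Sum>i\<in>I. f i x)"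
  by (induction I rule: infinite_finite_induct) (auto intro: exp_asymp_zero exp_asymp_add)

lemma exp_asymp_cong:
  assumes "exp_asymp \<gamma> \<theta> f" "\<forall>\<^sub>F x in at_top. f x = g x"
  shows "exp_asymp \<gamma> \<theta> g"
proof -
  obtain f' where f': "exp_poly \<gamma> f'" "exp_order \<theta> (\<lambda>x. f x - f' x)"
    using assms unfolding exp_asymp_def by auto
  have "exp_order \<theta> (\<lambda>x. g x - f' x)"
    by (rule exp_order_cong[OF f'(2)]) (use assms(2) in \<open>auto elim: eventually_mono\<close>)
  then show ?thesis using f' unfolding exp_asymp_def by blast
qed

text \<open>The error of the product splits as \<open>pr f' (g - g') + pr (f - f') g\<close>. In the
  second summand \<open>g\<close> itself must have order \<open>\<gamma>'\<close>, which is what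
  \<open>\<theta>' \<le> \<gamma>'\<close> provides.\<close>

lemma exp_asymp_bilinear:
  assumes "bounded_bilinear pr" "exp_asymp \<gamma> \<theta> f" "exp_asymp \<gamma>' \<theta>' g"
    and "\<theta>' \<le> \<gamma>'" "\<gamma> + \<gamma>' \<le> \<gamma>''" "\<gamma> + \<theta>' \<le> \<theta>''" "\<theta> + \<gamma>' \<le> \<theta>''"
  shows "exp_asymp \<gamma>'' \<theta>'' (\<lambda>x. pr (f x) (g x))"
proof -
  interpret bounded_bilinear pr by fact
  obtain f' g' where *: "exp_poly \<gamma> f'" "exp_order \<theta> (\<lambda>x. f x - f' x)"
      "exp_poly \<gamma>' g'" "exp_order \<theta>' (\<lambda>x. g x - g' x)"
    using assms unfolding exp_asymp_def by auto
  have g: "exp_order \<gamma>' g"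
    using exp_asymp_imp_order[OF assms(3)] assms(4) by simp
  have "exp_order \<theta>'' (\<lambda>x. pr (f' x) (g x - g' x) + pr (f x - f' x) (g x))"
    using exp_order_mono[OF exp_order_bilinear[OF assms(1) exp_poly_imp_order[OF *(1)] *(4)] assms(6)]
      exp_order_mono[OF exp_order_bilinear[OF assms(1) *(2) g] assms(7)]
    by (rule exp_order_add)
  moreover have "pr (f' x) (g x - g' x) + pr (f x - f' x) (g x) = pr (f x) (g x) - pr (f' x) (g' x)" for x
    by (simp add: diff_left diff_right)
  moreover have "exp_poly \<gamma>'' (\<lambda>x. pr (f' x) (g' x))"
    by (rule exp_poly_mono[OF exp_poly_bilinear[OF assms(1) *(1,3)] assms(5)])
  ultimately show ?thesis unfolding exp_asymp_def by auto
qed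

lemma exp_poly_shift:
  assumes "exp_poly \<gamma> f" "\<gamma> + c \<le> \<gamma>'"
  shows "exp_poly \<gamma>' (\<lambda>x. exp (c * x) *\<^sub>R f x)"
proof -
  have "exp_poly c (\<lambda>x. exp (c * x))"
    using exp_poly_term[of c c 0 "1::real"] by simp
  then have "exp_poly (c + \<gamma>) (\<lambda>x. exp (c * x) *\<^sub>R f x)"
    by (rule exp_poly_bilinear[OF bounded_bilinear_scaleR _ assms(1)])
  then show ?thesis by (rule exp_poly_mono) (use assms(2) in simp)
qed

lemma exp_order_shift:
  assumes "exp_order \<theta> f" "\<theta> + c \<le> \<theta>'"
  shows "exp_order \<theta>' (\<lambda>x. exp (c * x) *\<^sub>R f x)"
proof -
  have "exp_order c (\<lambda>x. exp (c * x))"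
    using exp_order_exp_term[of c 0 "1::real"] by simp
  then have "exp_order (c + \<theta>) (\<lambda>x. exp (c * x) *\<^sub>R f x)"
    by (rule exp_order_bilinear[OF bounded_bilinear_scaleR _ assms(1)])
  then show ?thesis by (rule exp_order_mono) (use assms(2) in simp)
qed

lemma exp_asymp_shift:
  assumes "exp_asymp \<gamma> \<theta> f" "\<gamma> + c \<le> \<gamma>'" "\<theta> + c \<le> \<theta>'"
  shows "exp_asymp \<gamma>' \<theta>' (\<lambda>x. exp (c * x) *\<^sub>R f x)"
proof -
  obtain g where g: "exp_poly \<gamma> g" "exp_order \<theta> (\<lambda>x. f x - g x)"
    using assms(1) unfolding exp_asymp_def by auto
  show ?thesis
    using exp_poly_shift[OF g(1) assms(2)] exp_order_shift[OF g(2) assms(3)]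
    unfolding exp_asymp_def by (auto simp: scaleR_diff_right)
qed

lemma exp_order_tendsto_0:
  assumes "exp_order \<theta> f" "\<theta> < 0"
  shows "(f \<longlongrightarrow> 0) at_top"
proof -
  obtain C where C: "\<forall>\<^sub>F x in at_top. norm (f x) \<le> C * exp (\<theta> / 2 * x)"
    using exp_orderD[OF assms(1), of "\<theta> / 2"] assms(2) by auto
  have "((\<lambda>x. exp (\<theta> / 2 * x)) \<longlongrightarrow> 0) at_top"
    using assms(2)
    by (intro filterlim_compose[OF exp_at_bot] filterlim_tendsto_neg_mult_at_bot[OF tendsto_const] filterlim_ident) auto
  then have "((\<lambda>x. C * exp (\<theta> / 2 * x)) \<longlongrightarrow> 0) at_top"
    by (rule tendsto_mult_right_zero)
  then show ?thesis by (rule Lim_null_comparison[OF C])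
qed

subsection \<open>Remainders of the binomial series\<close>

definition binomial_rem :: "nat \<Rightarrow> real \<Rightarrow> real \<Rightarrow> real" where
  "binomial_rem K c u = (1 + u) powr c - (\<Sum>k<K. (c gchoose k) * u ^ k)"

text \<open>Differentiation lowers the order and the exponent together, by the absorption identity
  for binomial coefficients; all bounds on the remainders are inductions along this
  relation.\<close>

lemma binomial_rem_deriv:
  assumes "\<bar>u\<bar> < 1"
  shows "(binomial_rem (Suc K) c has_real_derivative c * binomial_rem K (c - 1) u) (at u within S)"
proof -
  have "(\<Sum>k<Suc K. (c gchoose k) * (real k * u ^ (k - 1)))
      = (\<Sum>k<K. of_nat (Suc k) * (c gchoose Suc k) * u ^ k)"
    by (subst sum.lessThan_Suc_shift) (simp add: mult_ac)
  also have "\<dots> = c * (\<Sum>k<K. ((c - 1) gchoose k) * u ^ k)"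
    unfolding gbinomial_absorption by (simp add: sum_distrib_left mult.assoc)
  finally have *: "(\<Sum>k<Suc K. (c gchoose k) * (real k * u ^ (k - 1)))
      = c * (\<Sum>k<K. ((c - 1) gchoose k) * u ^ k)" .
  have "((\<lambda>u. (1 + u) powr c - (\<Sum>k<Suc K. (c gchoose k) * u ^ k)) has_real_derivative
     c * (1 + u) powr (c - 1) - (\<Sum>k<Suc K. (c gchoose k) * (real k * u ^ (k - 1)))) (at u within S)"
    using assms by (auto intro!: derivative_eq_intros sum.cong simp del: sum.lessThan_Suc simp: powr_diff)
  then show ?thesis
    unfolding binomial_rem_def * by (simp add: algebra_simps)
qed

text \<open>Mean value inequality on \<open>{-m..m}\<close>. Differences are estimated because
  comparing two trajectories requires the factor
  \<open>\<bar>u\<^sub>1 - u\<^sub>2\<bar>\<close>.\<close>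

lemma binomial_rem_diff_from_bound:
  assumes "0 \<le> C" "\<And>u. \<bar>u\<bar> \<le> 1/2 \<Longrightarrow> \<bar>binomial_rem K (c - 1) u\<bar> \<le> C * \<bar>u\<bar> ^ K"
    and "\<bar>u\<^sub>1\<bar> \<le> m" "\<bar>u\<^sub>2\<bar> \<le> m" "m \<le> 1/2"
  shows "\<bar>binomial_rem (Suc K) c u\<^sub>1 - binomial_rem (Suc K) c u\<^sub>2\<bar> \<le> \<bar>c\<bar> * C * m ^ K * \<bar>u\<^sub>1 - u\<^sub>2\<bar>"
proof -
  have "norm (binomial_rem (Suc K) c u\<^sub>1 - binomial_rem (Suc K) c u\<^sub>2)
      \<le> \<bar>c\<bar> * C * m ^ K * norm (u\<^sub>1 - u\<^sub>2)"
  proof (rule field_differentiable_bound[where S = "{-m..m}" and f' = "\<lambda>u. c * binomial_rem K (c - 1) u"])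
    fix u assume u: "u \<in> {-m..m}"
    then show "(binomial_rem (Suc K) c has_field_derivative c * binomial_rem K (c - 1) u) (at u within {-m..m})"
      using assms by (intro binomial_rem_deriv) auto
    have "\<bar>binomial_rem K (c - 1) u\<bar> \<le> C * \<bar>u\<bar> ^ K" using u assms by auto
    also have "\<dots> \<le> C * m ^ K" using u assms by (intro mult_left_mono power_mono) auto
    finally show "norm (c * binomial_rem K (c - 1) u) \<le> \<bar>c\<bar> * C * m ^ K"
      by (simp add: abs_mult mult.assoc mult_left_mono)
  qed (use assms in auto)
  then show ?thesis by simp
qed

text \<open>Order \<open>Suc K\<close> for \<open>c\<close> comes from order \<open>K\<close> for
  \<open>c - 1\<close>, so \<open>c\<close> varies in the induction. For
  \<open>\<bar>u\<bar> \<le> 1/2\<close> the base \<open>1 + u\<close> stays away from 0, and order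
  0 is compactness.\<close>

lemma binomial_rem_bound:
  "\<exists>C\<ge>0. \<forall>u. \<bar>u\<bar> \<le> 1/2 \<longrightarrow> \<bar>binomial_rem K c u\<bar> \<le> C * \<bar>u\<bar> ^ K"
proof (induction K arbitrary: c)
  case 0
  have "continuous_on {-1/2..1/2} (\<lambda>u::real. (1 + u) powr c)"
    by (auto intro!: continuous_intros)
  then have "compact ((\<lambda>u::real. (1 + u) powr c) ` {-1/2..1/2})"
    by (rule compact_continuous_image) simp
  then obtain C where C: "\<forall>u\<in>{-1/2..1/2::real}. norm ((1 + u) powr c) \<le> C"
    unfolding compact_eq_bounded_closed bounded_iff by auto
  have "\<bar>binomial_rem 0 c u\<bar> \<le> max C 0 * \<bar>u\<bar> ^ 0" if "\<bar>u\<bar> \<le> 1/2" for u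
  proof -
    have "norm ((1 + u) powr c) \<le> C" using that by (intro C[rule_format]) (auto simp: abs_le_iff)
    then show ?thesis by (simp add: binomial_rem_def)
  qed
  then show ?case by (intro exI[of _ "max C 0"] conjI allI impI) simp_all
next
  case (Suc K)
  from Suc.IH[of "c - 1"] obtain C where "0 \<le> C \<and> (\<forall>u. \<bar>u\<bar> \<le> 1/2 \<longrightarrow> \<bar>binomial_rem K (c - 1) u\<bar> \<le> C * \<bar>u\<bar> ^ K)" ..
  then have C: "0 \<le> C" "\<And>u. \<bar>u\<bar> \<le> 1/2 \<Longrightarrow> \<bar>binomial_rem K (c - 1) u\<bar> \<le> C * \<bar>u\<bar> ^ K"
    by blast+
  have 0: "binomial_rem (Suc K) c 0 = 0"
    unfolding binomial_rem_def by (subst sum.lessThan_Suc_shift) simp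
  have "\<bar>binomial_rem (Suc K) c u\<bar> \<le> \<bar>c\<bar> * C * \<bar>u\<bar> ^ Suc K" if "\<bar>u\<bar> \<le> 1/2" for u
    \<comment> \<open>Comparison with \<open>0\<close>, where the remainder vanishes, on the
      smallest interval containing \<open>u\<close>.\<close>
    using binomial_rem_diff_from_bound[OF C, of u "\<bar>u\<bar>" 0] that by (simp add: 0 mult_ac)
  then show ?case using C(1) by (intro exI[of _ "\<bar>c\<bar> * C"] conjI allI impI) simp_all
qed

lemma binomial_rem_diff:
  obtains C where "0 \<le> C" "\<And>u\<^sub>1 u\<^sub>2 m. \<bar>u\<^sub>1\<bar> \<le> m \<Longrightarrow> \<bar>u\<^sub>2\<bar> \<le> m \<Longrightarrow> m \<le> 1/2 \<Longrightarrow>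
    \<bar>binomial_rem (Suc K) c u\<^sub>1 - binomial_rem (Suc K) c u\<^sub>2\<bar> \<le> C * m ^ K * \<bar>u\<^sub>1 - u\<^sub>2\<bar>"
proof -
  obtain C where "0 \<le> C" "\<And>u. \<bar>u\<bar> \<le> 1/2 \<Longrightarrow> \<bar>binomial_rem K (c - 1) u\<bar> \<le> C * \<bar>u\<bar> ^ K"
    using binomial_rem_bound[of K "c - 1"] by metis
  then show ?thesis using that[of "\<bar>c\<bar> * C"] binomial_rem_diff_from_bound by simp
qed

text \<open>Constant terms cancel and linear ones stand on the left, so the sum starts with squares;
  hence the shift by 2.\<close>

lemma binomial_diff_expand:
  fixes c :: real
  shows "(1 + u\<^sub>1) powr c - (1 + u\<^sub>2) powr c - c * (u\<^sub>1 - u\<^sub>2) =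
    (\<Sum>k<K. (c gchoose (k + 2)) * (u\<^sub>1 ^ (k + 2) - u\<^sub>2 ^ (k + 2)))
      + (binomial_rem (Suc (Suc K)) c u\<^sub>1 - binomial_rem (Suc (Suc K)) c u\<^sub>2)"
proof -
  have "(\<Sum>k<Suc (Suc K). (c gchoose k) * u ^ k) =
      1 + c * u + (\<Sum>k<K. (c gchoose (k + 2)) * u ^ (k + 2))" for u
    by (subst sum.lessThan_Suc_shift, subst sum.lessThan_Suc_shift) simp
  then show ?thesis
    unfolding binomial_rem_def by (simp add: sum_subtractf right_diff_distrib)
qed

lemma binomial_linear_approx:
  fixes c :: real
  obtains C where "0 \<le> C" "\<And>u\<^sub>1 u\<^sub>2 m. \<bar>u\<^sub>1\<bar> \<le> m \<Longrightarrow> \<bar>u\<^sub>2\<bar> \<le> m \<Longrightarrow> m \<le> 1/2 \<Longrightarrow>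
    \<bar>(1 + u\<^sub>1) powr c - (1 + u\<^sub>2) powr c - c * (u\<^sub>1 - u\<^sub>2)\<bar> \<le> C * m * \<bar>u\<^sub>1 - u\<^sub>2\<bar>"
proof -
  obtain C where "0 \<le> C" "\<And>u\<^sub>1 u\<^sub>2 m. \<bar>u\<^sub>1\<bar> \<le> m \<Longrightarrow> \<bar>u\<^sub>2\<bar> \<le> m \<Longrightarrow> m \<le> 1/2 \<Longrightarrow>
    \<bar>binomial_rem (Suc (Suc 0)) c u\<^sub>1 - binomial_rem (Suc (Suc 0)) c u\<^sub>2\<bar> \<le> C * m ^ (Suc 0) * \<bar>u\<^sub>1 - u\<^sub>2\<bar>"
    using binomial_rem_diff[of "Suc 0" c] by blast
  then show ?thesis using that[of C] binomial_diff_expand[of _ c _ 0] by simp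
qed

subsection \<open>Expansions of powers\<close>

lemma exp_order_power:
  fixes f :: "real \<Rightarrow> real"
  assumes "exp_order \<theta> f"
  shows "exp_order (real n * \<theta>) (\<lambda>x. f x ^ n)"
proof (induction n)
  case 0
  show ?case using exp_order_exp_term[of 0 0 "1::real"] by simp
next
  case (Suc n)
  show ?case using exp_order_bilinear[OF bounded_bilinear_mult assms Suc] by (simp add: distrib_right)
qed

lemma exp_asymp_power_Suc:
  fixes u :: "real \<Rightarrow> real"
  assumes "exp_asymp (-\<kappa>) \<theta> u" "\<kappa> > 0" "\<theta> \<le> -\<kappa>"
  shows "exp_asymp (-\<kappa>) \<theta> (\<lambda>x. u x ^ Suc n)"
proof (induction n)
  case (Suc n)
  show ?case
    using exp_asymp_bilinear[OF bounded_bilinear_mult assms(1) Suc, of "-\<kappa>" \<theta>] assms by simp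
qed (use assms in simp)

text \<open>From degree 2 on, a difference of powers is a sum of products of a difference with at
  least one decaying factor, which gains \<open>\<kappa>\<close>. The error level
  \<open>\<gamma> + \<theta>\<close> is that of a difference of size \<open>\<gamma>\<close> times
  an unknown part of size \<open>\<theta>\<close>; it is preserved.\<close>

lemma exp_asymp_power_diff:
  fixes u\<^sub>1 u\<^sub>2 :: "real \<Rightarrow> real"
  assumes u: "exp_asymp (-\<kappa>) \<theta> u\<^sub>1" "exp_asymp (-\<kappa>) \<theta> u\<^sub>2" "\<kappa> > 0" "\<theta> \<le> -\<kappa>"
    and d: "exp_asymp \<gamma> (\<gamma> + \<theta>) (\<lambda>x. u\<^sub>1 x - u\<^sub>2 x)"
  shows "exp_asymp \<gamma> (\<gamma> + \<theta>) (\<lambda>x. u\<^sub>1 x ^ Suc n - u\<^sub>2 x ^ Suc n)"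
    and "exp_asymp (\<gamma> - \<kappa>) (\<gamma> + \<theta>) (\<lambda>x. u\<^sub>1 x ^ (n + 2) - u\<^sub>2 x ^ (n + 2))"
proof -
  have step: "exp_asymp (\<gamma> - \<kappa>) (\<gamma> + \<theta>) (\<lambda>x. u\<^sub>1 x ^ (n + 2) - u\<^sub>2 x ^ (n + 2))"
    if IH: "exp_asymp \<gamma> (\<gamma> + \<theta>) (\<lambda>x. u\<^sub>1 x ^ Suc n - u\<^sub>2 x ^ Suc n)" for n
  proof -
    have "exp_asymp (\<gamma> - \<kappa>) (\<gamma> + \<theta>)
        (\<lambda>x. (u\<^sub>1 x - u\<^sub>2 x) * u\<^sub>1 x ^ Suc n + (u\<^sub>1 x ^ Suc n - u\<^sub>2 x ^ Suc n) * u\<^sub>2 x)"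
      by (intro exp_asymp_add exp_asymp_bilinear[OF bounded_bilinear_mult d exp_asymp_power_Suc[OF u(1,3,4)]]
          exp_asymp_bilinear[OF bounded_bilinear_mult IH u(2)]) (use u in auto)
    moreover have "(u\<^sub>1 x - u\<^sub>2 x) * u\<^sub>1 x ^ Suc n + (u\<^sub>1 x ^ Suc n - u\<^sub>2 x ^ Suc n) * u\<^sub>2 x
        = u\<^sub>1 x ^ (n + 2) - u\<^sub>2 x ^ (n + 2)" for x
      by (simp add: algebra_simps)
    ultimately show ?thesis by simp
  qed
  show *: "exp_asymp \<gamma> (\<gamma> + \<theta>) (\<lambda>x. u\<^sub>1 x ^ Suc n - u\<^sub>2 x ^ Suc n)" for n
  proof (induction n)
    case (Suc n)
    show ?case using exp_asymp_mono[OF step[OF Suc], of \<gamma> "\<gamma> + \<theta>"] u by simp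
  qed (use d in simp)
  show "exp_asymp (\<gamma> - \<kappa>) (\<gamma> + \<theta>) (\<lambda>x. u\<^sub>1 x ^ (n + 2) - u\<^sub>2 x ^ (n + 2))"
    by (rule step[OF *])
qed

lemma exp_asymp_powr_diff:
  fixes u\<^sub>1 u\<^sub>2 :: "real \<Rightarrow> real"
  assumes u: "exp_asymp (-\<kappa>) \<theta> u\<^sub>1" "exp_asymp (-\<kappa>) \<theta> u\<^sub>2" "\<kappa> > 0" "\<theta> \<le> -\<kappa>"
    and d: "exp_asymp \<gamma> (\<gamma> + \<theta>) (\<lambda>x. u\<^sub>1 x - u\<^sub>2 x)"
  shows "exp_asymp (\<gamma> - \<kappa>) (\<gamma> + \<theta>)
    (\<lambda>x. (1 + u\<^sub>1 x) powr c - (1 + u\<^sub>2 x) powr c - c * (u\<^sub>1 x - u\<^sub>2 x))"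
proof -
  \<comment> \<open>Enough terms that the Taylor remainder, of order
    \<open>\<gamma> - (K + 1) * \<kappa>\<close>, falls to the error level
    \<open>\<gamma> + \<theta>\<close>.\<close>
  obtain K :: nat where K: "real K * \<kappa> \<ge> -\<theta>"
    using u(3) by (metis divide_le_eq order.refl pos_divide_le_eq real_arch_simple)
  have small: "exp_order (-\<kappa>) u\<^sub>1" "exp_order (-\<kappa>) u\<^sub>2"
    using u by (auto intro: exp_asymp_imp_order)
  obtain C where C: "0 \<le> C" "\<And>u\<^sub>1 u\<^sub>2 m. \<bar>u\<^sub>1\<bar> \<le> m \<Longrightarrow> \<bar>u\<^sub>2\<bar> \<le> m \<Longrightarrow> m \<le> 1/2 \<Longrightarrow>
    \<bar>binomial_rem (Suc (Suc K)) c u\<^sub>1 - binomial_rem (Suc (Suc K)) c u\<^sub>2\<bar> \<le> C * m ^ Suc K * \<bar>u\<^sub>1 - u\<^sub>2\<bar>"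
    using binomial_rem_diff[of "Suc K" c] by blast
  define m where "m x = \<bar>u\<^sub>1 x\<bar> + \<bar>u\<^sub>2 x\<bar>" for x
  have m: "exp_order (-\<kappa>) m"
    unfolding m_def
    by (intro exp_order_add exp_order_dominated[OF small(1), where K = 1]
        exp_order_dominated[OF small(2), where K = 1]) auto
  have "exp_order (\<gamma> + \<theta>) (\<lambda>x. m x ^ Suc K * (u\<^sub>1 x - u\<^sub>2 x))"
    by (rule exp_order_mono[OF exp_order_bilinear[OF bounded_bilinear_mult
          exp_order_power[OF m] exp_asymp_imp_order[OF d, of \<gamma>]]])
      (use u K in \<open>auto simp: algebra_simps\<close>)
  moreover have "\<forall>\<^sub>F x in at_top. norm (binomial_rem (Suc (Suc K)) c (u\<^sub>1 x) - binomial_rem (Suc (Suc K)) c (u\<^sub>2 x))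
      \<le> C * norm (m x ^ Suc K * (u\<^sub>1 x - u\<^sub>2 x))"
  proof -
    have "\<forall>\<^sub>F x in at_top. m x < 1/2"
      using order_tendstoD(2)[OF exp_order_tendsto_0[OF m], of "1/2"] u by simp
    then show ?thesis
    proof eventually_elim
      case (elim x)
      have "m x \<ge> 0" by (simp add: m_def)
      then show ?case
        using C(2)[of "u\<^sub>1 x" "m x" "u\<^sub>2 x"] elim by (simp add: m_def abs_mult mult.assoc)
    qed
  qed
  ultimately have rem: "exp_asymp (\<gamma> - \<kappa>) (\<gamma> + \<theta>)
      (\<lambda>x. binomial_rem (Suc (Suc K)) c (u\<^sub>1 x) - binomial_rem (Suc (Suc K)) c (u\<^sub>2 x))"
    by (rule exp_asymp_order[OF exp_order_dominated])
  have pow: "exp_asymp (\<gamma> - \<kappa>) (\<gamma> + \<theta>) (\<lambda>x. u\<^sub>1 x ^ (k + 2) - u\<^sub>2 x ^ (k + 2))" for k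
    by (rule exp_asymp_power_diff(2)[OF u d])
  have series: "exp_asymp (\<gamma> - \<kappa>) (\<gamma> + \<theta>)
      (\<lambda>x. (c gchoose (k + 2)) * (u\<^sub>1 x ^ (k + 2) - u\<^sub>2 x ^ (k + 2)))" for k
    by (rule exp_asymp_bounded_linear[OF bounded_linear_mult_right pow])
  have "exp_asymp (\<gamma> - \<kappa>) (\<gamma> + \<theta>)
      (\<lambda>x. \<Sum>k<K. (c gchoose (k + 2)) * (u\<^sub>1 x ^ (k + 2) - u\<^sub>2 x ^ (k + 2)))"
    by (rule exp_asymp_sum) (rule series)
  from exp_asymp_add[OF this rem] show ?thesis
    by (simp only: binomial_diff_expand[of _ c _ K])
qed

subsection \<open>The attraction law\<close>

definition attraction :: "real \<Rightarrow> 'a::real_inner \<Rightarrow> 'a" where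
  "attraction p x = (1 / norm x powr (p + 2)) *\<^sub>R x"

definition attraction_deriv :: "real \<Rightarrow> 'a::real_inner \<Rightarrow> 'a \<Rightarrow> 'a" where
  "attraction_deriv p c x = (1 / norm c powr (p + 2)) *\<^sub>R (x - ((p + 2) * (c \<bullet> x) / (c \<bullet> c)) *\<^sub>R c)"

text \<open>The number \<open>u\<close> with
  \<open>(c + x) \<bullet> (c + x) = (c \<bullet> c) * (1 + u)\<close>. It reduces powers of the
  norm to a binomial series in one real variable and, being polynomial in \<open>x\<close>, it
  preserves exponential polynomials.\<close>

definition rel_sq_incr :: "'a::real_inner \<Rightarrow> 'a \<Rightarrow> real" where
  "rel_sq_incr c x = (2 * (c \<bullet> x) + x \<bullet> x) / (c \<bullet> c)"

lemma attraction_scaleR: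
  assumes "s > 0"
  shows "attraction p (s *\<^sub>R x) = s powr (- p - 1) *\<^sub>R attraction p x"
proof -
  have "s powr (- p - 1) * s powr (p + 2) = s"
    using assms by (simp add: powr_add[symmetric])
  then have "s / s powr (p + 2) = s powr (- p - 1)"
    using assms by (simp add: field_simps)
  then show ?thesis
    using assms unfolding attraction_def by (simp add: powr_mult divide_divide_eq_left[symmetric] del: divide_divide_eq_left)
qed

lemma bounded_linear_attraction_deriv: "bounded_linear (attraction_deriv p c)"
proof -
  have "bounded_linear (\<lambda>x. (1 / norm c powr (p + 2)) *\<^sub>R (x - ((p + 2) / (c \<bullet> c) * (c \<bullet> x)) *\<^sub>R c))"
    by (intro bounded_linear_const_scaleR bounded_linear_sub bounded_linear_ident
      bounded_linear_scaleR_const bounded_linear_const_mult bounded_linear_inner_right)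
  then show ?thesis unfolding attraction_deriv_def[abs_def] by simp
qed

text \<open>\<open>attraction p\<close> is the gradient of \<open>- (norm x powr (- p)) / p\<close>,
  so its derivative is a Hessian.\<close>

lemma attraction_deriv_sym: "y \<bullet> attraction_deriv p c x = x \<bullet> attraction_deriv p c y"
  unfolding attraction_deriv_def by (simp add: inner_diff_right inner_commute mult_ac)

lemma attraction_deriv_minus: "attraction_deriv p (- c) = attraction_deriv p c"
  unfolding attraction_deriv_def by auto

lemma attraction_expand:
  assumes "c \<noteq> 0" "1 + rel_sq_incr c x > 0"
  shows "attraction p (c + x) =
    (1 / norm c powr (p + 2)) *\<^sub>R ((1 + rel_sq_incr c x) powr (- (p + 2) / 2) *\<^sub>R (c + x))"
proof -
  have "(c + x) \<bullet> (c + x) = (c \<bullet> c) * (1 + rel_sq_incr c x)"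
    using assms(1) unfolding rel_sq_incr_def by (simp add: field_simps inner_commute inner_add_left inner_add_right)
  then have "norm (c + x) = norm c * (1 + rel_sq_incr c x) powr (1/2)"
    using assms(2) by (simp add: norm_eq_sqrt_inner real_sqrt_mult powr_half_sqrt)
  then have 1: "norm (c + x) powr (p + 2) = norm c powr (p + 2) * (1 + rel_sq_incr c x) powr ((p + 2) / 2)"
    by (simp only: powr_mult powr_powr) simp
  have 2: "(1 + rel_sq_incr c x) powr (- (p + 2) / 2) = 1 / (1 + rel_sq_incr c x) powr ((p + 2) / 2)"
    by (metis minus_divide_left powr_minus_divide)
  show ?thesis
    unfolding attraction_def 1 2 by simp
qed

lemma rel_sq_incr_diff:
  "rel_sq_incr c x - rel_sq_incr c y = 2 * (c \<bullet> (x - y)) / (c \<bullet> c) + ((x - y) \<bullet> (x + y)) / (c \<bullet> c)"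
proof -
  have "2 * (c \<bullet> x) + x \<bullet> x - (2 * (c \<bullet> y) + y \<bullet> y) = 2 * (c \<bullet> (x - y)) + (x - y) \<bullet> (x + y)"
    by (simp add: inner_diff_left inner_diff_right inner_add_right inner_commute)
  then show ?thesis
    unfolding rel_sq_incr_def diff_divide_distrib[symmetric] add_divide_distrib[symmetric] by simp
qed

text \<open>The linear part of \<open>rel_sq_incr\<close> reproduces the radial part of
  \<open>attraction_deriv\<close>. Each of the four remaining terms is a difference times something
  that vanishes with \<open>x\<close> and \<open>y\<close>. The identity serves both the asymptotic
  expansion and the Lipschitz estimate.\<close>

lemma attraction_diff_expand:
  fixes c x y :: "'a::real_inner" and p :: real
  defines "s \<equiv> - (p + 2) / 2"
  defines "\<Phi> \<equiv> \<lambda>x. (1 + rel_sq_incr c x) powr s"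
  assumes "c \<noteq> 0" "1 + rel_sq_incr c x > 0" "1 + rel_sq_incr c y > 0"
  shows "attraction p (c + x) - attraction p (c + y) - attraction_deriv p c (x - y) =
    (1 / norm c powr (p + 2)) *\<^sub>R
      ((\<Phi> x - \<Phi> y - s * (rel_sq_incr c x - rel_sq_incr c y)) *\<^sub>R c
        + (s / (c \<bullet> c) * ((x - y) \<bullet> (x + y))) *\<^sub>R c + (\<Phi> x - \<Phi> y) *\<^sub>R x + (\<Phi> y - 1) *\<^sub>R (x - y))"
proof -
  have "attraction_deriv p c (x - y) =
      (1 / norm c powr (p + 2)) *\<^sub>R (x - y + (s * (2 * (c \<bullet> (x - y)) / (c \<bullet> c))) *\<^sub>R c)"
  proof -
    have "s * (2 * (c \<bullet> (x - y)) / (c \<bullet> c)) = - ((p + 2) * (c \<bullet> (x - y)) / (c \<bullet> c))"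
      using assms(3) unfolding s_def by (simp add: field_simps)
    then show ?thesis unfolding attraction_deriv_def by simp
  qed
  then have *: "attraction p (c + x) - attraction p (c + y) - attraction_deriv p c (x - y) =
    (1 / norm c powr (p + 2)) *\<^sub>R (\<Phi> x *\<^sub>R (c + x) - \<Phi> y *\<^sub>R (c + y)
       - (x - y + (s * (2 * (c \<bullet> (x - y)) / (c \<bullet> c))) *\<^sub>R c))"
    using attraction_expand[OF assms(3,4), of p] attraction_expand[OF assms(3,5), of p]
    unfolding \<Phi>_def s_def by (simp only: scaleR_diff_right)
  define z where "z = s * (2 * (c \<bullet> (x - y)) / (c \<bullet> c))"
  define U where "U = s * (rel_sq_incr c x - rel_sq_incr c y)"
  have zU: "s / (c \<bullet> c) * ((x - y) \<bullet> (x + y)) = U - z"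
    unfolding z_def U_def rel_sq_incr_diff by (simp add: distrib_left)
  show ?thesis
    unfolding * unfolding zU z_def[symmetric] U_def[symmetric]
    by (simp add: scaleR_diff_left scaleR_diff_right scaleR_add_right)
qed

lemma exp_asymp_rel_sq_incr:
  assumes "exp_asymp (-\<kappa>) \<theta> x" "\<kappa> > 0" "\<theta> \<le> -\<kappa>"
  shows "exp_asymp (-\<kappa>) \<theta> (\<lambda>t. rel_sq_incr c (x t))"
  unfolding rel_sq_incr_def
  by (intro exp_asymp_bounded_linear[OF bounded_linear_divide] exp_asymp_add
      exp_asymp_bounded_linear[OF bounded_linear_mult_right]
      exp_asymp_bounded_linear[OF bounded_linear_inner_right] assms
      exp_asymp_bilinear[OF bounded_bilinear_inner assms(1) assms(1)]) (use assms in auto)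

text \<open>Every term of the expanded difference contains one factor of exponent at most
  \<open>- \<kappa>\<close>, which is the gain in the first claim; adding the derivative back loses
  it and gives the second. Pairs inside a cluster use the first claim, pairs of different clusters
  the second.\<close>

lemma exp_asymp_attraction_diff:
  fixes x y :: "real \<Rightarrow> 'a::real_inner"
  assumes c: "c \<noteq> 0" and \<kappa>: "\<kappa> > 0" "\<theta> \<le> -\<kappa>"
    and xy: "exp_asymp (-\<kappa>) \<theta> x" "exp_asymp (-\<kappa>) \<theta> y"
    and d: "exp_asymp \<gamma> (\<gamma> + \<theta>) (\<lambda>t. x t - y t)"
  shows "exp_asymp (\<gamma> - \<kappa>) (\<gamma> + \<theta>)
      (\<lambda>t. attraction p (c + x t) - attraction p (c + y t) - attraction_deriv p c (x t - y t))"
    and "exp_asymp \<gamma> (\<gamma> + \<theta>) (\<lambda>t. attraction p (c + x t) - attraction p (c + y t))"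
proof -
  define s where "s = - (p + 2) / 2"
  define \<Phi> where "\<Phi> u = (1 + rel_sq_incr c u) powr s" for u
  define q where "q t = (x t - y t) \<bullet> (x t + y t)" for t
  define u where "u = (\<lambda>t. rel_sq_incr c (x t))"
  define w where "w = (\<lambda>t. rel_sq_incr c (y t))"
  have u: "exp_asymp (-\<kappa>) \<theta> u" and w: "exp_asymp (-\<kappa>) \<theta> w"
    unfolding u_def w_def by (intro exp_asymp_rel_sq_incr xy \<kappa>)+
  have q: "exp_asymp (\<gamma> - \<kappa>) (\<gamma> + \<theta>) q"
    unfolding q_def
    by (intro exp_asymp_bilinear[OF bounded_bilinear_inner d exp_asymp_add[OF xy]]) (use \<kappa> in auto)
  have uw: "exp_asymp \<gamma> (\<gamma> + \<theta>) (\<lambda>t. u t - w t)"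
    unfolding rel_sq_incr_diff u_def w_def q_def[symmetric]
    by (intro exp_asymp_add exp_asymp_bounded_linear[OF bounded_linear_divide]
        exp_asymp_mono[OF q] exp_asymp_bounded_linear[OF bounded_linear_mult_right]
        exp_asymp_bounded_linear[OF bounded_linear_inner_right] d) (use \<kappa> in auto)
  have lin: "exp_asymp (\<gamma> - \<kappa>) (\<gamma> + \<theta>) (\<lambda>t. \<Phi> (x t) - \<Phi> (y t) - s * (u t - w t))"
    using exp_asymp_powr_diff[OF u w \<kappa> uw, of s] unfolding \<Phi>_def u_def w_def .
  have "exp_asymp \<gamma> (\<gamma> + \<theta>) (\<lambda>t. (\<Phi> (x t) - \<Phi> (y t) - s * (u t - w t)) + s * (u t - w t))"
    by (intro exp_asymp_add exp_asymp_mono[OF lin] exp_asymp_bounded_linear[OF bounded_linear_mult_right] uw)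
      (use \<kappa> in auto)
  then have \<Phi>: "exp_asymp \<gamma> (\<gamma> + \<theta>) (\<lambda>t. \<Phi> (x t) - \<Phi> (y t))"
    by simp
  \<comment> \<open>The same expansion compares \<open>w\<close> with the zero function, at level
    \<open>\<gamma> = 0\<close>.\<close>
  have "exp_asymp (0 - \<kappa>) (0 + \<theta>) (\<lambda>t. (1 + w t) powr s - (1 + 0) powr s - s * (w t - 0))"
    by (intro exp_asymp_powr_diff exp_asymp_zero w \<kappa>) (use exp_asymp_mono[OF w] \<kappa> in auto)
  then have "exp_asymp (- \<kappa>) \<theta> (\<lambda>t. (\<Phi> (y t) - 1 - s * w t) + s * w t)"
    by (intro exp_asymp_add exp_asymp_bounded_linear[OF bounded_linear_mult_right] w)
      (simp add: \<Phi>_def w_def)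
  then have \<Phi>1: "exp_asymp (- \<kappa>) \<theta> (\<lambda>t. \<Phi> (y t) - 1)"
    by simp
  have "exp_asymp (\<gamma> - \<kappa>) (\<gamma> + \<theta>) (\<lambda>t. (1 / norm c powr (p + 2)) *\<^sub>R
      ((\<Phi> (x t) - \<Phi> (y t) - s * (u t - w t)) *\<^sub>R c + (s / (c \<bullet> c) * q t) *\<^sub>R c
        + (\<Phi> (x t) - \<Phi> (y t)) *\<^sub>R x t + (\<Phi> (y t) - 1) *\<^sub>R (x t - y t)))"
    by (intro exp_asymp_bounded_linear[OF bounded_linear_scaleR_right] exp_asymp_add
        exp_asymp_bounded_linear[OF bounded_linear_scaleR_left] lin
        exp_asymp_bounded_linear[OF bounded_linear_mult_right] q
        exp_asymp_bilinear[OF bounded_bilinear_scaleR \<Phi> xy(1)]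
        exp_asymp_bilinear[OF bounded_bilinear_scaleR \<Phi>1 d]) (use \<kappa> in auto)
  then show main: "exp_asymp (\<gamma> - \<kappa>) (\<gamma> + \<theta>)
      (\<lambda>t. attraction p (c + x t) - attraction p (c + y t) - attraction_deriv p c (x t - y t))"
  proof (rule exp_asymp_cong)
    \<comment> \<open>The expansion holds once \<open>1 + u\<close> and \<open>1 + w\<close> are
      positive, which is the case for late times.\<close>
    have "(u \<longlongrightarrow> 0) at_top" "(w \<longlongrightarrow> 0) at_top"
      using u w \<kappa> by (auto intro!: exp_order_tendsto_0[of "-\<kappa>"] exp_asymp_imp_order)
    then have "\<forall>\<^sub>F t in at_top. u t > -1" "\<forall>\<^sub>F t in at_top. w t > -1"
      by (auto intro: order_tendstoD)
    then show "\<forall>\<^sub>F t in at_top. (1 / norm c powr (p + 2)) *\<^sub>R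
      ((\<Phi> (x t) - \<Phi> (y t) - s * (u t - w t)) *\<^sub>R c + (s / (c \<bullet> c) * q t) *\<^sub>R c
        + (\<Phi> (x t) - \<Phi> (y t)) *\<^sub>R x t + (\<Phi> (y t) - 1) *\<^sub>R (x t - y t)) =
      attraction p (c + x t) - attraction p (c + y t) - attraction_deriv p c (x t - y t)"
      by eventually_elim
        (subst attraction_diff_expand[OF c], auto simp: u_def w_def \<Phi>_def s_def q_def)
  qed
  have "exp_asymp \<gamma> (\<gamma> + \<theta>) (\<lambda>t. (attraction p (c + x t) - attraction p (c + y t)
      - attraction_deriv p c (x t - y t)) + attraction_deriv p c (x t - y t))"
    by (intro exp_asymp_add exp_asymp_mono[OF main] exp_asymp_bounded_linear[OF bounded_linear_attraction_deriv] d)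
      (use \<kappa> in auto)
  then show "exp_asymp \<gamma> (\<gamma> + \<theta>) (\<lambda>t. attraction p (c + x t) - attraction p (c + y t))"
    by simp
qed

text \<open>Strict differentiability at \<open>c\<close> with a linear modulus. The contraction
  compares arbitrary functions inside a weighted ball, for which no exponential expansion is at
  hand.\<close>

lemma attraction_strict_deriv:
  fixes c :: "'a::real_inner"
  assumes c: "c \<noteq> 0"
  obtains K \<rho>\<^sub>0 where "K \<ge> 0" "\<rho>\<^sub>0 > 0"
    "\<And>x y \<rho>. norm x \<le> \<rho> \<Longrightarrow> norm y \<le> \<rho> \<Longrightarrow> \<rho> \<le> \<rho>\<^sub>0 \<Longrightarrow>
      norm (attraction p (c + x) - attraction p (c + y) - attraction_deriv p c (x - y)) \<le> K * \<rho> * norm (x - y)"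
proof -
  define s where "s = - (p + 2) / 2"
  define \<Phi> where "\<Phi> u = (1 + rel_sq_incr c u) powr s" for u
  define L where "L = norm c"
  have L: "L > 0" "c \<bullet> c = L\<^sup>2" using c by (auto simp: L_def power2_norm_eq_inner)
  obtain C where C: "0 \<le> C" "\<And>u\<^sub>1 u\<^sub>2 m. \<bar>u\<^sub>1\<bar> \<le> m \<Longrightarrow> \<bar>u\<^sub>2\<bar> \<le> m \<Longrightarrow> m \<le> 1/2 \<Longrightarrow>
    \<bar>(1 + u\<^sub>1) powr s - (1 + u\<^sub>2) powr s - s * (u\<^sub>1 - u\<^sub>2)\<bar> \<le> C * m * \<bar>u\<^sub>1 - u\<^sub>2\<bar>"
    using binomial_linear_approx[of s] by blast
  \<comment> \<open>One summand for each of the four terms of the expansion: \<open>3 / L\<close>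
    bounds \<open>rel_sq_incr\<close> on the ball relative to its radius, \<open>4 / L\<close> is
    its Lipschitz constant there.\<close>
  define B where "B = C * (3 / L) * (4 / L) * L + \<bar>s\<bar> * 2 / L
      + (C + \<bar>s\<bar>) * (4 / L) + (C + \<bar>s\<bar>) * (3 / L)"
  define K where "K = 1 / L powr (p + 2) * B"
  \<comment> \<open>The radius \<open>L / 6\<close> makes the increments at most
    \<open>3 / L * \<rho> \<le> 1/2\<close>, the range of the binomial estimate.\<close>
  have "norm (attraction p (c + x) - attraction p (c + y) - attraction_deriv p c (x - y)) \<le> K * \<rho> * norm (x - y)"
    if xy: "norm x \<le> \<rho>" "norm y \<le> \<rho>" "\<rho> \<le> L / 6" for x y \<rho>
  proof -
    define D where "D = norm (x - y)"
    define u where "u = rel_sq_incr c x"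
    define w where "w = rel_sq_incr c y"
    have \<rho>: "0 \<le> \<rho>" using xy norm_ge_zero order_trans by blast
    have incr: "\<bar>rel_sq_incr c z\<bar> \<le> 3 / L * \<rho>" if "norm z \<le> \<rho>" for z
    proof -
      have "\<bar>c \<bullet> z\<bar> \<le> L * \<rho>" "\<bar>z \<bullet> z\<bar> \<le> \<rho> * \<rho>"
        using that Cauchy_Schwarz_ineq2[of c z] mult_left_mono[OF that, of "norm c"]
          mult_mono[OF that that \<rho> norm_ge_zero] Cauchy_Schwarz_ineq2[of z z]
        unfolding L_def by (linarith | simp)+
      moreover have "\<rho> * \<rho> \<le> L * \<rho>" using xy L \<rho> by (intro mult_right_mono) auto
      ultimately have "\<bar>2 * (c \<bullet> z) + z \<bullet> z\<bar> \<le> 3 * L * \<rho>" by linarith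
      then have "\<bar>2 * (c \<bullet> z) + z \<bullet> z\<bar> / L\<^sup>2 \<le> 3 * L * \<rho> / L\<^sup>2" by (intro divide_right_mono) auto
      then show ?thesis unfolding rel_sq_incr_def L(2) using L by (simp add: power2_eq_square)
    qed
    define m where "m = 3 / L * \<rho>"
    have m: "\<bar>u\<bar> \<le> m" "\<bar>w\<bar> \<le> m" "0 \<le> m" "m \<le> 1/2"
      using incr xy L \<rho> unfolding m_def u_def w_def by (auto simp: field_simps)
    have xy2: "\<bar>(x - y) \<bullet> (x + y)\<bar> \<le> D * (2 * \<rho>)"
    proof -
      have "norm (x + y) \<le> 2 * \<rho>" using xy norm_triangle_ineq[of x y] by linarith
      then show ?thesis
        using Cauchy_Schwarz_ineq2[of "x - y" "x + y"] unfolding D_def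
        by (meson mult_left_mono norm_ge_zero order_trans)
    qed
    have uw: "\<bar>u - w\<bar> \<le> 4 / L * D"
    proof -
      have "\<bar>c \<bullet> (x - y)\<bar> \<le> L * D" using Cauchy_Schwarz_ineq2[of c "x - y"] by (simp add: L_def D_def)
      moreover have "D * (2 * \<rho>) \<le> D * (2 * L)" using xy L \<rho> by (intro mult_left_mono) (auto simp: D_def)
      ultimately have "\<bar>2 * (c \<bullet> (x - y)) + (x - y) \<bullet> (x + y)\<bar> \<le> 4 * L * D"
        using xy2 by (simp add: mult_ac)
      then have "\<bar>2 * (c \<bullet> (x - y)) + (x - y) \<bullet> (x + y)\<bar> / L\<^sup>2 \<le> 4 * L * D / L\<^sup>2"
        by (intro divide_right_mono) auto
      then show ?thesis unfolding u_def w_def rel_sq_incr_diff L(2) add_divide_distrib[symmetric]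
        using L by (simp add: power2_eq_square)
    qed
    have D0: "D \<ge> 0" by (simp add: D_def)
    have lin: "\<bar>\<Phi> x - \<Phi> y - s * (u - w)\<bar> \<le> C * m * (4 / L * D)"
      using C(2)[OF m(1,2,4)] mult_left_mono[OF uw, of "C * m"] C m
      unfolding \<Phi>_def u_def w_def by (force intro: order_trans)
    have \<Phi>xy: "\<bar>\<Phi> x - \<Phi> y\<bar> \<le> (C + \<bar>s\<bar>) * (4 / L * D)"
    proof -
      have "C * m * (4 / L * D) \<le> C * 1 * (4 / L * D)"
        using C m L D0 by (intro mult_right_mono mult_left_mono) auto
      moreover have "\<bar>s * (u - w)\<bar> \<le> \<bar>s\<bar> * (4 / L * D)"
        unfolding abs_mult by (intro mult_left_mono uw) auto
      ultimately show ?thesis using lin unfolding distrib_right by linarith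
    qed
    have \<Phi>1: "\<bar>\<Phi> y - 1\<bar> \<le> (C + \<bar>s\<bar>) * m"
    proof -
      have "\<bar>\<Phi> y - 1 - s * w\<bar> \<le> C * m * \<bar>w\<bar>"
        using C(2)[of w m 0] m unfolding \<Phi>_def w_def by simp
      also have "\<dots> \<le> C * 1 * m" using C m by (intro mult_mono) auto
      finally have "\<bar>\<Phi> y - 1 - s * w\<bar> \<le> C * m" by simp
      moreover have "\<bar>s * w\<bar> \<le> \<bar>s\<bar> * m" unfolding abs_mult by (intro mult_left_mono m) auto
      ultimately show ?thesis unfolding distrib_right by linarith
    qed
    define V where "V = (\<Phi> x - \<Phi> y - s * (u - w)) *\<^sub>R c + (s / (c \<bullet> c) * ((x - y) \<bullet> (x + y))) *\<^sub>R c
        + (\<Phi> x - \<Phi> y) *\<^sub>R x + (\<Phi> y - 1) *\<^sub>R (x - y)"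
    have "norm V
      \<le> \<bar>\<Phi> x - \<Phi> y - s * (u - w)\<bar> * L + \<bar>s\<bar> / L\<^sup>2 * \<bar>(x - y) \<bullet> (x + y)\<bar> * L
        + \<bar>\<Phi> x - \<Phi> y\<bar> * norm x + \<bar>\<Phi> y - 1\<bar> * D"
      unfolding V_def by (intro norm_triangle_le add_mono) (auto simp: L_def[symmetric] D_def L(2) abs_mult)
    also have "\<dots> \<le> C * m * (4 / L * D) * L + \<bar>s\<bar> / L\<^sup>2 * (D * (2 * \<rho>)) * L
        + (C + \<bar>s\<bar>) * (4 / L * D) * \<rho> + (C + \<bar>s\<bar>) * m * D"
      using lin xy2 \<Phi>xy \<Phi>1 xy L D0 C
      by (intro add_mono mult_mono mult_right_mono mult_left_mono) auto
    also have "\<dots> = B * \<rho> * D"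
      using L by (simp add: B_def m_def field_simps power2_eq_square)
    finally have "1 / L powr (p + 2) * norm V \<le> 1 / L powr (p + 2) * (B * \<rho> * D)"
      by (intro mult_left_mono) simp_all
    moreover have "1 + u > 0" "1 + w > 0" using m by auto
    then have "attraction p (c + x) - attraction p (c + y) - attraction_deriv p c (x - y)
        = (1 / L powr (p + 2)) *\<^sub>R V"
      using attraction_diff_expand[OF c, of x y p]
      unfolding V_def by (simp only: \<Phi>_def s_def u_def w_def L_def)
    ultimately show ?thesis by (simp add: K_def D_def mult.assoc)
  qed
  moreover have "K \<ge> 0" unfolding K_def B_def using L C by simp
  ultimately show ?thesis using that[of K "L / 6"] L by simp
qed

subsection \<open>Diagonalisation of self-adjoint maps\<close>

text \<open>A maximiser of the quadratic form on the unit sphere of \<open>S\<close> is an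
  eigenvector; otherwise moving it along the residual \<open>f x - \<mu> *\<^sub>R x\<close> would
  increase the Rayleigh quotient.\<close>

lemma self_adjoint_eigenvector:
  fixes f :: "'a::euclidean_space \<Rightarrow> 'a"
  assumes f: "linear f" "\<And>x y. x \<bullet> f y = f x \<bullet> y"
    and S: "subspace S" "f ` S \<subseteq> S" "S \<noteq> {0}"
  obtains x \<mu> where "x \<in> S" "norm x = 1" "f x = \<mu> *\<^sub>R x"
proof -
  interpret linear f by fact
  have "compact (S \<inter> sphere 0 1)"
    using closed_subspace[OF S(1)] by (metis compact_Int_closed compact_sphere inf_commute)
  moreover have "S \<inter> sphere 0 1 \<noteq> {}"
  proof -
    obtain y where y: "y \<in> S" "y \<noteq> 0"
      using S subspace_0 by blast
    then have "(1 / norm y) *\<^sub>R y \<in> S \<inter> sphere 0 1"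
      using S(1) by (simp add: subspace_scale)
    then show ?thesis by blast
  qed
  moreover have "continuous_on (S \<inter> sphere 0 1) (\<lambda>x. x \<bullet> f x)"
    by (intro continuous_intros linear_continuous_on linear_conv_bounded_linear[THEN iffD1, OF f(1)])
  ultimately obtain x where x: "x \<in> S \<inter> sphere 0 1" and
    max: "\<And>y. y \<in> S \<inter> sphere 0 1 \<Longrightarrow> y \<bullet> f y \<le> x \<bullet> f x"
    using continuous_attains_sup by metis
  define \<mu> where "\<mu> = x \<bullet> f x"
  have le: "y \<bullet> f y \<le> \<mu> * (y \<bullet> y)" if "y \<in> S" for y
  proof (cases "y = 0")
    case False
    have "(1 / norm y) *\<^sub>R y \<in> S \<inter> sphere 0 1"
      using that False S(1) by (simp add: subspace_scale)
    from max[OF this] have "(y \<bullet> f y) / (norm y)\<^sup>2 \<le> \<mu>"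
      by (simp add: \<mu>_def scale power2_eq_square)
    then show ?thesis using False by (simp add: power2_norm_eq_inner divide_le_eq)
  qed (simp add: zero)
  define y where "y = f x - \<mu> *\<^sub>R x"
  have yS: "y \<in> S" using x S by (auto simp: y_def intro: subspace_diff subspace_scale)
  have xx: "x \<bullet> x = 1" using x by (simp add: dot_square_norm)
  \<comment> \<open>Maximality compared with \<open>x + t *\<^sub>R y\<close>: the gain is linear in
    \<open>t\<close> with slope \<open>2 * (y \<bullet> y)\<close>, the loss is quadratic.\<close>
  have key: "2 * t * (y \<bullet> y) \<le> t\<^sup>2 * (\<mu> * (y \<bullet> y) - y \<bullet> f y)" for t
  proof -
    have "x + t *\<^sub>R y \<in> S" using x yS S(1) by (auto intro: subspace_add subspace_scale)
    from le[OF this] have "x \<bullet> f x + t * (x \<bullet> f y) + t * (y \<bullet> f x) + t * t * (y \<bullet> f y)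
        \<le> \<mu> * (x \<bullet> x + 2 * t * (x \<bullet> y) + t * t * (y \<bullet> y))"
      by (simp add: add scale inner_add_left inner_add_right inner_commute algebra_simps)
    moreover have "x \<bullet> f y = y \<bullet> f x" using f(2)[of x y] by (simp add: inner_commute)
    moreover have "y \<bullet> f x = y \<bullet> y + \<mu> * (x \<bullet> y)"
      by (simp add: y_def inner_diff_left inner_diff_right inner_commute algebra_simps)
    ultimately show ?thesis using xx by (simp add: \<mu>_def[symmetric] algebra_simps power2_eq_square)
  qed
  have "y \<bullet> y = 0"
  proof (rule ccontr)
    assume "y \<bullet> y \<noteq> 0"
    then have pos: "y \<bullet> y > 0" by simp
    \<comment> \<open>With \<open>t = (y \<bullet> y) / K\<close> the quadratic side is at most
      \<open>t * (y \<bullet> y)\<close>, half of the linear side.\<close>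
    define K where "K = \<bar>\<mu> * (y \<bullet> y) - y \<bullet> f y\<bar> + 1"
    define t where "t = (y \<bullet> y) / K"
    have K: "K > 0" "\<mu> * (y \<bullet> y) - y \<bullet> f y \<le> K" by (auto simp: K_def)
    have t: "t > 0" using pos K by (simp add: t_def)
    have "2 * t * (y \<bullet> y) \<le> t\<^sup>2 * K"
      using key[of t] mult_left_mono[OF K(2), of "t\<^sup>2"] by simp
    also have "\<dots> = t * (y \<bullet> y)" using K by (simp add: t_def power2_eq_square)
    finally show False using t pos by simp
  qed
  then have "f x = \<mu> *\<^sub>R x" by (simp add: y_def)
  then show ?thesis using that x by auto
qed

text \<open>Induction on the dimension: the orthogonal complement of an eigenvector within
  \<open>S\<close> is again invariant because \<open>f\<close> is self-adjoint.\<close>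

lemma self_adjoint_eigenbasis:
  fixes f :: "'a::euclidean_space \<Rightarrow> 'a"
  assumes f: "linear f" "\<And>x y. x \<bullet> f y = f x \<bullet> y"
    and "subspace S" "f ` S \<subseteq> S"
  shows "\<exists>B. finite B \<and> pairwise orthogonal B \<and> span B = S \<and> (\<forall>b\<in>B. norm b = 1 \<and> (\<exists>\<mu>. f b = \<mu> *\<^sub>R b))"
  using assms(3,4)
proof (induction "dim S" arbitrary: S rule: less_induct)
  case less
  show ?case
  proof (cases "S = {0}")
    case True
    then show ?thesis by (intro exI[of _ "{}"]) auto
  next
    case False
    obtain x \<mu> where x: "x \<in> S" "norm x = 1" "f x = \<mu> *\<^sub>R x"
      using self_adjoint_eigenvector[OF f less.prems False] .
    have xx: "x \<bullet> x = 1" using x by (simp add: dot_square_norm)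
    define S' where "S' = {y \<in> S. x \<bullet> y = 0}"
    have sub: "subspace S'"
      using less.prems(1) unfolding S'_def subspace_def by (auto simp: inner_add_right)
    have inv: "f ` S' \<subseteq> S'"
      using less.prems(2) x(3) unfolding S'_def by (auto simp: f(2))
    have "S' \<subseteq> S" "x \<notin> S'" using xx unfolding S'_def by auto
    then have "S' \<subset> S" using x(1) by blast
    then have "dim S' < dim S"
      using sub less.prems(1) by (metis dim_psubset span_eq_iff)
    from less.hyps[OF this sub inv] obtain B where B: "finite B" "pairwise orthogonal B" "span B = S'"
        "\<forall>b\<in>B. norm b = 1 \<and> (\<exists>\<mu>. f b = \<mu> *\<^sub>R b)" by blast
    have BS': "B \<subseteq> S'" using B(3) span_superset by blast
    have "pairwise orthogonal (insert x B)"
      using B(2) BS' unfolding S'_def pairwise_insert by (auto simp: orthogonal_def inner_commute)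
    moreover have "span (insert x B) = S"
    proof
      show "span (insert x B) \<subseteq> S"
        using BS' x less.prems(1) unfolding S'_def by (intro span_minimal) auto
      show "S \<subseteq> span (insert x B)"
      proof
        fix y assume y: "y \<in> S"
        have "y - (x \<bullet> y) *\<^sub>R x \<in> S'"
          using y x xx less.prems(1) unfolding S'_def
          by (auto simp: inner_diff_right intro: subspace_diff subspace_scale)
        then show "y \<in> span (insert x B)" using B(3) by (auto simp: span_insert)
      qed
    qed
    ultimately show ?thesis using B x by (intro exI[of _ "insert x B"]) auto
  qed
qed

text \<open>Encoded as a resolution of the identity by eigenvectors and bounded coordinate
  functionals, the form in which a vector equation decouples into scalar ones.\<close>

definition diagonalizable :: "('a::real_normed_vector \<Rightarrow> 'a) \<Rightarrow> bool" where
  "diagonalizable A \<longleftrightarrow> (\<exists>(B::'a set) \<phi> \<mu>. finite B \<and>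
      (\<forall>b\<in>B. bounded_linear (\<phi> b) \<and> A b = \<mu> b *\<^sub>R b) \<and> (\<forall>w. w = (\<Sum>b\<in>B. \<phi> b w *\<^sub>R b)))"

text \<open>Self-adjointness for the inner product \<open>D x \<bullet> D y\<close> suffices: an
  orthonormal eigenbasis of the conjugate is pulled back by \<open>D'\<close>.\<close>

lemma diagonalizable_conjugate:
  fixes A D :: "'a::euclidean_space \<Rightarrow> 'a"
  assumes lin: "linear A" "linear D" "linear D'"
    and inv: "\<And>x. D (D' x) = x" "\<And>x. D' (D x) = x"
    and sym: "\<And>x y. x \<bullet> D (A (D' y)) = D (A (D' x)) \<bullet> y"
  shows "diagonalizable A"
proof -
  have lf: "linear (\<lambda>x. D (A (D' x)))"
    using linear_compose[OF linear_compose[OF lin(3,1)] lin(2)] by (simp add: o_def)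
  obtain B where B: "finite B" "pairwise orthogonal B" "span B = UNIV"
      "\<forall>b\<in>B. norm b = 1 \<and> (\<exists>\<mu>. D (A (D' b)) = \<mu> *\<^sub>R b)"
    using self_adjoint_eigenbasis[OF lf sym subspace_UNIV] by auto
  then obtain \<mu> where \<mu>: "\<And>b. b \<in> B \<Longrightarrow> D (A (D' b)) = \<mu> b *\<^sub>R b" by metis
  have injD': "inj D'" using inv by (metis injI)
  show ?thesis
    unfolding diagonalizable_def
  proof (intro exI conjI ballI allI)
    show "finite (D' ` B)" using B by simp
    fix b assume b: "b \<in> D' ` B"
    show "bounded_linear (\<lambda>w. D w \<bullet> D b)"
      using bounded_linear_compose[OF bounded_linear_inner_left linear_conv_bounded_linear[THEN iffD1, OF lin(2)]]
      by blast
    have "D (A b) = \<mu> (D b) *\<^sub>R D b" using b \<mu> inv by auto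
    then have "D' (D (A b)) = \<mu> (D b) *\<^sub>R D' (D b)" by (simp add: linear_scale[OF lin(3)])
    then show "A b = \<mu> (D b) *\<^sub>R b" by (simp add: inv)
  next
    fix w
    have "(\<Sum>b\<in>D' ` B. (D w \<bullet> D b) *\<^sub>R b) = (\<Sum>b\<in>B. (D w \<bullet> b) *\<^sub>R D' b)"
      by (subst sum.reindex) (auto simp: inv intro: inj_on_subset[OF injD'])
    also have "\<dots> = D' (\<Sum>b\<in>B. (D w \<bullet> b) *\<^sub>R b)"
      by (simp add: linear_sum[OF lin(3)] linear_scale[OF lin(3)])
    also have "(\<Sum>b\<in>B. (D w \<bullet> b) *\<^sub>R b) = D w"
      by (rule orthonormal_basis_expand) (use B in auto)
    finally show "w = (\<Sum>b\<in>D' ` B. (D w \<bullet> D b) *\<^sub>R b)" by (simp add: inv)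
  qed
qed

subsection \<open>Linear equations with exponential-polynomial right-hand sides\<close>

text \<open>At resonance, \<open>s = q\<close>, the power of \<open>x\<close> rises by one;
  otherwise one divides by \<open>q - s\<close> and descends in \<open>k\<close>. Only a particular
  solution is taken, so its exponents stay real even for complex \<open>s\<close>.\<close>

lemma exp_poly_first_order_single:
  fixes s y :: complex
  assumes "q \<le> \<gamma>"
  shows "\<exists>u. exp_poly \<gamma> u \<and>
    (\<forall>x. (u has_vector_derivative s * u x + (exp (q * x) * x ^ k) *\<^sub>R y) (at x))"
proof (cases "s = complex_of_real q")
  case True
  have "((\<lambda>x. (exp (q * x) * x ^ Suc k) *\<^sub>R (y / of_nat (Suc k))) has_vector_derivative
      s * ((exp (q * x) * x ^ Suc k) *\<^sub>R (y / of_nat (Suc k))) + (exp (q * x) * x ^ k) *\<^sub>R y) (at x)" for x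
  proof (rule has_vector_derivative_eq_rhs)
    have "((\<lambda>x. exp (q * x) * x ^ Suc k) has_real_derivative
        q * (exp (q * x) * x ^ Suc k) + (exp (q * x) * x ^ k) * real (Suc k)) (at x)"
      by (auto intro!: derivative_eq_intros simp: algebra_simps simp del: power_Suc)
    then show "((\<lambda>x. (exp (q * x) * x ^ Suc k) *\<^sub>R (y / of_nat (Suc k))) has_vector_derivative
        (exp (q * x) * x ^ Suc k) *\<^sub>R 0 + (q * (exp (q * x) * x ^ Suc k) + (exp (q * x) * x ^ k) * real (Suc k))
          *\<^sub>R (y / of_nat (Suc k))) (at x)"
      by (intro has_vector_derivative_scaleR has_vector_derivative_const)
    have "real (Suc k) *\<^sub>R (y / of_nat (Suc k)) = y"
      by (simp add: scaleR_conv_of_real del: of_nat_Suc)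
    then show "(exp (q * x) * x ^ Suc k) *\<^sub>R 0 + (q * (exp (q * x) * x ^ Suc k) + (exp (q * x) * x ^ k) * real (Suc k))
          *\<^sub>R (y / of_nat (Suc k)) = s * ((exp (q * x) * x ^ Suc k) *\<^sub>R (y / of_nat (Suc k))) + (exp (q * x) * x ^ k) *\<^sub>R y"
      using True by (simp add: scaleR_conv_of_real field_simps del: power_Suc of_nat_Suc)
  qed
  then show ?thesis
    using exp_poly_term[OF assms, of "Suc k" "y / of_nat (Suc k)"] by blast
next
  case False
  define c where "c = complex_of_real q - s"
  have c: "c \<noteq> 0" using False by (simp add: c_def)
  show ?thesis
  proof (induction k arbitrary: y)
    case 0
    have "((\<lambda>x. (exp (q * x) * x ^ 0) *\<^sub>R (y / c)) has_vector_derivative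
        s * ((exp (q * x) * x ^ 0) *\<^sub>R (y / c)) + (exp (q * x) * x ^ 0) *\<^sub>R y) (at x)" for x
    proof (rule has_vector_derivative_eq_rhs)
      have "((\<lambda>x. exp (q * x) * x ^ 0) has_real_derivative q * exp (q * x)) (at x)"
        by (auto intro!: derivative_eq_intros)
      then show "((\<lambda>x. (exp (q * x) * x ^ 0) *\<^sub>R (y / c)) has_vector_derivative
          (exp (q * x) * x ^ 0) *\<^sub>R 0 + (q * exp (q * x)) *\<^sub>R (y / c)) (at x)"
        by (intro has_vector_derivative_scaleR has_vector_derivative_const)
      show "(exp (q * x) * x ^ 0) *\<^sub>R 0 + (q * exp (q * x)) *\<^sub>R (y / c) =
          s * ((exp (q * x) * x ^ 0) *\<^sub>R (y / c)) + (exp (q * x) * x ^ 0) *\<^sub>R y"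
        using c by (simp add: scaleR_conv_of_real field_simps) (simp add: c_def algebra_simps)
    qed
    then show ?case using exp_poly_term[OF assms, of 0 "y / c"] by blast
  next
    case (Suc k)
    \<comment> \<open>\<open>v\<close> removes the lower power that arises when
      \<open>x ^ Suc k\<close> is differentiated.\<close>
    obtain v where v: "exp_poly \<gamma> v" "\<And>x. (v has_vector_derivative s * v x +
        (exp (q * x) * x ^ k) *\<^sub>R (- (of_nat (Suc k) * y / c))) (at x)"
      using Suc.IH by blast
    have "((\<lambda>x. v x + (exp (q * x) * x ^ Suc k) *\<^sub>R (y / c)) has_vector_derivative
        s * (v x + (exp (q * x) * x ^ Suc k) *\<^sub>R (y / c)) + (exp (q * x) * x ^ Suc k) *\<^sub>R y) (at x)" for x
    proof (rule has_vector_derivative_eq_rhs)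
      have "((\<lambda>x. exp (q * x) * x ^ Suc k) has_real_derivative
        q * (exp (q * x) * x ^ Suc k) + (exp (q * x) * x ^ k) * real (Suc k)) (at x)"
        by (auto intro!: derivative_eq_intros simp: algebra_simps simp del: power_Suc)
      then show "((\<lambda>x. v x + (exp (q * x) * x ^ Suc k) *\<^sub>R (y / c)) has_vector_derivative
          (s * v x + (exp (q * x) * x ^ k) *\<^sub>R (- (of_nat (Suc k) * y / c))) +
          ((exp (q * x) * x ^ Suc k) *\<^sub>R 0 + (q * (exp (q * x) * x ^ Suc k) + (exp (q * x) * x ^ k) * real (Suc k))
          *\<^sub>R (y / c))) (at x)"
        by (intro has_vector_derivative_add v has_vector_derivative_scaleR has_vector_derivative_const)
      have "complex_of_real q * (y / c) = s * (y / c) + y"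
        using c by (simp add: field_simps) (simp add: c_def algebra_simps)
      then have "(q * (exp (q * x) * x ^ Suc k)) *\<^sub>R (y / c) =
          (exp (q * x) * x ^ Suc k) *\<^sub>R (s * (y / c) + y)"
        by (metis mult.commute scaleR_conv_of_real scaleR_scaleR)
      then show "(s * v x + (exp (q * x) * x ^ k) *\<^sub>R (- (of_nat (Suc k) * y / c))) +
          ((exp (q * x) * x ^ Suc k) *\<^sub>R 0 + (q * (exp (q * x) * x ^ Suc k) + (exp (q * x) * x ^ k) * real (Suc k))
          *\<^sub>R (y / c)) = s * (v x + (exp (q * x) * x ^ Suc k) *\<^sub>R (y / c)) + (exp (q * x) * x ^ Suc k) *\<^sub>R y"
        by (simp add: scaleR_add_left scaleR_add_right distrib_left del: power_Suc of_nat_Suc)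
          (simp add: scaleR_conv_of_real)
    qed
    moreover have "exp_poly \<gamma> (\<lambda>x. v x + (exp (q * x) * x ^ Suc k) *\<^sub>R (y / c))"
      by (rule exp_poly_step[OF v(1) assms])
    ultimately show ?case by blast
  qed
qed

lemma exp_poly_first_order:
  fixes s :: complex
  assumes "exp_poly \<gamma> h"
  shows "\<exists>u. exp_poly \<gamma> u \<and> (\<forall>x. (u has_vector_derivative s * u x + h x) (at x))"
  using assms
proof induction
  case exp_poly_zero
  show ?case by (intro exI[of _ "\<lambda>_. 0"]) (auto intro: exp_poly.exp_poly_zero)
next
  case (exp_poly_step h q k y)
  obtain u where u: "exp_poly \<gamma> u" "\<And>x. (u has_vector_derivative s * u x + h x) (at x)"
    using exp_poly_step by blast
  obtain v where v: "exp_poly \<gamma> v"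
      "\<And>x. (v has_vector_derivative s * v x + (exp (q * x) * x ^ k) *\<^sub>R y) (at x)"
    using exp_poly_first_order_single[OF exp_poly_step(2)] by blast
  have "((\<lambda>x. u x + v x) has_vector_derivative s * (u x + v x) + (h x + (exp (q * x) * x ^ k) *\<^sub>R y)) (at x)" for x
    using has_vector_derivative_add[OF u(2) v(2)] by (simp add: distrib_left add_ac)
  then show ?case using exp_poly_add[OF u(1) v(1)] by blast
qed

text \<open>With \<open>s * (1 - s) = \<mu>\<close> the operator \<open>u'' - u' + \<mu> u\<close>
  factors into first-order operators with roots \<open>s\<close> and \<open>1 - s\<close>. The roots
  are not real for \<open>\<mu> > 1/4\<close>, hence the complex square root.\<close>

definition char_root :: "real \<Rightarrow> complex" where
  "char_root \<mu> = 1 / 2 + csqrt (1 / 4 - complex_of_real \<mu>)"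

lemma char_root: "char_root \<mu> * (1 - char_root \<mu>) = complex_of_real \<mu>"
proof -
  have "char_root \<mu> * (1 - char_root \<mu>) = 1 / 4 - (csqrt (1 / 4 - complex_of_real \<mu>))\<^sup>2"
    by (simp add: char_root_def power2_eq_square algebra_simps)
  then show ?thesis by simp
qed

text \<open>The two factors are inverted one after the other; since \<open>\<mu>\<close> and
  \<open>h\<close> are real, the real part solves the same equation. The set \<open>X\<close> allows
  both the whole line, for exponential polynomials, and a half-line, for decaying solutions.\<close>

lemma second_order_from_first_order:
  fixes v u :: "real \<Rightarrow> complex" and h \<mu> :: real
  defines "s \<equiv> char_root \<mu>"
  assumes v: "(v has_vector_derivative s * v x + of_real h) (at x within X)"
    and u: "(u has_vector_derivative (1 - s) * u x + v x) (at x within X)"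
  shows "((\<lambda>x. Re (u x)) has_vector_derivative Re ((1 - s) * u x + v x)) (at x within X)"
    and "((\<lambda>x. Re ((1 - s) * u x + v x)) has_vector_derivative
      Re ((1 - s) * u x + v x) - \<mu> * Re (u x) + h) (at x within X)"
proof -
  show "((\<lambda>x. Re (u x)) has_vector_derivative Re ((1 - s) * u x + v x)) (at x within X)"
    by (rule bounded_linear.has_vector_derivative[OF bounded_linear_Re u])
  have "((\<lambda>x. (1 - s) * u x + v x) has_vector_derivative
      (1 - s) * ((1 - s) * u x + v x) + (s * v x + of_real h)) (at x within X)"
    by (intro has_vector_derivative_add has_vector_derivative_mult_right u v)
  then have "((\<lambda>x. Re ((1 - s) * u x + v x)) has_vector_derivative
      Re ((1 - s) * ((1 - s) * u x + v x) + (s * v x + of_real h))) (at x within X)"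
    by (rule bounded_linear.has_vector_derivative[OF bounded_linear_Re])
  moreover have "(1 - s) * ((1 - s) * u x + v x) + (s * v x + of_real h)
      = ((1 - s) * u x + v x) - (s * (1 - s)) * u x + of_real h"
    by (simp add: algebra_simps)
  then have "(1 - s) * ((1 - s) * u x + v x) + (s * v x + of_real h)
      = ((1 - s) * u x + v x) - of_real \<mu> * u x + of_real h"
    unfolding s_def char_root .
  ultimately show "((\<lambda>x. Re ((1 - s) * u x + v x)) has_vector_derivative
      Re ((1 - s) * u x + v x) - \<mu> * Re (u x) + h) (at x within X)"
    by simp
qed

lemma exp_poly_second_order:
  fixes A :: "'a::real_normed_vector \<Rightarrow> 'a"
  assumes A: "bounded_linear A" "diagonalizable A" and h: "exp_poly \<gamma> h"
  shows "\<exists>u u'. exp_poly \<gamma> u \<and> (\<forall>x. (u has_vector_derivative u' x) (at x) \<and>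
    (u' has_vector_derivative u' x - A (u x) + h x) (at x))"
proof -
  obtain B :: "'a set" and \<phi> \<mu> where B: "finite B" "\<And>b. b \<in> B \<Longrightarrow> bounded_linear (\<phi> b)"
      "\<And>b. b \<in> B \<Longrightarrow> A b = \<mu> b *\<^sub>R b" "\<And>w. w = (\<Sum>b\<in>B. \<phi> b w *\<^sub>R b)"
    using A unfolding diagonalizable_def by blast
  have "\<exists>u u'. exp_poly \<gamma> u \<and> (\<forall>x. (u has_vector_derivative u' x) (at x) \<and>
      (u' has_vector_derivative u' x - \<mu> b * u x + \<phi> b (h x)) (at x))" if "b \<in> B" for b
  proof -
    have "exp_poly \<gamma> (\<lambda>x. complex_of_real (\<phi> b (h x)))"
      by (intro exp_poly_bounded_linear[OF bounded_linear_of_real] exp_poly_bounded_linear[OF B(2)] that h)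
    then obtain v where v: "exp_poly \<gamma> v"
      "\<And>x. (v has_vector_derivative char_root (\<mu> b) * v x + of_real (\<phi> b (h x))) (at x)"
      using exp_poly_first_order by blast
    obtain u where u: "exp_poly \<gamma> u"
      "\<And>x. (u has_vector_derivative (1 - char_root (\<mu> b)) * u x + v x) (at x)"
      using exp_poly_first_order[OF v(1)] by blast
    show ?thesis
      using exp_poly_bounded_linear[OF bounded_linear_Re u(1)] second_order_from_first_order[OF v(2) u(2)]
      by (intro exI conjI allI)
  qed
  then obtain u u' where u: "\<And>b. b \<in> B \<Longrightarrow> exp_poly \<gamma> (u b)"
      "\<And>b x. b \<in> B \<Longrightarrow> (u b has_vector_derivative u' b x) (at x)"
      "\<And>b x. b \<in> B \<Longrightarrow> (u' b has_vector_derivative u' b x - \<mu> b * u b x + \<phi> b (h x)) (at x)"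
    by metis
  show ?thesis
  proof (intro exI conjI allI)
    show "exp_poly \<gamma> (\<lambda>x. \<Sum>b\<in>B. u b x *\<^sub>R b)"
      by (rule exp_poly_sum, rule exp_poly_bounded_linear[OF bounded_linear_scaleR_left], rule u)
    fix x
    show "((\<lambda>x. \<Sum>b\<in>B. u b x *\<^sub>R b) has_vector_derivative (\<Sum>b\<in>B. u' b x *\<^sub>R b)) (at x)"
      by (intro has_vector_derivative_sum bounded_linear.has_vector_derivative[OF bounded_linear_scaleR_left] u)
    have "((\<lambda>x. \<Sum>b\<in>B. u' b x *\<^sub>R b) has_vector_derivative
        (\<Sum>b\<in>B. (u' b x - \<mu> b * u b x + \<phi> b (h x)) *\<^sub>R b)) (at x)"
      by (intro has_vector_derivative_sum bounded_linear.has_vector_derivative[OF bounded_linear_scaleR_left] u)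
    moreover have "A (\<Sum>b\<in>B. u b x *\<^sub>R b) = (\<Sum>b\<in>B. (\<mu> b * u b x) *\<^sub>R b)"
      using A(1) B(3) by (simp add: linear_sum bounded_linear.linear linear_scale mult.commute)
    ultimately show "((\<lambda>x. \<Sum>b\<in>B. u' b x *\<^sub>R b) has_vector_derivative
        (\<Sum>b\<in>B. u' b x *\<^sub>R b) - A (\<Sum>b\<in>B. u b x *\<^sub>R b) + h x) (at x)"
      using B(4)[of "h x"] by (simp add: scaleR_add_left scaleR_diff_left sum.distrib sum_subtractf)
  qed
qed

subsection \<open>Exponentially decaying solutions\<close>

text \<open>Explicit \<open>T\<close> and \<open>M\<close> in place of an order of growth: the norm
  of the solution operator must not depend on \<open>T\<close>, so that \<open>T\<close> can be
  chosen after all constants.\<close>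

definition decays :: "real \<Rightarrow> real \<Rightarrow> real \<Rightarrow> (real \<Rightarrow> 'a::real_normed_vector) \<Rightarrow> bool" where
  "decays \<delta> T M h \<longleftrightarrow> continuous_on {T..} h \<and> (\<forall>x\<ge>T. norm (h x) \<le> M * exp (- (\<delta> * x)))"

lemma decaysD:
  assumes "decays \<delta> T M h"
  shows "continuous_on {T..} h" "x \<ge> T \<Longrightarrow> norm (h x) \<le> M * exp (- (\<delta> * x))"
  using assms unfolding decays_def by auto

lemma decays_nonneg: "decays \<delta> T M h \<Longrightarrow> M \<ge> 0"
  using decaysD(2)[of \<delta> T M h T] order_trans[OF norm_ge_zero] by (metis exp_gt_zero order.refl zero_le_mult_iff not_less)

lemma decays_mono: "decays \<delta> T M h \<Longrightarrow> M \<le> M' \<Longrightarrow> decays \<delta> T M' h"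
  unfolding decays_def by (meson exp_ge_zero mult_right_mono order_trans)

lemma decays_bounded_linear:
  assumes "bounded_linear L"
  obtains K where "K \<ge> 0" "\<And>\<delta> T M h. decays \<delta> T M h \<Longrightarrow> decays \<delta> T (K * M) (\<lambda>x. L (h x))"
proof -
  interpret bounded_linear L by fact
  obtain K where K: "K \<ge> 0" "\<And>x. norm (L x) \<le> norm x * K" using nonneg_bounded by blast
  have "decays \<delta> T (K * M) (\<lambda>x. L (h x))" if "decays \<delta> T M h" for \<delta> T M and h :: "real \<Rightarrow> 'a"
    unfolding decays_def
  proof (intro conjI allI impI)
    show "continuous_on {T..} (\<lambda>x. L (h x))" using continuous_on decaysD(1)[OF that] by blast
    fix x assume "T \<le> x"
    then have "norm (h x) * K \<le> M * exp (- (\<delta> * x)) * K" by (intro mult_right_mono decaysD(2)[OF that] K)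
    then show "norm (L (h x)) \<le> K * M * exp (- (\<delta> * x))" using K(2)[of "h x"] by (simp add: mult_ac)
  qed
  then show ?thesis using that K(1) by blast
qed

lemma decays_add:
  assumes "decays \<delta> T M f" "decays \<delta> T M' g"
  shows "decays \<delta> T (M + M') (\<lambda>x. f x + g x)"
  unfolding decays_def
proof (intro conjI allI impI)
  show "continuous_on {T..} (\<lambda>x. f x + g x)" using assms by (intro continuous_on_add decaysD(1))
  fix x assume "T \<le> x"
  then show "norm (f x + g x) \<le> (M + M') * exp (- (\<delta> * x))"
    using norm_triangle_le[OF add_mono[OF decaysD(2)[OF assms(1)] decaysD(2)[OF assms(2)]]]
    by (simp add: distrib_right)
qed

lemma decays_sum:
  assumes "finite B" "\<And>b. b \<in> B \<Longrightarrow> decays \<delta> T (M b) (f b)"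
  shows "decays \<delta> T (\<Sum>b\<in>B. M b) (\<lambda>x. \<Sum>b\<in>B. f b x)"
  using assms by (induction B) (auto intro!: decays_add simp: decays_def[of _ _ 0])

text \<open>The solution of \<open>u' = s u + h\<close> that inherits the decay of \<open>h\<close>: it starts from \<open>0\<close> at \<open>T\<close>
  if the homogeneous solution decays faster than \<open>h\<close>, and from \<open>0\<close> at infinity otherwise.\<close>

definition duhamel :: "real \<Rightarrow> real \<Rightarrow> complex \<Rightarrow> (real \<Rightarrow> complex) \<Rightarrow> real \<Rightarrow> complex" where
  "duhamel \<delta> T s h x = exp (s * of_real x) * (integral {T..x} (\<lambda>y. exp (- s * of_real y) * h y)
     - (if Re s < - \<delta> then 0 else integral {T..} (\<lambda>y. exp (- s * of_real y) * h y)))"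

lemma duhamel_integrand:
  assumes "decays \<delta> T M h"
  shows "continuous_on {T..} (\<lambda>y. exp (- s * of_real y) * h y)"
    and "x \<ge> T \<Longrightarrow> norm (exp (- s * of_real x) * h x) \<le> M * exp (- (Re s + \<delta>) * x)"
proof -
  show "continuous_on {T..} (\<lambda>y. exp (- s * of_real y) * h y)"
    by (intro continuous_intros decaysD(1)[OF assms])
  assume "x \<ge> T"
  have "norm (exp (- s * of_real x) * h x) = exp (- Re s * x) * norm (h x)"
    by (simp add: norm_mult norm_exp_eq_Re)
  also have "\<dots> \<le> exp (- Re s * x) * (M * exp (- (\<delta> * x)))"
    using \<open>x \<ge> T\<close> by (intro mult_left_mono decaysD(2)[OF assms]) auto
  also have "\<dots> = M * (exp (- Re s * x) * exp (- (\<delta> * x)))"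
    by (rule mult.left_commute)
  also have "exp (- Re s * x) * exp (- (\<delta> * x)) = exp (- (Re s + \<delta>) * x)"
    unfolding exp_add[symmetric] by (simp add: algebra_simps)
  finally show "norm (exp (- s * of_real x) * h x) \<le> M * exp (- (Re s + \<delta>) * x)" .
qed

lemma duhamel_integrable:
  assumes "decays \<delta> T M h"
  shows "(\<lambda>y. exp (- s * of_real y) * h y) integrable_on {T..x}"
    and "Re s > - \<delta> \<Longrightarrow> x \<ge> T \<Longrightarrow> (\<lambda>y. exp (- s * of_real y) * h y) integrable_on {x..}"
proof -
  show "(\<lambda>y. exp (- s * of_real y) * h y) integrable_on {T..x}"
    by (intro integrable_continuous_interval continuous_on_subset[OF duhamel_integrand(1)[OF assms]]) auto
  assume *: "Re s > - \<delta>" "x \<ge> T"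
  show "(\<lambda>y. exp (- s * of_real y) * h y) integrable_on {x..}"
  proof (rule measurable_bounded_by_integrable_imp_integrable)
    show "{x..} \<in> sets lebesgue" by simp
    then show "(\<lambda>y. exp (- s * of_real y) * h y) \<in> borel_measurable (lebesgue_on {x..})"
      using * by (intro continuous_imp_measurable_on_sets_lebesgue
          continuous_on_subset[OF duhamel_integrand(1)[OF assms]]) auto
    show "(\<lambda>y. M * exp (- (Re s + \<delta>) * y)) integrable_on {x..}"
      using * integrable_on_exp_minus_to_infinity[of "Re s + \<delta>" x] by (intro integrable_on_mult_right) auto
    fix y assume "y \<in> {x..}"
    then show "norm (exp (- s * of_real y) * h y) \<le> M * exp (- (Re s + \<delta>) * y)"
      using * by (intro duhamel_integrand(2)[OF assms]) auto
  qed
qed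

text \<open>The integrand decays at the rate \<open>a = Re s + \<delta>\<close>. If
  \<open>a < 0\<close> it grows and the integral from \<open>T\<close> is governed by its end at
  \<open>x\<close>; if \<open>a > 0\<close> only the tail beyond \<open>x\<close> is left. Both give
  the factor \<open>1 / \<bar>a\<bar>\<close>, independent of \<open>T\<close>.\<close>

lemma duhamel_bound:
  assumes h: "decays \<delta> T M h" and s: "Re s \<noteq> - \<delta>" and x: "x \<ge> T"
  shows "norm (duhamel \<delta> T s h x) \<le> M / \<bar>Re s + \<delta>\<bar> * exp (- (\<delta> * x))"
proof -
  define a where "a = Re s + \<delta>"
  define g where "g = (\<lambda>y. exp (- s * of_real y) * h y)"
  define J where "J = integral {T..x} g - (if Re s < - \<delta> then 0 else integral {T..} g)"
  have g: "norm (g y) \<le> M * exp (- a * y)" if "y \<ge> T" for y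
    using duhamel_integrand(2)[OF h that] by (simp add: g_def a_def)
  have M: "M \<ge> 0" using decays_nonneg[OF h] .
  have "norm J \<le> M * (exp (- a * x) / \<bar>a\<bar>)"
  proof (cases "Re s < - \<delta>")
    case True
    then have a: "a < 0" by (simp add: a_def)
    have int: "((\<lambda>y. exp (- a * y)) has_integral exp (- a * x) / (- a) - exp (- a * T) / (- a)) {T..x}"
      using x a by (intro fundamental_theorem_of_calculus)
        (auto intro!: derivative_eq_intros simp flip: has_real_derivative_iff_has_vector_derivative)
    have "norm (integral {T..x} g) \<le> integral {T..x} (\<lambda>y. M * exp (- a * y))"
      using g duhamel_integrable(1)[OF h] int unfolding g_def
      by (intro integral_norm_bound_integral integrable_on_mult_right) (auto intro: has_integral_integrable)
    also have "\<dots> = M * (exp (- a * x) / (- a) - exp (- a * T) / (- a))"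
      using int by (simp add: integral_unique)
    also have "\<dots> \<le> M * (exp (- a * x) / \<bar>a\<bar>)"
      using M a by (intro mult_left_mono) (auto simp: divide_le_0_iff)
    finally show ?thesis using True by (simp add: J_def)
  next
    case False
    then have a: "a > 0" using s by (simp add: a_def)
    have "integral ({T..x} \<union> {x..}) g = integral {T..x} g + integral {x..} g"
    proof (rule integral_Un)
      show "g integrable_on {T..x}" "g integrable_on {x..}"
        unfolding g_def using duhamel_integrable[OF h] a x by (auto simp: a_def)
      show "negligible ({T..x} \<inter> {x..})"
        by (rule negligible_subset[of "{x}"]) auto
    qed
    moreover have "{T..x} \<union> {x..} = {T..}" using x by auto
    ultimately have J: "J = - integral {x..} g" using False by (simp add: J_def)
    have "norm (integral {x..} g) \<le> integral {x..} (\<lambda>y. M * exp (- a * y))"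
      using g duhamel_integrable(2)[OF h] a x unfolding g_def a_def
      by (intro integral_norm_bound_integral integrable_on_mult_right integrable_on_exp_minus_to_infinity)
        auto
    also have "\<dots> = M * (exp (- a * x) / a)"
      using has_integral_exp_minus_to_infinity[OF a, of x] by (simp add: integral_unique)
    finally show ?thesis using J a by simp
  qed
  then have "exp (Re s * x) * norm J \<le> exp (Re s * x) * (M * (exp (- a * x) / \<bar>a\<bar>))"
    by (intro mult_left_mono) auto
  also have "\<dots> = M / \<bar>a\<bar> * (exp (Re s * x) * exp (- a * x))" by simp
  also have "exp (Re s * x) * exp (- a * x) = exp (- (\<delta> * x))"
    by (simp add: exp_add[symmetric] a_def algebra_simps)
  finally have "exp (Re s * x) * norm J \<le> M / \<bar>a\<bar> * exp (- (\<delta> * x))" .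
  moreover have "duhamel \<delta> T s h x = exp (s * of_real x) * J"
    by (simp only: duhamel_def J_def g_def)
  ultimately show ?thesis
    unfolding a_def by (simp only: norm_mult norm_exp_eq_Re) simp
qed

lemma duhamel_deriv:
  assumes h: "decays \<delta> T M h" and x: "x \<ge> T"
  shows "(duhamel \<delta> T s h has_vector_derivative s * duhamel \<delta> T s h x + h x) (at x within {T..})"
proof -
  define g where "g = (\<lambda>y. exp (- s * of_real y) * h y)"
  define K where "K = (if Re s < - \<delta> then 0 else integral {T..} g)"
  have "continuous_on {T..x + 1} g"
    unfolding g_def by (rule continuous_on_subset[OF duhamel_integrand(1)[OF h]]) auto
  then have "((\<lambda>u. integral {T..u} g) has_vector_derivative g x) (at x within {T..x + 1})"
    by (rule integral_has_vector_derivative) (use x in auto)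
  moreover have "at x within {T..x + 1} = at x within {T..}"
    by (rule at_within_nhd[where S = "{..<x + 1}"]) auto
  ultimately have "((\<lambda>u. integral {T..u} g) has_vector_derivative g x) (at x within {T..})" by simp
  then have 1: "((\<lambda>u. integral {T..u} g - K) has_vector_derivative g x - 0) (at x within {T..})"
    by (intro has_vector_derivative_diff has_vector_derivative_const)
  have 2: "((\<lambda>x. exp (s * of_real x)) has_vector_derivative s * exp (s * of_real x)) (at x within {T..})"
    by (rule has_vector_derivative_real_field[where f = "\<lambda>z. exp (s * z)"])
      (auto intro!: derivative_eq_intros)
  have "((\<lambda>u. exp (s * of_real u) * (integral {T..u} g - K)) has_vector_derivative
      exp (s * of_real x) * (g x - 0) + s * exp (s * of_real x) * (integral {T..x} g - K)) (at x within {T..})"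
    by (rule has_vector_derivative_mult[OF 2 1])
  moreover have "exp (s * of_real x) * g x = h x"
    by (simp add: g_def mult.assoc[symmetric] exp_add[symmetric])
  ultimately show ?thesis
    unfolding duhamel_def[abs_def] g_def[symmetric] K_def[symmetric] by (simp add: add.commute mult.assoc)
qed

lemma duhamel_decays:
  assumes "decays \<delta> T M h" "Re s \<noteq> - \<delta>"
  shows "decays \<delta> T (M / \<bar>Re s + \<delta>\<bar>) (duhamel \<delta> T s h)"
  unfolding decays_def
proof (intro conjI allI impI duhamel_bound assms)
  show "continuous_on {T..} (duhamel \<delta> T s h)"
    unfolding continuous_on_eq_continuous_within
    using duhamel_deriv[OF assms(1)] has_vector_derivative_continuous by blast
qed

lemma duhamel_diff:
  assumes h: "decays \<delta> T M h" "decays \<delta> T M' k" and s: "Re s \<noteq> - \<delta>"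
  shows "duhamel \<delta> T s (\<lambda>x. h x - k x) x = duhamel \<delta> T s h x - duhamel \<delta> T s k x"
proof -
  define I where "I X f = integral X (\<lambda>y. exp (- s * of_real y) * f y)" for X f
  have 1: "I {T..x} (\<lambda>y. h y - k y) = I {T..x} h - I {T..x} k"
    unfolding I_def right_diff_distrib
    by (intro integral_diff duhamel_integrable[OF h(1)] duhamel_integrable[OF h(2)])
  have 2: "I {T..} (\<lambda>y. h y - k y) = I {T..} h - I {T..} k" if "\<not> Re s < - \<delta>"
    unfolding I_def right_diff_distrib using s that
    by (intro integral_diff duhamel_integrable(2)[OF h(1)] duhamel_integrable(2)[OF h(2)]) auto
  show ?thesis unfolding duhamel_def I_def[symmetric] by (simp add: 1 2 algebra_simps)
qed

text \<open>A right inverse of the linear operator on the space with weight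
  \<open>exp (- (\<delta> * x))\<close>, with norm at most \<open>C\<close>. Differences are the
  linearity that a contraction estimate uses; they are restricted to decaying inputs, for which the
  improper integrals converge.\<close>

definition decaying_solver ::
    "('a::real_normed_vector \<Rightarrow> 'a) \<Rightarrow> real \<Rightarrow> real \<Rightarrow> real \<Rightarrow> ((real \<Rightarrow> 'a) \<Rightarrow> real \<Rightarrow> 'a) \<Rightarrow> bool" where
  "decaying_solver A \<delta> C T S \<longleftrightarrow>
    (\<forall>h M. decays \<delta> T M h \<longrightarrow> decays \<delta> T (C * M) (S h) \<and>
      (\<exists>u'. \<forall>x\<ge>T. (S h has_vector_derivative u' x) (at x within {T..}) \<and>
        (u' has_vector_derivative u' x - A (S h x) + h x) (at x within {T..}))) \<and>
    (\<forall>h k M M'. decays \<delta> T M h \<longrightarrow> decays \<delta> T M' k \<longrightarrow> S (\<lambda>x. h x - k x) = (\<lambda>x. S h x - S k x))"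

text \<open>Two Duhamel operators in succession, for the roots \<open>s\<close> and
  \<open>1 - s\<close>; each excludes one weight.\<close>

lemma decaying_solver_scalar:
  assumes "Re (char_root \<mu>) \<noteq> - \<delta>" "Re (1 - char_root \<mu>) \<noteq> - \<delta>"
  shows "\<exists>C\<ge>0. \<forall>T. \<exists>S. decaying_solver (\<lambda>x. \<mu> * x) \<delta> C T S"
proof -
  define s where "s = char_root \<mu>"
  define C where "C = 1 / \<bar>Re s + \<delta>\<bar> / \<bar>Re (1 - s) + \<delta>\<bar>"
  have "decaying_solver (\<lambda>x. \<mu> * x) \<delta> C T
      (\<lambda>h x. Re (duhamel \<delta> T (1 - s) (duhamel \<delta> T s (\<lambda>x. of_real (h x))) x))" for T
    unfolding decaying_solver_def
  proof (intro conjI allI impI)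
    fix h :: "real \<Rightarrow> real" and M assume h: "decays \<delta> T M h"
    define v where "v = duhamel \<delta> T s (\<lambda>x. of_real (h x))"
    define u where "u = duhamel \<delta> T (1 - s) v"
    have hc: "decays \<delta> T M (\<lambda>x. complex_of_real (h x))"
      using h unfolding decays_def by (auto intro: continuous_intros)
    have v: "decays \<delta> T (M / \<bar>Re s + \<delta>\<bar>) v"
      unfolding v_def by (rule duhamel_decays[OF hc]) (use assms in \<open>simp add: s_def\<close>)
    have u: "decays \<delta> T (M / \<bar>Re s + \<delta>\<bar> / \<bar>Re (1 - s) + \<delta>\<bar>) u"
      unfolding u_def by (rule duhamel_decays[OF v]) (use assms in \<open>simp add: s_def\<close>)
    have "decays \<delta> T (M / \<bar>Re s + \<delta>\<bar> / \<bar>Re (1 - s) + \<delta>\<bar>) (\<lambda>x. Re (u x))"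
      unfolding decays_def
    proof (intro conjI allI impI)
      show "continuous_on {T..} (\<lambda>x. Re (u x))" by (intro continuous_intros decaysD(1)[OF u])
      fix x assume "T \<le> x"
      then show "norm (Re (u x)) \<le> M / \<bar>Re s + \<delta>\<bar> / \<bar>Re (1 - s) + \<delta>\<bar> * exp (- (\<delta> * x))"
        using decaysD(2)[OF u] abs_Re_le_cmod[of "u x"] by (metis order_trans real_norm_def)
    qed
    then show "decays \<delta> T (C * M) (\<lambda>x. Re (duhamel \<delta> T (1 - s) (duhamel \<delta> T s (\<lambda>x. of_real (h x))) x))"
      by (simp add: C_def u_def v_def)
    have "(v has_vector_derivative s * v x + of_real (h x)) (at x within {T..})" if "x \<ge> T" for x
      unfolding v_def by (rule duhamel_deriv[OF hc that])
    moreover have "(u has_vector_derivative (1 - s) * u x + v x) (at x within {T..})" if "x \<ge> T" for x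
      unfolding u_def by (rule duhamel_deriv[OF v that])
    ultimately have "\<exists>u'. \<forall>x\<ge>T. ((\<lambda>x. Re (u x)) has_vector_derivative u' x) (at x within {T..}) \<and>
        (u' has_vector_derivative u' x - \<mu> * Re (u x) + h x) (at x within {T..})"
      unfolding s_def by (intro exI[of _ "\<lambda>x. Re ((1 - char_root \<mu>) * u x + v x)"] allI impI conjI
        second_order_from_first_order) auto
    then show "\<exists>u'. \<forall>x\<ge>T. ((\<lambda>x. Re (duhamel \<delta> T (1 - s) (duhamel \<delta> T s (\<lambda>x. of_real (h x))) x))
          has_vector_derivative u' x) (at x within {T..}) \<and>
        (u' has_vector_derivative u' x
          - \<mu> * Re (duhamel \<delta> T (1 - s) (duhamel \<delta> T s (\<lambda>x. of_real (h x))) x) + h x) (at x within {T..})"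
      by (simp add: u_def v_def)
  next
    fix h k :: "real \<Rightarrow> real" and M M' assume "decays \<delta> T M h" "decays \<delta> T M' k"
    then have hk: "decays \<delta> T M (\<lambda>x. complex_of_real (h x))" "decays \<delta> T M' (\<lambda>x. complex_of_real (k x))"
      unfolding decays_def by (auto intro: continuous_intros)
    have 1: "duhamel \<delta> T s (\<lambda>x. complex_of_real (h x) - of_real (k x)) =
        (\<lambda>x. duhamel \<delta> T s (\<lambda>x. of_real (h x)) x - duhamel \<delta> T s (\<lambda>x. of_real (k x)) x)"
      using duhamel_diff[OF hk, of s] assms by (auto simp: s_def)
    show "(\<lambda>x. Re (duhamel \<delta> T (1 - s) (duhamel \<delta> T s (\<lambda>x. complex_of_real (h x - k x))) x)) =
        (\<lambda>x. Re (duhamel \<delta> T (1 - s) (duhamel \<delta> T s (\<lambda>x. of_real (h x))) x)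
          - Re (duhamel \<delta> T (1 - s) (duhamel \<delta> T s (\<lambda>x. of_real (k x))) x))"
      unfolding of_real_diff 1
      by (subst duhamel_diff[OF duhamel_decays[OF hk(1)] duhamel_decays[OF hk(2)]])
        (use assms in \<open>auto simp: s_def\<close>)
  qed
  moreover have "C \<ge> 0" by (simp add: C_def)
  ultimately show ?thesis by blast
qed

text \<open>The excluded weights are those at which some homogeneous solution decays exactly like
  the weight, at most two for each eigenvector.\<close>

lemma decaying_solver_exists:
  fixes A :: "'a::real_normed_vector \<Rightarrow> 'a"
  assumes A: "bounded_linear A" "diagonalizable A"
  obtains R :: "real set" where "finite R"
    "\<And>\<delta>. \<delta> \<notin> R \<Longrightarrow> \<exists>C>0. \<forall>T. \<exists>S. decaying_solver A \<delta> C T S"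
proof -
  obtain B :: "'a set" and \<phi> \<mu> where B: "finite B" "\<And>b. b \<in> B \<Longrightarrow> bounded_linear (\<phi> b)"
      "\<And>b. b \<in> B \<Longrightarrow> A b = \<mu> b *\<^sub>R b" "\<And>w. w = (\<Sum>b\<in>B. \<phi> b w *\<^sub>R b)"
    using A unfolding diagonalizable_def by blast
  define R where "R = (\<lambda>b. - Re (char_root (\<mu> b))) ` B \<union> (\<lambda>b. - Re (1 - char_root (\<mu> b))) ` B"
  have "\<exists>C>0. \<forall>T. \<exists>S. decaying_solver A \<delta> C T S" if \<delta>: "\<delta> \<notin> R" for \<delta>
  proof -
    have "\<exists>C\<ge>0. \<forall>T. \<exists>S. decaying_solver (\<lambda>x. \<mu> b * x) \<delta> C T S" if "b \<in> B" for b
    proof -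
      have "\<delta> \<noteq> - Re (char_root (\<mu> b))" "\<delta> \<noteq> - Re (1 - char_root (\<mu> b))"
        using \<delta> that unfolding R_def by blast+
      then show ?thesis by (intro decaying_solver_scalar) auto
    qed
    then obtain C where C: "\<And>b. b \<in> B \<Longrightarrow> C b \<ge> 0"
        "\<And>b. b \<in> B \<Longrightarrow> \<forall>T. \<exists>S. decaying_solver (\<lambda>x. \<mu> b * x) \<delta> (C b) T S" by metis
    have "\<exists>K\<ge>0. \<forall>T M h. decays \<delta> T M h \<longrightarrow> decays \<delta> T (K * M) (\<lambda>x. \<phi> b (h x))" if "b \<in> B" for b
      using decays_bounded_linear[OF B(2)[OF that]] by metis
    then obtain K where K: "\<And>b. b \<in> B \<Longrightarrow> K b \<ge> 0"
        "\<And>b T M h. b \<in> B \<Longrightarrow> decays \<delta> T M h \<Longrightarrow> decays \<delta> T (K b * M) (\<lambda>x. \<phi> b (h x))" by metis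
    \<comment> \<open>The summand 1 makes the constant positive; the contraction later divides by
      it.\<close>
    define C' where "C' = (\<Sum>b\<in>B. C b * K b * norm b) + 1"
    have C': "C' > 0" unfolding C'_def using C K by (intro add_nonneg_pos sum_nonneg) auto
    have "\<exists>S. decaying_solver A \<delta> C' T S" for T
    proof -
      have "\<forall>b\<in>B. \<exists>S. decaying_solver (\<lambda>x. \<mu> b * x) \<delta> (C b) T S"
        using C(2) by blast
      from bchoice[OF this] obtain S
        where S: "\<And>b. b \<in> B \<Longrightarrow> decaying_solver (\<lambda>x. \<mu> b * x) \<delta> (C b) T (S b)"
        by blast
      have "decaying_solver A \<delta> C' T (\<lambda>h x. \<Sum>b\<in>B. S b (\<lambda>x. \<phi> b (h x)) x *\<^sub>R b)"
        unfolding decaying_solver_def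
      proof (intro conjI allI impI)
        fix h :: "real \<Rightarrow> 'a" and M assume h: "decays \<delta> T M h"
        have 1: "decays \<delta> T (C b * (K b * M)) (S b (\<lambda>x. \<phi> b (h x)))" if "b \<in> B" for b
          using S[OF that] K(2)[OF that h] unfolding decaying_solver_def by blast
        have "decays \<delta> T (C b * K b * norm b * M) (\<lambda>x. S b (\<lambda>x. \<phi> b (h x)) x *\<^sub>R b)" if "b \<in> B" for b
          unfolding decays_def
        proof (intro conjI allI impI)
          show "continuous_on {T..} (\<lambda>x. S b (\<lambda>x. \<phi> b (h x)) x *\<^sub>R b)"
            by (intro continuous_intros decaysD(1)[OF 1[OF that]])
          fix x assume "T \<le> x"
          from mult_right_mono[OF decaysD(2)[OF 1[OF that] this], of "norm b"]
          show "norm (S b (\<lambda>x. \<phi> b (h x)) x *\<^sub>R b) \<le> C b * K b * norm b * M * exp (- (\<delta> * x))"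
            by (simp add: mult_ac)
        qed
        then have "decays \<delta> T (\<Sum>b\<in>B. C b * K b * norm b * M) (\<lambda>x. \<Sum>b\<in>B. S b (\<lambda>x. \<phi> b (h x)) x *\<^sub>R b)"
          by (intro decays_sum B)
        then show "decays \<delta> T (C' * M) (\<lambda>x. \<Sum>b\<in>B. S b (\<lambda>x. \<phi> b (h x)) x *\<^sub>R b)"
          using decays_nonneg[OF h]
          by (elim decays_mono) (simp add: C'_def sum_distrib_right distrib_right)
        have "\<exists>u'. \<forall>x\<ge>T. (S b (\<lambda>x. \<phi> b (h x)) has_vector_derivative u' x) (at x within {T..}) \<and>
            (u' has_vector_derivative u' x - \<mu> b * S b (\<lambda>x. \<phi> b (h x)) x + \<phi> b (h x)) (at x within {T..})"
          if "b \<in> B" for b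
          using S[OF that] K(2)[OF that h] unfolding decaying_solver_def by blast
        then obtain u' where u':
          "\<And>b x. b \<in> B \<Longrightarrow> x \<ge> T \<Longrightarrow> (S b (\<lambda>x. \<phi> b (h x)) has_vector_derivative u' b x) (at x within {T..})"
          "\<And>b x. b \<in> B \<Longrightarrow> x \<ge> T \<Longrightarrow> (u' b has_vector_derivative u' b x - \<mu> b * S b (\<lambda>x. \<phi> b (h x)) x + \<phi> b (h x)) (at x within {T..})"
          by metis
        show "\<exists>u'. \<forall>x\<ge>T. ((\<lambda>x. \<Sum>b\<in>B. S b (\<lambda>x. \<phi> b (h x)) x *\<^sub>R b) has_vector_derivative u' x) (at x within {T..}) \<and>
          (u' has_vector_derivative u' x - A (\<Sum>b\<in>B. S b (\<lambda>x. \<phi> b (h x)) x *\<^sub>R b) + h x) (at x within {T..})"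
        proof (intro exI conjI allI impI)
          fix x assume x: "T \<le> x"
          show "((\<lambda>x. \<Sum>b\<in>B. S b (\<lambda>x. \<phi> b (h x)) x *\<^sub>R b) has_vector_derivative (\<Sum>b\<in>B. u' b x *\<^sub>R b)) (at x within {T..})"
            by (intro has_vector_derivative_sum bounded_linear.has_vector_derivative[OF bounded_linear_scaleR_left] u' x)
          have "((\<lambda>x. \<Sum>b\<in>B. u' b x *\<^sub>R b) has_vector_derivative
              (\<Sum>b\<in>B. (u' b x - \<mu> b * S b (\<lambda>x. \<phi> b (h x)) x + \<phi> b (h x)) *\<^sub>R b)) (at x within {T..})"
            by (intro has_vector_derivative_sum bounded_linear.has_vector_derivative[OF bounded_linear_scaleR_left] u' x)
          moreover have "A (\<Sum>b\<in>B. S b (\<lambda>x. \<phi> b (h x)) x *\<^sub>R b) = (\<Sum>b\<in>B. (\<mu> b * S b (\<lambda>x. \<phi> b (h x)) x) *\<^sub>R b)"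
            using A(1) B(3) by (simp add: linear_sum bounded_linear.linear linear_scale mult.commute)
          ultimately show "((\<lambda>x. \<Sum>b\<in>B. u' b x *\<^sub>R b) has_vector_derivative
              (\<Sum>b\<in>B. u' b x *\<^sub>R b) - A (\<Sum>b\<in>B. S b (\<lambda>x. \<phi> b (h x)) x *\<^sub>R b) + h x) (at x within {T..})"
            using B(4)[of "h x"] by (simp add: scaleR_add_left scaleR_diff_left sum.distrib sum_subtractf)
        qed
      next
        fix h k :: "real \<Rightarrow> 'a" and M M' assume hk: "decays \<delta> T M h" "decays \<delta> T M' k"
        have "S b (\<lambda>x. \<phi> b (h x - k x)) = (\<lambda>x. S b (\<lambda>x. \<phi> b (h x)) x - S b (\<lambda>x. \<phi> b (k x)) x)" if "b \<in> B" for b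
          using S[OF that] K(2)[OF that hk(1)] K(2)[OF that hk(2)]
          unfolding decaying_solver_def linear_diff[OF bounded_linear.linear[OF B(2)[OF that]]] by blast
        then show "(\<lambda>x. \<Sum>b\<in>B. S b (\<lambda>x. \<phi> b (h x - k x)) x *\<^sub>R b) =
            (\<lambda>x. (\<Sum>b\<in>B. S b (\<lambda>x. \<phi> b (h x)) x *\<^sub>R b) - (\<Sum>b\<in>B. S b (\<lambda>x. \<phi> b (k x)) x *\<^sub>R b))"
          by (simp add: scaleR_diff_left sum_subtractf)
      qed
      then show ?thesis by blast
    qed
    then show ?thesis using C' by blast
  qed
  moreover have "finite R" using B by (simp add: R_def)
  ultimately show ?thesis using that by blast
qed

subsection \<open>Nonlinear perturbations of the linear equation\<close>

text \<open>Banach's theorem for the map that solves the linear equation with source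
  \<open>G x (w x)\<close>. The Lipschitz constant \<open>1 / (2 * C)\<close> gives the contraction
  factor 1/2, and \<open>C * (M\<^sub>0 + M / (2 * C)) \<le> M\<close> makes the ball
  invariant.\<close>

lemma decaying_solution_from_solver:
  fixes A :: "'a::euclidean_space \<Rightarrow> 'a" and G :: "real \<Rightarrow> 'a \<Rightarrow> 'a"
  assumes solver: "C > 0" "decaying_solver A \<delta> C T S"
    and M: "0 \<le> M\<^sub>0" "M = 2 * C * M\<^sub>0 + 1"
    and G0: "\<And>x. x \<ge> T \<Longrightarrow> norm (G x 0) \<le> M\<^sub>0 * exp (- (\<delta> * x))"
    and lip: "\<And>x w\<^sub>1 w\<^sub>2. x \<ge> T \<Longrightarrow> norm w\<^sub>1 \<le> M * exp (- (\<delta> * x)) \<Longrightarrow>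
        norm w\<^sub>2 \<le> M * exp (- (\<delta> * x)) \<Longrightarrow> norm (G x w\<^sub>1 - G x w\<^sub>2) \<le> 1 / (2 * C) * norm (w\<^sub>1 - w\<^sub>2)"
    and cont: "continuous_on {(x, w). x \<ge> T \<and> norm w \<le> M * exp (- (\<delta> * x))} (\<lambda>(x, w). G x w)"
  obtains w w' where "\<And>x. x \<ge> T \<Longrightarrow> norm (w x) \<le> M * exp (- (\<delta> * x))"
    "\<And>x. x > T \<Longrightarrow> (w has_vector_derivative w' x) (at x)"
    "\<And>x. x > T \<Longrightarrow> (w' has_vector_derivative w' x - A (w x) + G x (w x)) (at x)"
proof -
  have M0: "M > 0" using M solver by (simp add: add_nonneg_pos)
  \<comment> \<open>Dividing by the weight turns weighted decay into boundedness, so the fixed point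
    is sought in a ball of bounded continuous functions.\<close>
  define W :: "(real \<Rightarrow>\<^sub>C 'a) \<Rightarrow> real \<Rightarrow> 'a" where
    "W y x = exp (- (\<delta> * x)) *\<^sub>R apply_bcontfun y x" for y x
  define H where "H y = (\<lambda>x. G x (W y x))" for y
  \<comment> \<open>\<open>max x T\<close> freezes the function to the left of \<open>T\<close>,
    where the solver is not controlled, and keeps it bounded and continuous on the whole
    line.\<close>
  define \<Phi> where "\<Phi> y = (\<lambda>x. exp (\<delta> * max x T) *\<^sub>R S (H y) (max x T))" for y
  have Wb: "norm (W y x) \<le> M * exp (- (\<delta> * x))" if "y \<in> cball 0 M" for y x
  proof -
    have "norm (apply_bcontfun y x) \<le> M" using that norm_bounded[of y x] by (simp add: dist_norm)
    then show ?thesis unfolding W_def by (simp add: mult.commute)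
  qed
  have Wd: "norm (W y x - W z x) \<le> dist y z * exp (- (\<delta> * x))" for y z x
    using dist_bounded[of y x z] unfolding W_def
    by (simp add: scaleR_diff_right[symmetric] dist_norm mult.commute)
  have W0: "norm (0::'a) \<le> M * exp (- (\<delta> * x))" for x using M0 by simp
  have Hcont: "continuous_on {T..} (H y)" if "y \<in> cball 0 M" for y
  proof -
    have "continuous_on {T..} (\<lambda>x. (\<lambda>(x, w). G x w) (x, W y x))"
    proof (rule continuous_on_compose2[OF cont])
      show "continuous_on {T..} (\<lambda>x. (x, W y x))"
        unfolding W_def by (intro continuous_intros) auto
    qed (use Wb[OF that] in auto)
    then show ?thesis by (simp add: H_def)
  qed
  have H: "decays \<delta> T (M / C) (H y)" if y: "y \<in> cball 0 M" for y
    unfolding decays_def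
  proof (intro conjI allI impI Hcont y)
    fix x assume x: "T \<le> x"
    have "norm (G x (W y x) - G x 0) \<le> 1 / (2 * C) * norm (W y x - 0)"
      by (rule lip[OF x Wb[OF y] W0])
    also have "\<dots> \<le> 1 / (2 * C) * (M * exp (- (\<delta> * x)))"
      using solver Wb[OF y] by (intro mult_left_mono) auto
    finally have "norm (G x (W y x)) \<le> M\<^sub>0 * exp (- (\<delta> * x)) + 1 / (2 * C) * (M * exp (- (\<delta> * x)))"
      using G0[OF x] norm_triangle_ineq2[of "G x (W y x)" "G x 0"] by linarith
    also have "\<dots> = (M\<^sub>0 + M / (2 * C)) * exp (- (\<delta> * x))" by (simp add: distrib_right)
    also have "\<dots> \<le> M / C * exp (- (\<delta> * x))"
      using solver M by (intro mult_right_mono) (auto simp: field_simps)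
    finally show "norm (H y x) \<le> M / C * exp (- (\<delta> * x))" by (simp add: H_def)
  qed
  have S: "decays \<delta> T M (S (H y))" if "y \<in> cball 0 M" for y
    using solver H[OF that] unfolding decaying_solver_def by (metis nonzero_mult_div_cancel_left not_less_iff_gr_or_eq times_divide_eq_right)
  have \<Phi>b: "\<Phi> y \<in> bcontfun" "norm (\<Phi> y x) \<le> M" if y: "y \<in> cball 0 M" for y x
  proof -
    have "continuous_on UNIV (\<lambda>x. S (H y) (max x T))"
      by (rule continuous_on_compose2[OF decaysD(1)[OF S[OF y]]]) (auto intro!: continuous_intros)
    then have "continuous_on UNIV (\<Phi> y)"
      unfolding \<Phi>_def by (intro continuous_intros)
    moreover have *: "norm (\<Phi> y x) \<le> M" for x
    proof -
      have "exp (\<delta> * max x T) * norm (S (H y) (max x T)) \<le> exp (\<delta> * max x T) * (M * exp (- (\<delta> * max x T)))"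
        by (intro mult_left_mono decaysD(2)[OF S[OF y]]) auto
      also have "\<dots> = M" by (simp add: exp_minus)
      finally show ?thesis by (simp add: \<Phi>_def)
    qed
    ultimately show "\<Phi> y \<in> bcontfun" by (rule bcontfun_normI)
    show "norm (\<Phi> y x) \<le> M" by (rule *)
  qed
  have \<Phi>apply: "apply_bcontfun (Bcontfun (\<Phi> y)) = \<Phi> y" if "y \<in> cball 0 M" for y
    by (rule Bcontfun_inverse[OF \<Phi>b(1)[OF that]])
  have "\<exists>!y\<in>cball 0 M. Bcontfun (\<Phi> y) = y"
  proof (rule Banach_fix)
    show "complete (cball 0 M :: (real \<Rightarrow>\<^sub>C 'a) set)" by (simp add: complete_eq_closed)
    show "cball 0 M \<noteq> ({} :: (real \<Rightarrow>\<^sub>C 'a) set)" using M0 by simp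
    show "(\<lambda>y. Bcontfun (\<Phi> y)) ` cball 0 M \<subseteq> cball 0 M"
    proof
      fix z assume "z \<in> (\<lambda>y. Bcontfun (\<Phi> y)) ` cball 0 M"
      then obtain y where y: "y \<in> cball 0 M" "z = Bcontfun (\<Phi> y)" by auto
      have "norm z \<le> M" by (rule norm_bound) (simp add: y(2) \<Phi>apply[OF y(1)] \<Phi>b(2)[OF y(1)])
      then show "z \<in> cball 0 M" by simp
    qed
    show "dist (Bcontfun (\<Phi> y)) (Bcontfun (\<Phi> z)) \<le> 1/2 * dist y z"
      if "y \<in> cball 0 M" "z \<in> cball 0 M" for y z
    proof (rule dist_bound)
      fix x
      have dec: "decays \<delta> T (1 / (2 * C) * dist y z) (\<lambda>x. H y x - H z x)"
        unfolding decays_def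
      proof (intro conjI allI impI continuous_on_diff Hcont that)
        fix x assume "T \<le> x"
        then have "norm (H y x - H z x) \<le> 1 / (2 * C) * norm (W y x - W z x)"
          unfolding H_def by (rule lip[OF _ Wb[OF that(1)] Wb[OF that(2)]])
        also have "\<dots> \<le> 1 / (2 * C) * (dist y z * exp (- (\<delta> * x)))"
          using solver by (intro mult_left_mono Wd) auto
        finally show "norm (H y x - H z x) \<le> 1 / (2 * C) * dist y z * exp (- (\<delta> * x))" by simp
      qed
      have "S (\<lambda>x. H y x - H z x) = (\<lambda>x. S (H y) x - S (H z) x)"
        using solver(2) H[OF that(1)] H[OF that(2)] unfolding decaying_solver_def by blast
      moreover have "decays \<delta> T (C * (1 / (2 * C) * dist y z)) (S (\<lambda>x. H y x - H z x))"
        using solver(2) dec unfolding decaying_solver_def by blast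
      ultimately have "decays \<delta> T (1/2 * dist y z) (\<lambda>x. S (H y) x - S (H z) x)"
        using solver(1) by simp
      from decaysD(2)[OF this, of "max x T"]
      have "exp (\<delta> * max x T) * norm (S (H y) (max x T) - S (H z) (max x T))
          \<le> exp (\<delta> * max x T) * (1/2 * dist y z * exp (- (\<delta> * max x T)))"
        by (intro mult_left_mono) auto
      also have "\<dots> = 1/2 * dist y z" by (simp add: exp_minus)
      finally have "norm (\<Phi> y x - \<Phi> z x) \<le> 1/2 * dist y z"
        unfolding \<Phi>_def scaleR_diff_right[symmetric] by simp
      then show "dist (apply_bcontfun (Bcontfun (\<Phi> y)) x) (apply_bcontfun (Bcontfun (\<Phi> z)) x) \<le> 1/2 * dist y z"
        by (simp add: \<Phi>apply[OF that(1)] \<Phi>apply[OF that(2)] dist_norm)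
    qed
  qed auto
  then obtain y where y: "y \<in> cball 0 M" "Bcontfun (\<Phi> y) = y" by blast
  have yx: "apply_bcontfun y x = exp (\<delta> * x) *\<^sub>R S (H y) x" if "x \<ge> T" for x
  proof -
    have "apply_bcontfun y x = \<Phi> y x" using \<Phi>apply[OF y(1)] y(2) by simp
    then show ?thesis using that by (simp add: \<Phi>_def max_def)
  qed
  \<comment> \<open>From \<open>T\<close> on the unknown and the output of the solver agree, so the
    linear equation with source \<open>H y\<close> is the nonlinear one.\<close>
  have fixed: "H y x = G x (S (H y) x)" if "x \<ge> T" for x
  proof -
    have "W y x = S (H y) x"
      using yx[OF that] by (simp add: W_def exp_add[symmetric])
    then show ?thesis unfolding H_def by simp
  qed
  obtain u' where u': "\<And>x. x \<ge> T \<Longrightarrow> (S (H y) has_vector_derivative u' x) (at x within {T..})"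
      "\<And>x. x \<ge> T \<Longrightarrow> (u' has_vector_derivative u' x - A (S (H y) x) + H y x) (at x within {T..})"
    using solver(2) H[OF y(1)] unfolding decaying_solver_def by blast
  have at: "at x within {T..} = at x" if "x > T" for x
    by (rule at_within_interior) (use that in simp)
  show ?thesis
  proof (rule that)
    show "norm (S (H y) x) \<le> M * exp (- (\<delta> * x))" if "x \<ge> T" for x
      using decaysD(2)[OF S[OF y(1)] that] .
    show "(S (H y) has_vector_derivative u' x) (at x)" if "x > T" for x
      using u'(1)[of x] at[OF that] that by simp
    show "(u' has_vector_derivative u' x - A (S (H y) x) + G x (S (H y) x)) (at x)" if "x > T" for x
      using u'(2)[of x] at[OF that] fixed[of x] that by simp
  qed
qed

lemma exp_poly_continuous: "exp_poly \<gamma> f \<Longrightarrow> continuous_on S f"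
  by (induction rule: exp_poly.induct) (auto intro!: continuous_intros)

text \<open>Each step solves the linear equation driven by the polynomial part of the current
  residual. That correction changes \<open>H\<close> by a residual whose exponents are lower by
  \<open>\<kappa>\<close>. \<open>k\<close> is the exact source seen by \<open>f\<close>, since
  \<open>H x (f x)\<close> is known only up to order \<open>\<eta>\<close>.\<close>

lemma exp_poly_solution_mod_order:
  fixes A :: "'a::euclidean_space \<Rightarrow> 'a" and H :: "real \<Rightarrow> 'a \<Rightarrow> 'a"
  assumes A: "bounded_linear A" "diagonalizable A" and "\<kappa> > 0"
    and H0: "exp_asymp \<gamma> \<eta> (\<lambda>x. H x 0)"
    and HD: "\<And>f g \<gamma>'. exp_poly \<gamma> f \<Longrightarrow> exp_poly \<gamma>' g \<Longrightarrow> \<gamma>' \<le> \<gamma> \<Longrightarrow>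
      exp_asymp (\<gamma>' - \<kappa>) \<eta> (\<lambda>x. H x (f x + g x) - H x (f x))"
  obtains f k f' where "exp_poly \<gamma> f" "exp_poly \<gamma> k"
    "\<forall>x. (f has_vector_derivative f' x) (at x)"
    "\<forall>x. (f' has_vector_derivative f' x - A (f x) + k x) (at x)"
    "exp_order \<eta> (\<lambda>x. H x (f x) - k x)"
proof -
  have "\<exists>f f' k. exp_poly \<gamma> f \<and> exp_poly \<gamma> k \<and> (\<forall>x. (f has_vector_derivative f' x) (at x)) \<and>
    (\<forall>x. (f' has_vector_derivative f' x - A (f x) + k x) (at x)) \<and>
    exp_asymp (\<gamma> - real n * \<kappa>) \<eta> (\<lambda>x. H x (f x) - k x)" for n
  proof (induction n)
    case 0
    show ?case
      by (rule exI[of _ "\<lambda>_. 0"])+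
        (use H0 A(1) in \<open>auto intro: exp_poly_zero simp: linear_0 bounded_linear.linear\<close>)
  next
    case (Suc n)
    then obtain f f' k where f: "exp_poly \<gamma> f" "exp_poly \<gamma> k"
      "\<And>x. (f has_vector_derivative f' x) (at x)"
      "\<And>x. (f' has_vector_derivative f' x - A (f x) + k x) (at x)"
      "exp_asymp (\<gamma> - real n * \<kappa>) \<eta> (\<lambda>x. H x (f x) - k x)" by blast
    obtain h where h: "exp_poly (\<gamma> - real n * \<kappa>) h" "exp_order \<eta> (\<lambda>x. H x (f x) - k x - h x)"
      using f(5) unfolding exp_asymp_def by auto
    obtain g g' where g: "exp_poly (\<gamma> - real n * \<kappa>) g"
      "\<And>x. (g has_vector_derivative g' x) (at x)"
      "\<And>x. (g' has_vector_derivative g' x - A (g x) + h x) (at x)"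
      using exp_poly_second_order[OF A h(1)] by blast
    have le: "\<gamma> - real n * \<kappa> \<le> \<gamma>" using \<open>\<kappa> > 0\<close> by simp
    have lin: "A (f x + g x) = A (f x) + A (g x)" for x
      using A(1) by (simp add: linear_add bounded_linear.linear)
    have "exp_poly \<gamma> (\<lambda>x. f x + g x)" "exp_poly \<gamma> (\<lambda>x. k x + h x)"
      by (intro exp_poly_add f exp_poly_mono[OF g(1) le] exp_poly_mono[OF h(1) le])+
    moreover have "((\<lambda>x. f x + g x) has_vector_derivative f' x + g' x) (at x)" for x
      by (intro has_vector_derivative_add f g)
    moreover have "((\<lambda>x. f' x + g' x) has_vector_derivative
        (f' x + g' x) - A (f x + g x) + (k x + h x)) (at x)" for x
      using has_vector_derivative_add[OF f(4) g(3)] lin by (simp add: algebra_simps)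
    moreover have "exp_asymp (\<gamma> - real (Suc n) * \<kappa>) \<eta> (\<lambda>x. H x (f x + g x) - (k x + h x))"
    proof -
      have "exp_asymp (\<gamma> - real (Suc n) * \<kappa>) \<eta> (\<lambda>x. H x (f x + g x) - H x (f x))"
        using HD[OF f(1) g(1) le] by (simp add: algebra_simps)
      from exp_asymp_add[OF this exp_asymp_order[OF h(2)]] show ?thesis
        by (simp add: algebra_simps)
    qed
    ultimately show ?case
      by (intro exI[of _ "\<lambda>x. f x + g x"] exI[of _ "\<lambda>x. f' x + g' x"] exI[of _ "\<lambda>x. k x + h x"]) blast
  qed note step = this
  \<comment> \<open>After this many steps the polynomial part of the residual has sunk below the
    error level as well.\<close>
  obtain n :: nat where "(\<gamma> - \<eta>) / \<kappa> \<le> real n" using real_arch_simple by blast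
  then have "\<gamma> - real n * \<kappa> \<le> \<eta>" using \<open>\<kappa> > 0\<close> by (simp add: field_simps)
  then show ?thesis using step[of n] that exp_asymp_imp_order[of _ \<eta> _ \<eta>] by blast
qed

text \<open>Subtracting the equation of \<open>f\<close> leaves an equation for \<open>w\<close>
  whose source at \<open>w = 0\<close> is the residual. The order of choices matters:
  \<open>C\<close> and the residual fix \<open>M\<close>, then \<open>M\<close> fixes
  \<open>T\<close>, and only then is the solver for this \<open>T\<close> taken.\<close>

lemma decaying_correction:
  fixes A :: "'a::euclidean_space \<Rightarrow> 'a" and H :: "real \<Rightarrow> 'a \<Rightarrow> 'a"
  assumes solver: "C > 0" "\<And>T. \<exists>S. decaying_solver A \<delta> C T S"
    and res: "exp_order \<eta> (\<lambda>x. H x (f x) - k x)" "\<eta> < - \<delta>"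
    and k: "continuous_on UNIV k"
    and lip: "\<And>M \<epsilon>. \<epsilon> > 0 \<Longrightarrow> \<forall>\<^sub>F x in at_top. \<forall>w\<^sub>1 w\<^sub>2. norm w\<^sub>1 \<le> M * exp (- (\<delta> * x)) \<longrightarrow>
        norm w\<^sub>2 \<le> M * exp (- (\<delta> * x)) \<longrightarrow> norm (H x (f x + w\<^sub>1) - H x (f x + w\<^sub>2)) \<le> \<epsilon> * norm (w\<^sub>1 - w\<^sub>2)"
    and cont: "\<And>M. \<forall>\<^sub>F T in at_top.
        continuous_on {(x, w). x \<ge> T \<and> norm w \<le> M * exp (- (\<delta> * x))} (\<lambda>(x, w). H x (f x + w))"
  obtains T w M w' where "\<forall>x\<ge>T. norm (w x) \<le> M * exp (- (\<delta> * x))"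
    "\<forall>x>T. (w has_vector_derivative w' x) (at x)"
    "\<forall>x>T. (w' has_vector_derivative w' x - A (w x) + (H x (f x + w x) - k x)) (at x)"
proof -
  obtain M\<^sub>0 where M0: "M\<^sub>0 > 0" "\<forall>\<^sub>F x in at_top. norm (H x (f x) - k x) \<le> M\<^sub>0 * exp (- \<delta> * x)"
    using exp_orderD[OF res] .
  define M where "M = 2 * C * M\<^sub>0 + 1"
  have "\<forall>\<^sub>F x in at_top. \<forall>w\<^sub>1 w\<^sub>2. norm w\<^sub>1 \<le> M * exp (- (\<delta> * x)) \<longrightarrow>
        norm w\<^sub>2 \<le> M * exp (- (\<delta> * x)) \<longrightarrow> norm (H x (f x + w\<^sub>1) - H x (f x + w\<^sub>2)) \<le> 1 / (2 * C) * norm (w\<^sub>1 - w\<^sub>2)"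
    by (rule lip) (use solver in simp)
  from eventually_conj[OF M0(2) this] obtain T\<^sub>1 where
    T1: "\<And>x. x \<ge> T\<^sub>1 \<Longrightarrow> norm (H x (f x) - k x) \<le> M\<^sub>0 * exp (- \<delta> * x) \<and>
      (\<forall>w\<^sub>1 w\<^sub>2. norm w\<^sub>1 \<le> M * exp (- (\<delta> * x)) \<longrightarrow> norm w\<^sub>2 \<le> M * exp (- (\<delta> * x)) \<longrightarrow>
        norm (H x (f x + w\<^sub>1) - H x (f x + w\<^sub>2)) \<le> 1 / (2 * C) * norm (w\<^sub>1 - w\<^sub>2))"
    unfolding eventually_at_top_linorder by blast
  from cont[of M] obtain T\<^sub>2 where T2: "\<And>T. T \<ge> T\<^sub>2 \<Longrightarrow>
      continuous_on {(x, w). x \<ge> T \<and> norm w \<le> M * exp (- (\<delta> * x))} (\<lambda>(x, w). H x (f x + w))"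
    unfolding eventually_at_top_linorder by blast
  define T where "T = max T\<^sub>1 T\<^sub>2"
  define G where "G x w = H x (f x + w) - k x" for x w
  obtain S where S: "decaying_solver A \<delta> C T S" using solver by blast
  have contG: "continuous_on {(x, w). x \<ge> T \<and> norm w \<le> M * exp (- (\<delta> * x))} (\<lambda>(x, w). G x w)"
  proof -
    have "continuous_on X (\<lambda>z :: real \<times> 'a. k (fst z))" for X
      by (rule continuous_on_compose2[OF k]) (auto intro!: continuous_intros)
    from continuous_on_diff[OF T2[of T] this] show ?thesis
      by (simp add: T_def G_def case_prod_beta)
  qed
  have G0: "norm (G x 0) \<le> M\<^sub>0 * exp (- (\<delta> * x))" if "x \<ge> T" for x
    using T1[of x] that by (simp add: G_def T_def)
  have Glip: "norm (G x w\<^sub>1 - G x w\<^sub>2) \<le> 1 / (2 * C) * norm (w\<^sub>1 - w\<^sub>2)"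
    if "x \<ge> T" "norm w\<^sub>1 \<le> M * exp (- (\<delta> * x))" "norm w\<^sub>2 \<le> M * exp (- (\<delta> * x))" for x w\<^sub>1 w\<^sub>2
    using T1[of x] that by (simp add: G_def T_def)
  have "M\<^sub>0 \<ge> 0" using M0 by simp
  from decaying_solution_from_solver[OF solver(1) S this M_def G0 Glip contG]
  obtain w w' where "\<And>x. x \<ge> T \<Longrightarrow> norm (w x) \<le> M * exp (- (\<delta> * x))"
    "\<And>x. x > T \<Longrightarrow> (w has_vector_derivative w' x) (at x)"
    "\<And>x. x > T \<Longrightarrow> (w' has_vector_derivative w' x - A (w x) + G x (w x)) (at x)"
    by blast
  then show ?thesis using that unfolding G_def by blast
qed

text \<open>Half of \<open>\<epsilon>\<close> is spent on the order bound, the other half makes the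
  quotient tend to 0.\<close>

lemma exp_order_smallo_plus:
  assumes f: "exp_order \<theta> f" and g: "\<forall>\<^sub>F t in at_top. g t = f (ln t)"
  shows "smallo_plus g \<theta>"
  unfolding smallo_plus_def
proof (intro allI impI)
  fix \<epsilon> :: real assume "\<epsilon> > 0"
  then obtain C where "C > 0" "\<forall>\<^sub>F x in at_top. norm (f x) \<le> C * exp ((\<theta> + \<epsilon> / 2) * x)"
    using exp_orderD[OF f, of "\<theta> + \<epsilon> / 2"] by auto
  then have "\<forall>\<^sub>F t in at_top. norm (f (ln t)) \<le> C * exp ((\<theta> + \<epsilon> / 2) * ln t)"
    using filterlim_iff ln_at_top by blast
  then have "\<forall>\<^sub>F t in at_top. norm (g t /\<^sub>R t powr (\<theta> + \<epsilon>)) \<le> C * t powr (- (\<epsilon> / 2))"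
    using g eventually_gt_at_top[of 0]
  proof eventually_elim
    case (elim t)
    then have "norm (g t) \<le> C * t powr (\<theta> + \<epsilon> / 2)" by (simp add: powr_def)
    moreover have "t powr (\<theta> + \<epsilon> / 2) = t powr (- (\<epsilon> / 2)) * t powr (\<theta> + \<epsilon>)"
      unfolding powr_add[symmetric] by (simp add: add.commute)
    ultimately show ?case using elim by (simp add: field_simps)
  qed
  moreover have "((\<lambda>t::real. C * t powr (- (\<epsilon> / 2))) \<longlongrightarrow> 0) at_top"
    using \<open>\<epsilon> > 0\<close> by (intro tendsto_mult_right_zero tendsto_neg_powr filterlim_ident) auto
  ultimately show "((\<lambda>t. g t /\<^sub>R t powr (\<theta> + \<epsilon>)) \<longlongrightarrow> 0) at_top"
    by (rule Lim_null_comparison)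
qed

subsection \<open>The interaction of clusters\<close>

lemma vec_eq_sum_axis: "x = (\<Sum>i\<in>UNIV. axis i (x $ i))"
  for x :: "'a::comm_monoid_add ^ 'n::finite"
proof -
  have "(\<Sum>i\<in>UNIV. axis i (x $ i)) $ j = (\<Sum>i\<in>UNIV. if i = j then x $ i else 0)" for j
    unfolding sum_component by (intro sum.cong) (auto simp: axis_def)
  then show ?thesis by (simp add: vec_eq_iff)
qed

lemma exp_asymp_vec:
  fixes f :: "real \<Rightarrow> (real ^ 'd) ^ 'n"
  assumes "\<And>i. exp_asymp \<gamma> \<theta> (\<lambda>x. f x $ i)"
  shows "exp_asymp \<gamma> \<theta> f"
proof -
  have "bounded_linear (axis i :: real ^ 'd \<Rightarrow> (real ^ 'd) ^ 'n)" for i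
    by (auto simp: linear_conv_bounded_linear[symmetric] vec_eq_iff axis_def intro!: linearI)
  then have "exp_asymp \<gamma> \<theta> (\<lambda>x. axis i (f x $ i) :: (real ^ 'd) ^ 'n)" for i
    by (rule exp_asymp_bounded_linear[OF _ assms])
  then have "exp_asymp \<gamma> \<theta> (\<lambda>x. \<Sum>i\<in>UNIV. axis i (f x $ i))"
    by (rule exp_asymp_sum)
  then show ?thesis by (simp add: vec_eq_sum_axis[symmetric])
qed

lemma norm_vec_le_sum: "norm x \<le> (\<Sum>i\<in>UNIV. norm (x $ i))"
  for x :: "'a::real_normed_vector ^ 'n::finite"
  unfolding norm_vec_def by (rule L2_set_le_sum) simp

lemma bounded_linear_vec_diff: "bounded_linear (\<lambda>x :: 'a::real_normed_vector ^ 'n::finite. x $ i - x $ j)"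
  by (intro bounded_linear_sub bounded_linear_vec_nth)

lemma norm_vec_diff_le: "norm (x $ i - x $ j) \<le> 2 * norm x"
  for x :: "'a::real_normed_vector ^ 'n::finite"
  using norm_triangle_ineq4[of "x $ i" "x $ j"] Finite_Cartesian_Product.norm_nth_le[of x i] Finite_Cartesian_Product.norm_nth_le[of x j] by linarith

lemma continuous_on_attraction:
  assumes "continuous_on S g" "\<And>x. x \<in> S \<Longrightarrow> g x \<noteq> 0"
  shows "continuous_on S (\<lambda>x. attraction p (g x))"
  unfolding attraction_def using assms by (intro continuous_intros) auto

text \<open>Covers pairs inside a cluster and between clusters alike: \<open>c\<close> is the limit
  of the rescaled gap, \<open>z\<close> a known vanishing offset, and \<open>\<sigma>\<close> the
  factor with which the unknown enters. As everything shrinks around \<open>c\<close>, strict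
  differentiability yields any \<open>\<epsilon>\<close>.\<close>

lemma attraction_pair_small_lipschitz:
  fixes c :: "'a::real_inner" and z :: "real \<Rightarrow> 'a" and \<sigma> R :: "real \<Rightarrow> real"
  assumes c: "c \<noteq> 0" and z: "(z \<longlongrightarrow> 0) at_top" and R: "((\<lambda>x. \<sigma> x * R x) \<longlongrightarrow> 0) at_top"
    and \<sigma>: "\<And>x. \<sigma> x > 0" and "\<epsilon> > 0"
  shows "\<forall>\<^sub>F x in at_top. \<forall>u\<^sub>1 u\<^sub>2 :: 'a. norm u\<^sub>1 \<le> R x \<longrightarrow> norm u\<^sub>2 \<le> R x \<longrightarrow>
      norm (attraction p (c + (z x + \<sigma> x *\<^sub>R u\<^sub>1)) - attraction p (c + (z x + \<sigma> x *\<^sub>R u\<^sub>2))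
        - attraction_deriv p c (\<sigma> x *\<^sub>R (u\<^sub>1 - u\<^sub>2))) \<le> \<epsilon> * \<sigma> x * norm (u\<^sub>1 - u\<^sub>2)"
proof -
  obtain K \<rho>\<^sub>0 where K: "K \<ge> 0" "\<rho>\<^sub>0 > 0"
    "\<And>x y \<rho>. norm x \<le> \<rho> \<Longrightarrow> norm y \<le> \<rho> \<Longrightarrow> \<rho> \<le> \<rho>\<^sub>0 \<Longrightarrow>
      norm (attraction p (c + x) - attraction p (c + y) - attraction_deriv p c (x - y)) \<le> K * \<rho> * norm (x - y)"
    using attraction_strict_deriv[OF c, of p] by blast
  define \<rho> where "\<rho> = min \<rho>\<^sub>0 (\<epsilon> / (K + 1))"
  have \<rho>: "\<rho> > 0" "\<rho> \<le> \<rho>\<^sub>0" using K \<open>\<epsilon> > 0\<close> by (auto simp: \<rho>_def)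
  have "K * \<rho> \<le> (K + 1) * (\<epsilon> / (K + 1))"
    using K \<rho> by (intro mult_mono) (auto simp: \<rho>_def)
  then have K\<rho>: "K * \<rho> \<le> \<epsilon>" using K by simp
  have "((\<lambda>x. norm (z x) + \<sigma> x * R x) \<longlongrightarrow> 0) at_top"
    using tendsto_add[OF tendsto_norm_zero[OF z] R] by simp
  then have "\<forall>\<^sub>F x in at_top. norm (z x) + \<sigma> x * R x < \<rho>"
    using \<rho> by (auto intro: order_tendstoD)
  then show ?thesis
  proof eventually_elim
    case (elim x)
    have b: "norm (z x + \<sigma> x *\<^sub>R u) \<le> \<rho>" if "norm u \<le> R x" for u
    proof -
      have "norm (z x + \<sigma> x *\<^sub>R u) \<le> norm (z x) + \<sigma> x * norm u"
        using norm_triangle_ineq[of "z x" "\<sigma> x *\<^sub>R u"] \<sigma>[of x] by simp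
      also have "\<dots> \<le> norm (z x) + \<sigma> x * R x"
        using that \<sigma>[of x] by simp
      finally show ?thesis using elim by simp
    qed
    show ?case
    proof (intro allI impI)
      fix u\<^sub>1 u\<^sub>2 :: 'a assume u: "norm u\<^sub>1 \<le> R x" "norm u\<^sub>2 \<le> R x"
      have e: "z x + \<sigma> x *\<^sub>R u\<^sub>1 - (z x + \<sigma> x *\<^sub>R u\<^sub>2) = \<sigma> x *\<^sub>R (u\<^sub>1 - u\<^sub>2)"
        by (simp add: scaleR_diff_right)
      have "K * \<rho> * norm (\<sigma> x *\<^sub>R (u\<^sub>1 - u\<^sub>2)) \<le> \<epsilon> * norm (\<sigma> x *\<^sub>R (u\<^sub>1 - u\<^sub>2))"
        using K\<rho> by (intro mult_right_mono) auto
      from order_trans[OF K(3)[OF b[OF u(1)] b[OF u(2)] \<rho>(2), unfolded e] this]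
      show "norm (attraction p (c + (z x + \<sigma> x *\<^sub>R u\<^sub>1)) - attraction p (c + (z x + \<sigma> x *\<^sub>R u\<^sub>2))
        - attraction_deriv p c (\<sigma> x *\<^sub>R (u\<^sub>1 - u\<^sub>2))) \<le> \<epsilon> * \<sigma> x * norm (u\<^sub>1 - u\<^sub>2)"
        using \<sigma>[of x] by (simp add: mult.assoc)
    qed
  qed
qed

lemma pair_eventually_nonzero:
  fixes c :: "'a::real_inner" and z :: "real \<Rightarrow> 'a" and \<sigma> R :: "real \<Rightarrow> real"
  assumes c: "c \<noteq> 0" and z: "(z \<longlongrightarrow> 0) at_top" and R: "((\<lambda>x. \<sigma> x * R x) \<longlongrightarrow> 0) at_top"
    and \<sigma>: "\<And>x. \<sigma> x > 0"
  shows "\<forall>\<^sub>F x in at_top. \<forall>u. norm u \<le> R x \<longrightarrow> c + (z x + \<sigma> x *\<^sub>R u) \<noteq> 0"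
proof -
  have "((\<lambda>x. norm (z x) + \<sigma> x * R x) \<longlongrightarrow> 0) at_top"
    using tendsto_add[OF tendsto_norm_zero[OF z] R] by simp
  then have "\<forall>\<^sub>F x in at_top. norm (z x) + \<sigma> x * R x < norm c"
    using c by (auto intro: order_tendstoD)
  then show ?thesis
  proof eventually_elim
    case (elim x)
    show ?case
    proof (intro allI impI notI)
      fix u assume u: "norm u \<le> R x" and "c + (z x + \<sigma> x *\<^sub>R u) = 0"
      then have "norm c = norm (z x + \<sigma> x *\<^sub>R u)" by (metis add_eq_0_iff2 norm_minus_cancel)
      also have "\<dots> \<le> norm (z x) + \<sigma> x * norm u"
        using norm_triangle_ineq[of "z x" "\<sigma> x *\<^sub>R u"] \<sigma>[of x] by simp
      also have "\<dots> \<le> norm (z x) + \<sigma> x * R x" using u \<sigma>[of x] by simp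
      finally show False using elim by simp
    qed
  qed
qed

definition gap :: "'n \<Rightarrow> 'n \<Rightarrow> 'a::real_normed_vector ^ 'n::finite \<Rightarrow> 'a" where
  "gap i j x = x $ i - x $ j"

lemma bounded_linear_gap: "bounded_linear (gap i j)"
  unfolding gap_def[abs_def] by (rule bounded_linear_vec_diff)

lemma gap_simps:
  "gap i j (x + y) = gap i j x + gap i j y" "gap i j (x - y) = gap i j x - gap i j y"
  "gap i j (c *\<^sub>R x) = c *\<^sub>R gap i j x" "gap i j 0 = 0"
  unfolding gap_def by (simp_all add: scaleR_diff_right)

lemma gap_swap: "gap j i x = - gap i j x"
  unfolding gap_def by simp

lemma norm_gap_le: "norm (gap i j x) \<le> 2 * norm x"
  unfolding gap_def by (rule norm_vec_diff_le)

section \<open>The cluster equations in logarithmic time\<close>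

text \<open>Only the shape of the given cluster motion is assumed here, with \<open>b\<close> its
  relative remainder. That it solves the cluster systems enters in the final theorem, where its
  acceleration balances the force that \<open>H\<close> subtracts.\<close>

locale clustered_bodies =
  fixes lam :: "'n::finite \<Rightarrow> real" and p q :: real
    and v a :: "(real ^ 'd::finite) ^ 'n" and b :: "real \<Rightarrow> (real ^ 'd) ^ 'n"
  assumes lam: "\<And>i. lam i > 0" and p: "p > 0"
    and a: "\<And>i j. i \<noteq> j \<Longrightarrow> v $ i = v $ j \<Longrightarrow> a $ i \<noteq> a $ j"
    and q: "q < 2 / (p + 2) + p - 1" "q < 2 / (p + 2)"
    and b_order: "exp_order (q - 2 / (p + 2)) b" and b_cont: "continuous_on UNIV b"
begin

definition r :: real where "r = 2 / (p + 2)"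
text \<open>The slowest decay among the perturbations of the rescaled gaps: \<open>p\<close> and
  \<open>1 - r\<close> from the far gaps (unknown and cluster motion against \<open>t\<close>),
  \<open>r + p - 1\<close> and \<open>r - q\<close> from the near ones (unknown and remainder
  against \<open>t powr r\<close>).\<close>

definition \<kappa> :: real where "\<kappa> = min (min p (1 - r)) (min (r + p - 1) (r - q))"
text \<open>Where the unknown \<open>b\<close> limits the expansion: in the near forces it
  multiplies an unknown of exponent \<open>1 - p\<close>, giving \<open>1 - p + q - r\<close>; in
  the far forces, of exponent \<open>1 - p\<close>, it is a relative error of exponent
  \<open>q - 1\<close>, giving \<open>q - p\<close>.\<close>

definition \<eta> :: real where "\<eta> = max (1 - p + q - r) (q - p)"

definition near :: "'n \<Rightarrow> 'n set" where "near i = {j. j \<noteq> i \<and> v $ i = v $ j}"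
definition far :: "'n \<Rightarrow> 'n set" where "far i = {j. v $ i \<noteq> v $ j}"

text \<open>At time \<open>t = exp x\<close>, the vector between the bodies \<open>i\<close> and \<open>j\<close> is \<open>t powr r *\<^sub>R (gap i j a + near_arg i j x w)\<close>
  inside a cluster and \<open>t *\<^sub>R (gap i j v + far_arg i j x w)\<close> between clusters, \<open>w\<close> being the unknown.
  The exponentials in \<open>H\<close> come from the homogeneity of the attraction and \<open>r * (p + 2) = 2\<close>.\<close>

definition near_arg :: "'n \<Rightarrow> 'n \<Rightarrow> real \<Rightarrow> (real ^ 'd) ^ 'n \<Rightarrow> real ^ 'd" where
  "near_arg i j x w = gap i j (b x) + exp (- r * x) *\<^sub>R gap i j w"
definition far_arg :: "'n \<Rightarrow> 'n \<Rightarrow> real \<Rightarrow> (real ^ 'd) ^ 'n \<Rightarrow> real ^ 'd" where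
  "far_arg i j x w = exp ((r - 1) * x) *\<^sub>R gap i j (a + b x) + exp (- 1 * x) *\<^sub>R gap i j w"

text \<open>Linearised at the limit shape \<open>a\<close>, not at \<open>a + b x\<close>, so that
  the coefficients are constant; the discrepancy is left to the nonlinearity.\<close>

definition lin :: "(real ^ 'd) ^ 'n \<Rightarrow> (real ^ 'd) ^ 'n" where
  "lin w = (\<chi> i. \<Sum>j\<in>near i. lam j *\<^sub>R attraction_deriv p (gap i j a) (gap i j w))"

definition H :: "real \<Rightarrow> (real ^ 'd) ^ 'n \<Rightarrow> (real ^ 'd) ^ 'n" where
  "H x w = (\<chi> i. lin w $ i
    - exp (r * x) *\<^sub>R (\<Sum>j\<in>near i. lam j *\<^sub>R
        (attraction p (gap i j a + near_arg i j x w) - attraction p (gap i j a + near_arg i j x 0)))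
    - exp ((1 - p) * x) *\<^sub>R (\<Sum>j\<in>far i. lam j *\<^sub>R attraction p (gap i j v + far_arg i j x w)))"

text \<open>The last claim says that corrections of exponent \<open>1 - p\<close> are small against
  the cluster size \<open>t powr r\<close>; it amounts to \<open>0 < p + p * p\<close>.\<close>

lemma r: "0 < r" "r < 1" "r * (p + 2) = 2" "1 - p < r"
proof -
  show "0 < r" "r < 1" using p by (auto simp: r_def)
  have "p + 2 \<noteq> 0" using p by simp
  then show "r * (p + 2) = 2" using nonzero_eq_divide_eq[THEN iffD1, OF _ r_def] by blast
  have "0 < p + p * p" using p by (intro add_pos_pos mult_pos_pos)
  then have "(1 - p) * (p + 2) < 2" by (simp add: algebra_simps)
  then show "1 - p < r" using p by (simp add: r_def pos_less_divide_eq)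
qed

lemma \<kappa>: "\<kappa> > 0" "\<kappa> \<le> p" "\<kappa> \<le> 1 - r" "\<kappa> \<le> r + p - 1" "\<kappa> \<le> r - q"
  using r p q unfolding \<kappa>_def by (auto simp: r_def[symmetric])

text \<open>Both halves of the hypothesis on \<open>q\<close> act here: \<open>q < r + p - 1\<close>
  makes \<open>\<eta>\<close> negative and \<open>q < r\<close> puts it below \<open>1 - p\<close>,
  with \<open>r < 1\<close> taking care of the exponent \<open>q - p\<close>. This leaves room for
  the weight.\<close>

lemma \<eta>: "1 - p + q - r \<le> \<eta>" "q - p \<le> \<eta>" "\<eta> < 0" "\<eta> < 1 - p"
  using r p q unfolding \<eta>_def by (auto simp: r_def[symmetric])

lemma near_gap: "j \<in> near i \<Longrightarrow> gap i j a \<noteq> 0"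
  using a[of i j] by (auto simp: near_def gap_def)

lemma far_gap: "j \<in> far i \<Longrightarrow> gap i j v \<noteq> 0"
  by (auto simp: far_def gap_def)

lemma b_order': "exp_order (q - r) (\<lambda>x. gap i j (b x))"
  unfolding r_def by (rule exp_order_bounded_linear[OF bounded_linear_gap b_order])

lemma attraction_deriv_linear: "linear (attraction_deriv p c)"
  using bounded_linear_attraction_deriv by (rule bounded_linear.linear)

subsection \<open>Mass symmetry of the linear part\<close>

lemma linear_lin: "linear lin"
  by (rule linearI)
    (simp_all add: lin_def vec_eq_iff gap_simps linear_add[OF attraction_deriv_linear]
      linear_scale[OF attraction_deriv_linear] scaleR_add_right sum.distrib scaleR_sum_right mult.commute)

text \<open>Action and reaction: exchanging the two bodies of a pair flips both the gap and the
  linearised force, so symmetrising the sum over ordered pairs turns \<open>y $ i\<close> into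
  \<open>gap i j y\<close>, and the symmetry of \<open>attraction_deriv\<close> applies.\<close>

lemma lin_mass_symmetric:
  "(\<Sum>i\<in>UNIV. lam i * (y $ i \<bullet> lin x $ i)) = (\<Sum>i\<in>UNIV. lam i * (x $ i \<bullet> lin y $ i))"
proof -
  define B where "B i j x y = lam i * lam j * (gap i j y \<bullet> attraction_deriv p (gap i j a) (gap i j x))"
    for i j and x y :: "(real ^ 'd) ^ 'n"
  define P where "P = {(i, j). j \<in> near i}"
  have swap: "prod.swap ` P = P" unfolding P_def near_def by (force simp: image_iff)
  have double: "2 * (\<Sum>i\<in>UNIV. lam i * (y $ i \<bullet> lin x $ i)) = (\<Sum>(i, j)\<in>P. B i j x y)" for x y
  proof -
    define g where "g = (\<lambda>(i, j). lam i * lam j * (y $ i \<bullet> attraction_deriv p (gap i j a) (gap i j x)))"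
    have "(\<Sum>i\<in>UNIV. lam i * (y $ i \<bullet> lin x $ i)) = (\<Sum>i\<in>UNIV. \<Sum>j\<in>near i. g (i, j))"
      by (simp add: lin_def g_def inner_sum_right sum_distrib_left mult.assoc)
    also have "\<dots> = sum g P"
      unfolding P_def by (subst sum.Sigma) (auto simp: Sigma_def intro!: sum.cong)
    finally have 1: "(\<Sum>i\<in>UNIV. lam i * (y $ i \<bullet> lin x $ i)) = sum g P" .
    have "sum g P = sum g (prod.swap ` P)" by (simp only: swap)
    also have "\<dots> = (\<Sum>z\<in>P. g (prod.swap z))"
      by (simp add: sum.reindex)
    finally have "2 * sum g P = (\<Sum>z\<in>P. g z + g (prod.swap z))" by (simp add: sum.distrib)
    also have "\<dots> = (\<Sum>(i, j)\<in>P. B i j x y)"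
    proof (rule sum.cong[OF refl], clarify)
      fix i j
      have "attraction_deriv p (gap j i a) (gap j i x) = - attraction_deriv p (gap i j a) (gap i j x)"
        unfolding gap_swap[of j i] attraction_deriv_minus
        by (rule linear_neg[OF attraction_deriv_linear])
      then show "g (i, j) + g (prod.swap (i, j)) = B i j x y"
        by (simp add: g_def B_def gap_def inner_diff_left right_diff_distrib mult.commute)
    qed
    finally show ?thesis using 1 by simp
  qed
  have "B i j x y = B i j y x" for i j x y
    unfolding B_def by (subst attraction_deriv_sym) simp
  then have "(\<Sum>(i, j)\<in>P. B i j x y) = (\<Sum>(i, j)\<in>P. B i j y x)"
    by (intro sum.cong refl) auto
  then show ?thesis
    using double[where x = x and y = y] double[where x = y and y = x] by linarith
qed

text \<open>Scaling by the square roots of the masses carries the mass inner product to the standard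
  one.\<close>

lemma diagonalizable_lin: "diagonalizable lin"
proof (rule diagonalizable_conjugate[where D = "\<lambda>x. \<chi> i. sqrt (lam i) *\<^sub>R x $ i"
      and D' = "\<lambda>x. \<chi> i. (1 / sqrt (lam i)) *\<^sub>R x $ i"])
  let ?D = "\<lambda>x::(real ^ 'd) ^ 'n. \<chi> i. sqrt (lam i) *\<^sub>R x $ i"
  let ?D' = "\<lambda>x::(real ^ 'd) ^ 'n. \<chi> i. (1 / sqrt (lam i)) *\<^sub>R x $ i"
  have s: "sqrt (lam i) > 0" for i using lam[of i] by simp
  show "linear lin" by (rule linear_lin)
  show "linear ?D" "linear ?D'"
    by (auto intro!: linearI simp: vec_eq_iff scaleR_add_right)
  show "?D (?D' x) = x" "?D' (?D x) = x" for x
    using s by (simp_all add: vec_eq_iff order_less_imp_not_eq2)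
  fix x y :: "(real ^ 'd) ^ 'n"
  have *: "x \<bullet> ?D (lin (?D' y)) = (\<Sum>i\<in>UNIV. lam i * (?D' x $ i \<bullet> lin (?D' y) $ i))" for x y
  proof -
    have "x $ i \<bullet> ?D (lin (?D' y)) $ i = lam i * (?D' x $ i \<bullet> lin (?D' y) $ i)" for i
    proof -
      have "lam i * (1 / sqrt (lam i)) = sqrt (lam i)"
        using lam[of i] by (simp add: real_div_sqrt)
      then show ?thesis
        by (simp only: vec_lambda_beta inner_scaleR_right inner_scaleR_left mult.assoc[symmetric])
    qed
    then show ?thesis by (subst inner_vec_def) (rule sum.cong[OF refl])
  qed
  show "x \<bullet> ?D (lin (?D' y)) = ?D (lin (?D' x)) \<bullet> y"
    unfolding inner_commute[of "?D (lin (?D' x))"] * by (rule lin_mass_symmetric)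
qed

subsection \<open>Expansion of the nonlinearity\<close>

lemma near_arg_diff: "near_arg i j x w - near_arg i j x w' = exp (- r * x) *\<^sub>R gap i j (w - w')"
  by (simp add: near_arg_def gap_simps scaleR_diff_right)

lemma far_arg_diff: "far_arg i j x w - far_arg i j x w' = exp (- 1 * x) *\<^sub>R gap i j (w - w')"
  by (simp add: far_arg_def gap_simps scaleR_diff_right)

text \<open>The force of the cluster motion cancels, and \<open>exp (r * x)\<close> cancels the
  factor \<open>exp (- r * x)\<close> of \<open>near_arg_diff\<close>, so that the difference of
  \<open>lin\<close> becomes the derivative term of each near pair.\<close>

lemma H_diff:
  "H x w $ i - H x w' $ i =
    - (\<Sum>j\<in>near i. lam j *\<^sub>R (exp (r * x) *\<^sub>R
        (attraction p (gap i j a + near_arg i j x w) - attraction p (gap i j a + near_arg i j x w')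
          - attraction_deriv p (gap i j a) (near_arg i j x w - near_arg i j x w'))))
    - (\<Sum>j\<in>far i. lam j *\<^sub>R (exp ((1 - p) * x) *\<^sub>R
        (attraction p (gap i j v + far_arg i j x w) - attraction p (gap i j v + far_arg i j x w'))))"
proof -
  define N where "N j u = attraction p (gap i j a + near_arg i j x u)" for j u
  define F where "F j u = attraction p (gap i j v + far_arg i j x u)" for j u
  define D where "D j = attraction_deriv p (gap i j a) (near_arg i j x w - near_arg i j x w')" for j
  have "exp (r * x) *\<^sub>R D j = attraction_deriv p (gap i j a) (gap i j w) - attraction_deriv p (gap i j a) (gap i j w')" for j
    unfolding D_def near_arg_diff linear_diff[OF attraction_deriv_linear, symmetric]
    by (simp add: linear_scale[OF attraction_deriv_linear] gap_simps exp_minus)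
  then have lin: "lin w $ i - lin w' $ i = (\<Sum>j\<in>near i. lam j *\<^sub>R (exp (r * x) *\<^sub>R D j))"
    by (simp add: lin_def sum_subtractf scaleR_diff_right)
  have pull: "c *\<^sub>R (\<Sum>j\<in>J. lam j *\<^sub>R g j) = (\<Sum>j\<in>J. lam j *\<^sub>R (c *\<^sub>R g j))" for c J and g :: "'n \<Rightarrow> real ^ 'd"
    by (simp add: scaleR_sum_right mult.commute)
  have "H x w $ i - H x w' $ i = (lin w $ i - lin w' $ i)
      - (\<Sum>j\<in>near i. lam j *\<^sub>R (exp (r * x) *\<^sub>R (N j w - N j w')))
      - (\<Sum>j\<in>far i. lam j *\<^sub>R (exp ((1 - p) * x) *\<^sub>R (F j w - F j w')))"
    unfolding H_def vec_lambda_beta N_def[symmetric] F_def[symmetric] pull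
    by (simp only: scaleR_diff_right sum_subtractf) simp
  then show ?thesis
    unfolding lin N_def[symmetric] F_def[symmetric] D_def[symmetric]
    by (simp only: scaleR_diff_right sum_subtractf) simp
qed

lemma exp_asymp_near_arg:
  assumes "exp_poly (1 - p) f"
  shows "exp_asymp (- \<kappa>) (q - r) (\<lambda>x. near_arg i j x (f x))"
  unfolding near_arg_def
proof (rule exp_asymp_add)
  show "exp_asymp (- \<kappa>) (q - r) (\<lambda>x. gap i j (b x))"
    by (rule exp_asymp_order[OF b_order'])
  show "exp_asymp (- \<kappa>) (q - r) (\<lambda>x. exp (- r * x) *\<^sub>R gap i j (f x))"
    by (rule exp_asymp_poly[OF exp_poly_shift[OF exp_poly_bounded_linear[OF bounded_linear_gap assms]]])
      (use \<kappa> in auto)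
qed

lemma exp_asymp_far_arg:
  assumes "exp_poly (1 - p) f"
  shows "exp_asymp (- \<kappa>) (q - 1) (\<lambda>x. far_arg i j x (f x))"
  unfolding far_arg_def gap_simps
proof (intro exp_asymp_add)
  have "exp_asymp 0 (q - r) (\<lambda>x. gap i j a + gap i j (b x))"
    by (intro exp_asymp_add exp_asymp_poly[OF exp_poly_const] exp_asymp_order[OF b_order']) auto
  then show "exp_asymp (- \<kappa>) (q - 1) (\<lambda>x. exp ((r - 1) * x) *\<^sub>R (gap i j a + gap i j (b x)))"
    by (rule exp_asymp_shift) (use \<kappa> in auto)
  show "exp_asymp (- \<kappa>) (q - 1) (\<lambda>x. exp (- 1 * x) *\<^sub>R gap i j (f x))"
    by (rule exp_asymp_poly[OF exp_poly_shift[OF exp_poly_bounded_linear[OF bounded_linear_gap assms]]])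
      (use \<kappa> in auto)
qed

text \<open>Near pairs: the arguments differ at level \<open>\<gamma> - r\<close>, the weight
  restores \<open>r\<close>, and the gain \<open>\<kappa>\<close> comes from subtracting the
  derivative. Far pairs: level \<open>\<gamma> - 1\<close> and weight \<open>1 - p\<close> add up to
  \<open>\<gamma> - p\<close>, so a first-order expansion suffices.\<close>

lemma exp_asymp_H_diff:
  assumes f: "exp_poly (1 - p) f" and g: "exp_poly \<gamma> g" and \<gamma>: "\<gamma> \<le> 1 - p"
  shows "exp_asymp (\<gamma> - \<kappa>) \<eta> (\<lambda>x. H x (f x + g x) - H x (f x))"
proof (rule exp_asymp_vec)
  fix i
  have fg: "exp_poly (1 - p) (\<lambda>x. f x + g x)"
    by (intro exp_poly_add f exp_poly_mono[OF g \<gamma>])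
  have near: "exp_asymp (\<gamma> - \<kappa>) \<eta> (\<lambda>x. lam j *\<^sub>R (exp (r * x) *\<^sub>R
        (attraction p (gap i j a + near_arg i j x (f x + g x)) - attraction p (gap i j a + near_arg i j x (f x))
          - attraction_deriv p (gap i j a) (near_arg i j x (f x + g x) - near_arg i j x (f x)))))"
    if "j \<in> near i" for j
  proof (rule exp_asymp_bounded_linear[OF bounded_linear_scaleR_right], rule exp_asymp_shift)
    show "exp_asymp (\<gamma> - r - \<kappa>) (\<gamma> - r + (q - r)) (\<lambda>x.
        attraction p (gap i j a + near_arg i j x (f x + g x)) - attraction p (gap i j a + near_arg i j x (f x))
          - attraction_deriv p (gap i j a) (near_arg i j x (f x + g x) - near_arg i j x (f x)))"
    proof (rule exp_asymp_attraction_diff(1)[OF near_gap[OF that] \<kappa>(1) _ exp_asymp_near_arg[OF fg] exp_asymp_near_arg[OF f]])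
      show "q - r \<le> - \<kappa>" using \<kappa> by simp
      show "exp_asymp (\<gamma> - r) (\<gamma> - r + (q - r)) (\<lambda>x. near_arg i j x (f x + g x) - near_arg i j x (f x))"
        unfolding near_arg_diff add_diff_cancel_left'
        by (rule exp_asymp_poly[OF exp_poly_shift[OF exp_poly_bounded_linear[OF bounded_linear_gap g]]]) simp
    qed
  qed (use \<gamma> \<eta> in auto)
  have far: "exp_asymp (\<gamma> - \<kappa>) \<eta> (\<lambda>x. lam j *\<^sub>R (exp ((1 - p) * x) *\<^sub>R
        (attraction p (gap i j v + far_arg i j x (f x + g x)) - attraction p (gap i j v + far_arg i j x (f x)))))"
    if "j \<in> far i" for j
  proof (rule exp_asymp_bounded_linear[OF bounded_linear_scaleR_right], rule exp_asymp_shift)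
    show "exp_asymp (\<gamma> - 1) (\<gamma> - 1 + (q - 1)) (\<lambda>x.
        attraction p (gap i j v + far_arg i j x (f x + g x)) - attraction p (gap i j v + far_arg i j x (f x)))"
    proof (rule exp_asymp_attraction_diff(2)[OF far_gap[OF that] \<kappa>(1) _ exp_asymp_far_arg[OF fg] exp_asymp_far_arg[OF f]])
      show "q - 1 \<le> - \<kappa>" using \<kappa> by simp
      show "exp_asymp (\<gamma> - 1) (\<gamma> - 1 + (q - 1)) (\<lambda>x. far_arg i j x (f x + g x) - far_arg i j x (f x))"
        unfolding far_arg_diff add_diff_cancel_left'
        by (rule exp_asymp_poly[OF exp_poly_shift[OF exp_poly_bounded_linear[OF bounded_linear_gap g]]]) simp
    qed
  qed (use \<gamma> \<eta> \<kappa> p in auto)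
  have "exp_asymp (\<gamma> - \<kappa>) \<eta> (\<lambda>x. 0 - (\<Sum>j\<in>near i. lam j *\<^sub>R (exp (r * x) *\<^sub>R
        (attraction p (gap i j a + near_arg i j x (f x + g x)) - attraction p (gap i j a + near_arg i j x (f x))
          - attraction_deriv p (gap i j a) (near_arg i j x (f x + g x) - near_arg i j x (f x)))))
      - (\<Sum>j\<in>far i. lam j *\<^sub>R (exp ((1 - p) * x) *\<^sub>R
        (attraction p (gap i j v + far_arg i j x (f x + g x)) - attraction p (gap i j v + far_arg i j x (f x))))))"
    by (intro exp_asymp_diff exp_asymp_sum exp_asymp_zero near far)
  then show "exp_asymp (\<gamma> - \<kappa>) \<eta> (\<lambda>x. (H x (f x + g x) - H x (f x)) $ i)"
    by (simp only: vector_minus_component H_diff diff_0)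
qed

text \<open>At \<open>w = 0\<close> the near terms vanish; the forces between clusters remain and
  are the origin of the exponent \<open>1 - p\<close>.\<close>

lemma exp_asymp_H_0: "exp_asymp (1 - p) \<eta> (\<lambda>x. H x 0)"
proof (rule exp_asymp_vec)
  fix i
  have far: "exp_asymp (1 - p) \<eta> (\<lambda>x. lam j *\<^sub>R (exp ((1 - p) * x) *\<^sub>R attraction p (gap i j v + far_arg i j x 0)))"
    if "j \<in> far i" for j
  proof (rule exp_asymp_bounded_linear[OF bounded_linear_scaleR_right], rule exp_asymp_shift)
    have arg: "exp_asymp (- \<kappa>) (q - 1) (\<lambda>x. far_arg i j x 0)"
      using exp_asymp_far_arg[OF exp_poly_zero] by simp
    have "exp_asymp 0 (0 + (q - 1)) (\<lambda>x. attraction p (gap i j v + far_arg i j x 0) - attraction p (gap i j v + 0))"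
    proof (rule exp_asymp_attraction_diff(2)[OF far_gap[OF that] \<kappa>(1) _ arg exp_asymp_zero])
      show "q - 1 \<le> - \<kappa>" using \<kappa> by simp
      show "exp_asymp 0 (0 + (q - 1)) (\<lambda>x. far_arg i j x 0 - 0)"
        using exp_asymp_mono[OF arg, of 0 "q - 1"] \<kappa> by simp
    qed
    from exp_asymp_add[OF this exp_asymp_poly[OF exp_poly_const[OF order.refl, of "attraction p (gap i j v)"]]]
    show "exp_asymp 0 (q - 1) (\<lambda>x. attraction p (gap i j v + far_arg i j x 0))" by simp
  qed (use \<eta> in auto)
  have *: "H x 0 $ i = 0 - (\<Sum>j\<in>far i. lam j *\<^sub>R (exp ((1 - p) * x) *\<^sub>R attraction p (gap i j v + far_arg i j x 0)))" for x
    by (simp add: H_def linear_0[OF linear_lin] scaleR_sum_right mult.commute)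
  show "exp_asymp (1 - p) \<eta> (\<lambda>x. H x 0 $ i)"
    unfolding * by (intro exp_asymp_diff exp_asymp_sum exp_asymp_zero far)
qed


subsection \<open>Lipschitz bounds and continuity\<close>

lemma b_tendsto: "((\<lambda>x. gap i j (b x)) \<longlongrightarrow> 0) at_top"
  by (rule exp_order_tendsto_0[OF b_order']) (use \<kappa> in auto)

lemma far_offset_tendsto: "((\<lambda>x. exp ((r - 1) * x) *\<^sub>R gap i j (a + b x)) \<longlongrightarrow> 0) at_top"
proof (rule exp_order_tendsto_0[OF exp_order_shift])
  have "exp_asymp 0 (q - r) (\<lambda>x. gap i j (a + b x))"
    unfolding gap_simps by (intro exp_asymp_add exp_asymp_poly[OF exp_poly_const] exp_asymp_order[OF b_order']) auto
  then show "exp_order 0 (\<lambda>x. gap i j (a + b x))"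
    by (rule exp_asymp_imp_order) (use \<kappa> in auto)
  show "0 + (r - 1) \<le> r - 1" by simp
  show "r - 1 < 0" using r by simp
qed

text \<open>A bound for the gaps of \<open>f x + w\<close> over the weighted ball: the 2 is that of
  \<open>norm_gap_le\<close>, and \<open>\<bar>M\<bar>\<close> keeps it nonnegative for every
  \<open>M\<close>.\<close>

definition radius :: "(real \<Rightarrow> (real ^ 'd) ^ 'n) \<Rightarrow> real \<Rightarrow> real \<Rightarrow> real \<Rightarrow> real" where
  "radius f \<delta> M x = 2 * (norm (f x) + \<bar>M\<bar> * exp (- (\<delta> * x)))"

lemma gap_le_radius:
  assumes "norm w \<le> M * exp (- (\<delta> * x))"
  shows "norm (gap i j (f x + w)) \<le> radius f \<delta> M x"
proof -
  note assms
  also have "M * exp (- (\<delta> * x)) \<le> \<bar>M\<bar> * exp (- (\<delta> * x))" by (intro mult_right_mono) auto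
  finally have "norm (f x + w) \<le> norm (f x) + \<bar>M\<bar> * exp (- (\<delta> * x))"
    using norm_triangle_ineq[of "f x" w] by linarith
  then have "2 * norm (f x + w) \<le> radius f \<delta> M x" unfolding radius_def by simp
  then show ?thesis by (rule order_trans[OF norm_gap_le])
qed

text \<open>Serves near pairs with \<open>c = - r\<close> and far pairs with \<open>c = - 1\<close>;
  the limit rests on \<open>1 - p < r\<close> and \<open>\<delta> > 0\<close>.\<close>

lemma radius_tendsto:
  assumes f: "exp_poly (1 - p) f" and \<delta>: "\<delta> > 0" and c: "c \<le> - r"
  shows "((\<lambda>x. exp (c * x) * radius f \<delta> M x) \<longlongrightarrow> 0) at_top"
proof -
  define \<mu> where "\<mu> = max (1 - p) (- \<delta>)"
  have 1: "exp_order \<mu> (\<lambda>x. norm (f x))"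
    by (rule exp_order_dominated[OF exp_order_mono[OF exp_poly_imp_order[OF f]], where K = 1]) (auto simp: \<mu>_def)
  have 2: "exp_order \<mu> (\<lambda>x. \<bar>M\<bar> * exp (- (\<delta> * x)))"
    by (rule exp_order_mono[of "- \<delta>"], rule exp_orderI[where C = "\<bar>M\<bar>"]) (auto simp: \<mu>_def)
  have "exp_order \<mu> (\<lambda>x. 2 * (norm (f x) + \<bar>M\<bar> * exp (- (\<delta> * x))))"
    by (rule exp_order_bounded_linear[OF bounded_linear_mult_right exp_order_add[OF 1 2]])
  then have "exp_order (\<mu> + c) (\<lambda>x. exp (c * x) *\<^sub>R radius f \<delta> M x)"
    unfolding radius_def by (rule exp_order_shift) simp
  moreover have "\<mu> + c < 0" using c r \<delta> by (auto simp: \<mu>_def)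
  ultimately have "((\<lambda>x. exp (c * x) *\<^sub>R radius f \<delta> M x) \<longlongrightarrow> 0) at_top"
    by (rule exp_order_tendsto_0)
  then show ?thesis by simp
qed

text \<open>Each rescaled gap tends to a nonzero vector, uniformly over the weighted ball. The
  clause with \<open>near_arg i j x 0\<close> is for the continuity of \<open>H\<close>, which also
  contains the force of the given cluster motion.\<close>

lemma eventually_no_collision:
  assumes f: "exp_poly (1 - p) f" and \<delta>: "\<delta> > 0"
  shows "\<forall>\<^sub>F x in at_top. \<forall>i j w. norm w \<le> M * exp (- (\<delta> * x)) \<longrightarrow>
    (j \<in> near i \<longrightarrow> gap i j a + near_arg i j x (f x + w) \<noteq> 0 \<and> gap i j a + near_arg i j x 0 \<noteq> 0) \<and>
    (j \<in> far i \<longrightarrow> gap i j v + far_arg i j x (f x + w) \<noteq> 0)"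
proof -
  let ?R = "radius f \<delta> M"
  have R0: "?R x \<ge> 0" for x by (simp add: radius_def)
  have r1: "- 1 \<le> - r" using r by simp
  have near: "\<forall>\<^sub>F x in at_top. j \<in> near i \<longrightarrow> (\<forall>u. norm u \<le> ?R x \<longrightarrow>
      gap i j a + (gap i j (b x) + exp (- r * x) *\<^sub>R u) \<noteq> 0)" for i j
  proof (cases "j \<in> near i")
    case True
    from pair_eventually_nonzero[OF near_gap[OF True] b_tendsto[of i j] radius_tendsto[OF f \<delta> order.refl, of M] exp_gt_zero]
    show ?thesis by (rule eventually_mono) simp
  qed simp
  have far: "\<forall>\<^sub>F x in at_top. j \<in> far i \<longrightarrow> (\<forall>u. norm u \<le> ?R x \<longrightarrow>
      gap i j v + (exp ((r - 1) * x) *\<^sub>R gap i j (a + b x) + exp (- 1 * x) *\<^sub>R u) \<noteq> 0)" for i j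
  proof (cases "j \<in> far i")
    case True
    from pair_eventually_nonzero[OF far_gap[OF True] far_offset_tendsto[of i j] radius_tendsto[OF f \<delta> r1, of M] exp_gt_zero]
    show ?thesis by (rule eventually_mono) simp
  qed simp
  have "\<forall>\<^sub>F x in at_top. \<forall>i j. j \<in> near i \<longrightarrow> (\<forall>u. norm u \<le> ?R x \<longrightarrow>
      gap i j a + (gap i j (b x) + exp (- r * x) *\<^sub>R u) \<noteq> 0)"
    by (intro eventually_all_finite near)
  moreover have "\<forall>\<^sub>F x in at_top. \<forall>i j. j \<in> far i \<longrightarrow> (\<forall>u. norm u \<le> ?R x \<longrightarrow>
      gap i j v + (exp ((r - 1) * x) *\<^sub>R gap i j (a + b x) + exp (- 1 * x) *\<^sub>R u) \<noteq> 0)"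
    by (intro eventually_all_finite far)
  ultimately show ?thesis
  proof eventually_elim
    case (elim x)
    show ?case
    proof (intro allI impI conjI)
      fix i j and w :: "(real ^ 'd) ^ 'n" assume w: "norm w \<le> M * exp (- (\<delta> * x))"
      note g = gap_le_radius[OF w, of i j f]
      show "gap i j a + near_arg i j x (f x + w) \<noteq> 0" if "j \<in> near i"
        unfolding near_arg_def using elim(1) that g by blast
      show "gap i j a + near_arg i j x 0 \<noteq> 0" if "j \<in> near i"
        unfolding near_arg_def gap_simps(4) using elim(1) that R0[of x] norm_zero by metis
      show "gap i j v + far_arg i j x (f x + w) \<noteq> 0" if "j \<in> far i"
        unfolding far_arg_def using elim(2) that g by blast
    qed
  qed
qed

lemma gap_diff_le: "norm (gap i j (u + w) - gap i j (u + w')) \<le> 2 * norm (w - w')"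
proof -
  have "gap i j (u + w) - gap i j (u + w') = gap i j (w - w')" by (simp add: gap_simps)
  then show ?thesis using norm_gap_le[of i j "w - w'"] by simp
qed

text \<open>The weight \<open>exp (r * x)\<close> exactly undoes the scale of the unknown, so the
  smallness comes entirely from strict differentiability.\<close>

lemma near_small_lipschitz:
  assumes f: "exp_poly (1 - p) f" and \<delta>: "\<delta> > 0" and ij: "j \<in> near i" and e: "e > 0"
  shows "\<forall>\<^sub>F x in at_top. \<forall>w w'. norm w \<le> M * exp (- (\<delta> * x)) \<longrightarrow> norm w' \<le> M * exp (- (\<delta> * x)) \<longrightarrow>
    norm (lam j *\<^sub>R (exp (r * x) *\<^sub>R
      (attraction p (gap i j a + near_arg i j x (f x + w)) - attraction p (gap i j a + near_arg i j x (f x + w'))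
        - attraction_deriv p (gap i j a) (near_arg i j x (f x + w) - near_arg i j x (f x + w')))))
    \<le> e * norm (w - w')"
proof -
  \<comment> \<open>Compensates the mass and the factor 2 of \<open>gap_diff_le\<close>.\<close>
  define e' where "e' = e / (2 * lam j)"
  have e': "e' > 0" using e lam[of j] by (simp add: e'_def)
  from attraction_pair_small_lipschitz[OF near_gap[OF ij] b_tendsto[of i j] radius_tendsto[OF f \<delta> order.refl, of M] exp_gt_zero e', of p]
  show ?thesis
  proof eventually_elim
    case (elim x)
    show ?case
    proof (intro allI impI)
      fix w w' :: "(real ^ 'd) ^ 'n" assume w: "norm w \<le> M * exp (- (\<delta> * x))" "norm w' \<le> M * exp (- (\<delta> * x))"
      define N where "N = norm (attraction p (gap i j a + near_arg i j x (f x + w)) - attraction p (gap i j a + near_arg i j x (f x + w'))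
        - attraction_deriv p (gap i j a) (near_arg i j x (f x + w) - near_arg i j x (f x + w')))"
      have "near_arg i j x (f x + w) - near_arg i j x (f x + w')
          = exp (- r * x) *\<^sub>R (gap i j (f x + w) - gap i j (f x + w'))"
        unfolding near_arg_def by (simp add: scaleR_diff_right)
      then have "N \<le> e' * exp (- r * x) * norm (gap i j (f x + w) - gap i j (f x + w'))"
        using elim[rule_format, OF gap_le_radius[OF w(1), of i j] gap_le_radius[OF w(2), of i j]]
        unfolding N_def by (simp only: near_arg_def)
      also have "\<dots> \<le> e' * exp (- r * x) * (2 * norm (w - w'))"
        using e' by (intro mult_left_mono gap_diff_le) auto
      finally have "lam j * exp (r * x) * N \<le> lam j * exp (r * x) * (e' * exp (- r * x) * (2 * norm (w - w')))"
        using lam[of j] by (intro mult_left_mono) auto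
      also have "\<dots> = (lam j * e' * 2) * (exp (r * x) * exp (- r * x)) * norm (w - w')"
        by (simp only: mult_ac)
      also have "\<dots> = e * norm (w - w')"
        using lam[of j] by (simp add: e'_def exp_minus)
      finally show "norm (lam j *\<^sub>R (exp (r * x) *\<^sub>R
        (attraction p (gap i j a + near_arg i j x (f x + w)) - attraction p (gap i j a + near_arg i j x (f x + w'))
          - attraction_deriv p (gap i j a) (near_arg i j x (f x + w) - near_arg i j x (f x + w'))))) \<le> e * norm (w - w')"
        using lam[of j] unfolding norm_scaleR N_def[symmetric] by (simp add: mult.assoc)
    qed
  qed
qed

text \<open>No derivative is subtracted, so the attraction is merely Lipschitz, with constant
  \<open>1 + K\<close>; the smallness comes from
  \<open>exp ((1 - p) * x) * exp (- 1 * x) = exp (- p * x)\<close>.\<close>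

lemma far_small_lipschitz:
  assumes f: "exp_poly (1 - p) f" and \<delta>: "\<delta> > 0" and ij: "j \<in> far i" and e: "e > 0"
  shows "\<forall>\<^sub>F x in at_top. \<forall>w w'. norm w \<le> M * exp (- (\<delta> * x)) \<longrightarrow> norm w' \<le> M * exp (- (\<delta> * x)) \<longrightarrow>
    norm (lam j *\<^sub>R (exp ((1 - p) * x) *\<^sub>R
      (attraction p (gap i j v + far_arg i j x (f x + w)) - attraction p (gap i j v + far_arg i j x (f x + w')))))
    \<le> e * norm (w - w')"
proof -
  obtain K where K: "K \<ge> 0" "\<And>u. norm (attraction_deriv p (gap i j v) u) \<le> norm u * K"
    using bounded_linear.nonneg_bounded[OF bounded_linear_attraction_deriv] by blast
  have r1: "- 1 \<le> - r" using r by simp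
  have "\<forall>\<^sub>F x in at_top. exp (- p * x) < e / (lam j * (1 + K) * 2)"
  proof (rule order_tendstoD(2))
    show "((\<lambda>x. exp (- p * x)) \<longlongrightarrow> 0) at_top"
      using p by (intro filterlim_compose[OF exp_at_bot]
        filterlim_tendsto_neg_mult_at_bot[OF tendsto_const] filterlim_ident) auto
    show "0 < e / (lam j * (1 + K) * 2)" using e lam[of j] K by simp
  qed
  with attraction_pair_small_lipschitz[OF far_gap[OF ij] far_offset_tendsto[of i j] radius_tendsto[OF f \<delta> r1, of M] exp_gt_zero zero_less_one, of p]
  show ?thesis
  proof eventually_elim
    case (elim x)
    show ?case
    proof (intro allI impI)
      fix w w' :: "(real ^ 'd) ^ 'n" assume w: "norm w \<le> M * exp (- (\<delta> * x))" "norm w' \<le> M * exp (- (\<delta> * x))"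
      define g where "g = gap i j (f x + w) - gap i j (f x + w')"
      define Y where "Y = attraction p (gap i j v + far_arg i j x (f x + w)) - attraction p (gap i j v + far_arg i j x (f x + w'))"
      define D where "D = attraction_deriv p (gap i j v) (exp (- 1 * x) *\<^sub>R g)"
      have "norm (Y - D) \<le> 1 * exp (- 1 * x) * norm g"
        using elim(1)[rule_format, OF gap_le_radius[OF w(1), of i j] gap_le_radius[OF w(2), of i j]]
        unfolding Y_def far_arg_def g_def D_def .
      moreover have "norm D \<le> exp (- 1 * x) * norm g * K"
        using K(2)[of "exp (- 1 * x) *\<^sub>R g"] unfolding D_def by simp
      ultimately have "norm Y \<le> (1 + K) * exp (- 1 * x) * norm g"
        using norm_triangle_ineq2[of Y D] by (simp add: algebra_simps)
      also have "\<dots> \<le> (1 + K) * exp (- 1 * x) * (2 * norm (w - w'))"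
        unfolding g_def using K by (intro mult_left_mono gap_diff_le) auto
      finally have "lam j * exp ((1 - p) * x) * norm Y
          \<le> lam j * exp ((1 - p) * x) * ((1 + K) * exp (- 1 * x) * (2 * norm (w - w')))"
        using lam[of j] by (intro mult_left_mono) auto
      also have "\<dots> = lam j * (1 + K) * 2 * (exp ((1 - p) * x) * exp (- 1 * x)) * norm (w - w')"
        by (simp only: mult_ac)
      also have "exp ((1 - p) * x) * exp (- 1 * x) = exp (- p * x)"
        unfolding exp_add[symmetric] by (simp add: algebra_simps)
      also have "lam j * (1 + K) * 2 * exp (- p * x) * norm (w - w') \<le> e * norm (w - w')"
      proof (rule mult_right_mono)
        have "0 < lam j * (1 + K) * 2" using lam[of j] K by simp
        then have "exp (- p * x) * (lam j * (1 + K) * 2) < e"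
          using elim(2) by (simp only: pos_less_divide_eq)
        then show "lam j * (1 + K) * 2 * exp (- p * x) \<le> e" by (simp only: mult.commute less_imp_le)
      qed simp
      finally show "norm (lam j *\<^sub>R (exp ((1 - p) * x) *\<^sub>R
        (attraction p (gap i j v + far_arg i j x (f x + w)) - attraction p (gap i j v + far_arg i j x (f x + w')))))
        \<le> e * norm (w - w')"
        using lam[of j] unfolding norm_scaleR Y_def[symmetric] by (simp add: mult.assoc)
    qed
  qed
qed

lemma H_small_lipschitz:
  assumes f: "exp_poly (1 - p) f" and \<delta>: "\<delta> > 0" and "\<epsilon> > 0"
  shows "\<forall>\<^sub>F x in at_top. \<forall>w\<^sub>1 w\<^sub>2. norm w\<^sub>1 \<le> M * exp (- (\<delta> * x)) \<longrightarrow>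
    norm w\<^sub>2 \<le> M * exp (- (\<delta> * x)) \<longrightarrow> norm (H x (f x + w\<^sub>1) - H x (f x + w\<^sub>2)) \<le> \<epsilon> * norm (w\<^sub>1 - w\<^sub>2)"
proof -
  define n where "n = real CARD('n)"
  have n: "n > 0" by (simp add: n_def)
  \<comment> \<open>There are \<open>n\<close> components, each with two sums of at most
    \<open>n\<close> pair terms.\<close>
  define e where "e = \<epsilon> / (2 * n * n)"
  have e: "e > 0" using n assms by (simp add: e_def)
  define X where "X i j x w w' = lam j *\<^sub>R (exp (r * x) *\<^sub>R
      (attraction p (gap i j a + near_arg i j x (f x + w)) - attraction p (gap i j a + near_arg i j x (f x + w'))
        - attraction_deriv p (gap i j a) (near_arg i j x (f x + w) - near_arg i j x (f x + w'))))" for i j x and w w' :: "(real ^ 'd) ^ 'n"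
  define Y where "Y i j x w w' = lam j *\<^sub>R (exp ((1 - p) * x) *\<^sub>R
      (attraction p (gap i j v + far_arg i j x (f x + w)) - attraction p (gap i j v + far_arg i j x (f x + w'))))"
    for i j x and w w' :: "(real ^ 'd) ^ 'n"
  have near: "\<forall>\<^sub>F x in at_top. j \<in> near i \<longrightarrow> (\<forall>w w'. norm w \<le> M * exp (- (\<delta> * x)) \<longrightarrow>
      norm w' \<le> M * exp (- (\<delta> * x)) \<longrightarrow> norm (X i j x w w') \<le> e * norm (w - w'))" for i j
  proof (cases "j \<in> near i")
    case True
    from near_small_lipschitz[OF f \<delta> True e, of M] show ?thesis
      unfolding X_def by (rule eventually_mono) simp
  qed simp
  have far: "\<forall>\<^sub>F x in at_top. j \<in> far i \<longrightarrow> (\<forall>w w'. norm w \<le> M * exp (- (\<delta> * x)) \<longrightarrow>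
      norm w' \<le> M * exp (- (\<delta> * x)) \<longrightarrow> norm (Y i j x w w') \<le> e * norm (w - w'))" for i j
  proof (cases "j \<in> far i")
    case True
    from far_small_lipschitz[OF f \<delta> True e, of M] show ?thesis
      unfolding Y_def by (rule eventually_mono) simp
  qed simp
  have "\<forall>\<^sub>F x in at_top. \<forall>i j. j \<in> near i \<longrightarrow> (\<forall>w w'. norm w \<le> M * exp (- (\<delta> * x)) \<longrightarrow>
      norm w' \<le> M * exp (- (\<delta> * x)) \<longrightarrow> norm (X i j x w w') \<le> e * norm (w - w'))"
    by (intro eventually_all_finite near)
  moreover have "\<forall>\<^sub>F x in at_top. \<forall>i j. j \<in> far i \<longrightarrow> (\<forall>w w'. norm w \<le> M * exp (- (\<delta> * x)) \<longrightarrow>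
      norm w' \<le> M * exp (- (\<delta> * x)) \<longrightarrow> norm (Y i j x w w') \<le> e * norm (w - w'))"
    by (intro eventually_all_finite far)
  ultimately show ?thesis
  proof eventually_elim
    case (elim x)
    show ?case
    proof (intro allI impI)
      fix w w' :: "(real ^ 'd) ^ 'n" assume w: "norm w \<le> M * exp (- (\<delta> * x))" "norm w' \<le> M * exp (- (\<delta> * x))"
      define d where "d = e * norm (w - w')"
      have d: "d \<ge> 0" using e by (simp add: d_def)
      have card: "norm (sum g J) \<le> n * d" if "\<And>j. j \<in> J \<Longrightarrow> norm (g j) \<le> d" for J and g :: "'n \<Rightarrow> real ^ 'd"
      proof -
        have "norm (sum g J) \<le> (\<Sum>j\<in>J. d)" by (rule sum_norm_le) (rule that)
        also have "\<dots> = real (card J) * d" by simp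
        also have "\<dots> \<le> n * d"
          unfolding n_def using d by (intro mult_right_mono) (auto intro: card_mono)
        finally show ?thesis .
      qed
      have comp: "norm ((H x (f x + w) - H x (f x + w')) $ i) \<le> 2 * n * d" for i
      proof -
        have A: "norm (\<Sum>j\<in>near i. X i j x w w') \<le> n * d"
          by (rule card) (use elim(1) w in \<open>auto simp: d_def\<close>)
        have B: "norm (\<Sum>j\<in>far i. Y i j x w w') \<le> n * d"
          by (rule card) (use elim(2) w in \<open>auto simp: d_def\<close>)
        have "(H x (f x + w) - H x (f x + w')) $ i = - (\<Sum>j\<in>near i. X i j x w w') - (\<Sum>j\<in>far i. Y i j x w w')"
          unfolding vector_minus_component H_diff X_def Y_def ..
        then show ?thesis
          using A B norm_triangle_ineq4[of "- (\<Sum>j\<in>near i. X i j x w w')" "\<Sum>j\<in>far i. Y i j x w w'"] by simp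
      qed
      have "norm (H x (f x + w) - H x (f x + w')) \<le> (\<Sum>i\<in>UNIV. norm ((H x (f x + w) - H x (f x + w')) $ i))"
        by (rule norm_vec_le_sum)
      also have "\<dots> \<le> (\<Sum>i\<in>(UNIV :: 'n set). 2 * n * d)"
        by (rule sum_mono) (rule comp)
      also have "\<dots> = n * (2 * n * d)" by (simp add: n_def)
      also have "\<dots> = \<epsilon> * norm (w - w')"
        using n by (simp add: d_def e_def)
      finally show "norm (H x (f x + w) - H x (f x + w')) \<le> \<epsilon> * norm (w - w')" .
    qed
  qed
qed

text \<open>The attraction is used as a continuous function away from 0 only, so the start has to be
  late enough for the whole weighted ball to avoid collisions.\<close>

lemma H_continuous:
  assumes f: "exp_poly (1 - p) f" and \<delta>: "\<delta> > 0"
  shows "\<forall>\<^sub>F T in at_top. continuous_on {(x, w). x \<ge> T \<and> norm w \<le> M * exp (- (\<delta> * x))} (\<lambda>(x, w). H x (f x + w))"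
proof -
  obtain T\<^sub>0 where T0: "\<And>x. x \<ge> T\<^sub>0 \<Longrightarrow> \<forall>i j w. norm w \<le> M * exp (- (\<delta> * x)) \<longrightarrow>
    (j \<in> near i \<longrightarrow> gap i j a + near_arg i j x (f x + w) \<noteq> 0 \<and> gap i j a + near_arg i j x 0 \<noteq> 0) \<and>
    (j \<in> far i \<longrightarrow> gap i j v + far_arg i j x (f x + w) \<noteq> 0)"
    using eventually_no_collision[OF f \<delta>, of M] unfolding eventually_at_top_linorder by blast
  have "continuous_on {(x, w). x \<ge> T \<and> norm w \<le> M * exp (- (\<delta> * x))} (\<lambda>(x, w). H x (f x + w))"
    if T: "T \<ge> T\<^sub>0" for T
  proof -
    define X where "X = {z :: real \<times> ((real ^ 'd) ^ 'n). fst z \<ge> T \<and> norm (snd z) \<le> M * exp (- (\<delta> * fst z))}"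
    have fc: "continuous_on X (\<lambda>z. f (fst z) + snd z)"
      by (intro continuous_on_add continuous_on_snd continuous_on_id
          continuous_on_compose2[OF exp_poly_continuous[OF f] continuous_on_fst[OF continuous_on_id]]) auto
    have bc: "continuous_on X (\<lambda>z. b (fst z))"
      by (rule continuous_on_compose2[OF b_cont continuous_on_fst[OF continuous_on_id]]) auto
    have gc: "continuous_on X (\<lambda>z. gap i j (g z))" if "continuous_on X g" for i j and g :: "_ \<Rightarrow> (real ^ 'd) ^ 'n"
      unfolding gap_def by (intro continuous_intros that)
    have linc: "continuous_on X (\<lambda>z. lin (f (fst z) + snd z))"
      by (rule linear_continuous_on_compose[OF fc linear_lin])
    have nearc: "continuous_on X (\<lambda>z. near_arg i j (fst z) (g z))" if "continuous_on X g" for i j g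
      unfolding near_arg_def by (intro continuous_intros gc bc that)
    have farc: "continuous_on X (\<lambda>z. far_arg i j (fst z) (f (fst z) + snd z))" for i j
      unfolding far_arg_def by (intro continuous_intros gc bc fc)
    have z: "(j \<in> near i \<longrightarrow> gap i j a + near_arg i j (fst z) (f (fst z) + snd z) \<noteq> 0 \<and> gap i j a + near_arg i j (fst z) 0 \<noteq> 0) \<and>
        (j \<in> far i \<longrightarrow> gap i j v + far_arg i j (fst z) (f (fst z) + snd z) \<noteq> 0)" if "z \<in> X" for z i j
      using T0[of "fst z"] that T unfolding X_def by auto
    have N: "continuous_on X (\<lambda>z. attraction p (gap i j a + near_arg i j (fst z) (f (fst z) + snd z)))"
        "continuous_on X (\<lambda>z. attraction p (gap i j a + near_arg i j (fst z) 0))" if "j \<in> near i" for i j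
      using z that by (auto intro!: continuous_on_attraction continuous_on_add continuous_on_const nearc fc)
    have F: "continuous_on X (\<lambda>z. attraction p (gap i j v + far_arg i j (fst z) (f (fst z) + snd z)))"
      if "j \<in> far i" for i j
      using z that by (auto intro!: continuous_on_attraction continuous_on_add continuous_on_const farc)
    have "continuous_on X (\<lambda>z. H (fst z) (f (fst z) + snd z))"
      unfolding H_def
      by (intro continuous_on_vec_lambda continuous_on_diff continuous_on_component linc
          continuous_on_scaleR continuous_on_sum continuous_on_exp continuous_on_mult continuous_on_const
          continuous_on_fst continuous_on_id N F)
    moreover have "{(x, w). x \<ge> T \<and> norm w \<le> M * exp (- (\<delta> * x))} = X" by (auto simp: X_def)
    ultimately show ?thesis by (simp add: case_prod_beta')
  qed
  then show ?thesis unfolding eventually_at_top_linorder by blast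
qed


subsection \<open>Solutions of the N-body system\<close>

lemma asymptotic_solution:
  "\<exists>\<delta> f W W' T. \<delta> > 0 \<and> \<delta> > p - 1 \<and> exp_poly (1 - p) f \<and> exp_order (- \<delta>) (\<lambda>x. W x - f x) \<and>
    (\<forall>x>T. (W has_vector_derivative W' x) (at x) \<and>
      (W' has_vector_derivative W' x - lin (W x) + H x (W x)) (at x) \<and>
      (\<forall>i j. (j \<in> near i \<longrightarrow> gap i j a + near_arg i j x (W x) \<noteq> 0) \<and>
        (j \<in> far i \<longrightarrow> gap i j v + far_arg i j x (W x) \<noteq> 0)))"
proof -
  have bl: "bounded_linear lin" using linear_lin by (simp add: linear_conv_bounded_linear)
  obtain R :: "real set" where R: "finite R"
    "\<And>\<delta>. \<delta> \<notin> R \<Longrightarrow> \<exists>C>0. \<forall>T. \<exists>S. decaying_solver lin \<delta> C T S"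
    using decaying_solver_exists[OF bl diagonalizable_lin] by blast
  \<comment> \<open>\<open>\<delta> < - \<eta>\<close> lets the residual decay faster than the
    weight, and \<open>\<delta> > p - 1\<close> keeps the correction below the exponent
    \<open>1 - p\<close>. An infinite interval survives the removal of the finitely many resonant
    weights.\<close>
  have "infinite {max 0 (p - 1)<..<- \<eta>}" using \<eta> by (intro infinite_Ioo) auto
  then have "{max 0 (p - 1)<..<- \<eta>} - R \<noteq> {}" using R(1) by (metis Diff_infinite_finite finite.emptyI)
  then obtain \<delta> where "\<delta> \<in> {max 0 (p - 1)<..<- \<eta>}" "\<delta> \<notin> R" by blast
  then have \<delta>: "\<delta> > 0" "\<delta> > p - 1" "\<eta> < - \<delta>" "\<delta> \<notin> R" by auto
  obtain C where C: "C > 0" "\<And>T. \<exists>S. decaying_solver lin \<delta> C T S" using R(2)[OF \<delta>(4)] by blast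
  obtain f f' k where f: "exp_poly (1 - p) f" "exp_poly (1 - p) k"
    "\<forall>x. (f has_vector_derivative f' x) (at x)"
    "\<forall>x. (f' has_vector_derivative f' x - lin (f x) + k x) (at x)"
    "exp_order \<eta> (\<lambda>x. H x (f x) - k x)"
    using exp_poly_solution_mod_order[where H = H, OF bl diagonalizable_lin \<kappa>(1) exp_asymp_H_0 exp_asymp_H_diff] .
  obtain w w' T\<^sub>1 M where w: "\<forall>x\<ge>T\<^sub>1. norm (w x) \<le> M * exp (- (\<delta> * x))"
    "\<forall>x>T\<^sub>1. (w has_vector_derivative w' x) (at x)"
    "\<forall>x>T\<^sub>1. (w' has_vector_derivative w' x - lin (w x) + (H x (f x + w x) - k x)) (at x)"
    using decaying_correction[where H = H and f = f and k = k, OF C f(5) \<delta>(3) exp_poly_continuous[OF f(2)]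
        H_small_lipschitz[OF f(1) \<delta>(1)] H_continuous[OF f(1) \<delta>(1)]] .
  obtain T\<^sub>2 where T2: "\<And>x. x \<ge> T\<^sub>2 \<Longrightarrow> \<forall>i j w. norm w \<le> M * exp (- (\<delta> * x)) \<longrightarrow>
    (j \<in> near i \<longrightarrow> gap i j a + near_arg i j x (f x + w) \<noteq> 0 \<and> gap i j a + near_arg i j x 0 \<noteq> 0) \<and>
    (j \<in> far i \<longrightarrow> gap i j v + far_arg i j x (f x + w) \<noteq> 0)"
    using eventually_no_collision[OF f(1) \<delta>(1), of M] unfolding eventually_at_top_linorder by blast
  define T where "T = max T\<^sub>1 T\<^sub>2"
  show ?thesis
  proof (rule exI[of _ \<delta>], rule exI[of _ f], rule exI[of _ "\<lambda>x. f x + w x"],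
      rule exI[of _ "\<lambda>x. f' x + w' x"], rule exI[of _ T], intro conjI allI impI)
    show "exp_order (- \<delta>) (\<lambda>x. f x + w x - f x)"
      by (rule exp_orderI[where C = M], rule eventually_mono[OF eventually_ge_at_top[of T\<^sub>1]])
        (use w(1) in simp)
    fix x assume x: "x > T"
    show "((\<lambda>x. f x + w x) has_vector_derivative f' x + w' x) (at x)"
      using x by (intro has_vector_derivative_add f[rule_format] w[rule_format]) (auto simp: T_def)
    have "((\<lambda>x. f' x + w' x) has_vector_derivative
        (f' x - lin (f x) + k x) + (w' x - lin (w x) + (H x (f x + w x) - k x))) (at x)"
      using x by (intro has_vector_derivative_add f[rule_format] w[rule_format]) (auto simp: T_def)
    moreover have "lin (f x + w x) = lin (f x) + lin (w x)" by (rule linear_add[OF linear_lin])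
    ultimately show "((\<lambda>x. f' x + w' x) has_vector_derivative
        f' x + w' x - lin (f x + w x) + H x (f x + w x)) (at x)"
      by (simp add: algebra_simps)
    have "(j \<in> near i \<longrightarrow> gap i j a + near_arg i j x (f x + w x) \<noteq> 0) \<and>
      (j \<in> far i \<longrightarrow> gap i j v + far_arg i j x (f x + w x) \<noteq> 0)" for i j
      using T2[of x] w(1)[rule_format, of x] x by (auto simp: T_def)
    then show "j \<in> near i \<Longrightarrow> gap i j a + near_arg i j x (f x + w x) \<noteq> 0"
      "j \<in> far i \<Longrightarrow> gap i j v + far_arg i j x (f x + w x) \<noteq> 0" for i j by blast+
  qed (use \<delta> f in auto)
qed

lemma gap_near:
  assumes "t > 0" "j \<in> near i"
  shows "gap i j (t *\<^sub>R v + t powr r *\<^sub>R (a + b (ln t)) + w) = t powr r *\<^sub>R (gap i j a + near_arg i j (ln t) w)"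
proof -
  have "t powr r * exp (- r * ln t) = 1" using assms by (simp add: powr_def exp_minus)
  moreover have "gap i j v = 0" using assms by (simp add: near_def gap_def)
  ultimately show ?thesis by (simp add: near_arg_def gap_simps scaleR_add_right)
qed

lemma gap_far:
  assumes "t > 0"
  shows "gap i j (t *\<^sub>R v + t powr r *\<^sub>R (a + b (ln t)) + w) = t *\<^sub>R (gap i j v + far_arg i j (ln t) w)"
proof -
  have "t * exp ((r - 1) * ln t) = exp (ln t + (r - 1) * ln t)" using assms by (simp add: exp_add)
  also have "\<dots> = t powr r" using assms by (simp add: powr_def algebra_simps)
  finally have "t * exp ((r - 1) * ln t) = t powr r" .
  moreover have "t * exp (- 1 * ln t) = 1" using assms by (simp add: exp_minus)
  ultimately show ?thesis by (simp add: far_arg_def gap_simps scaleR_add_right)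
qed

text \<open>Homogeneity gives \<open>t powr (- 2)\<close> times \<open>t powr r\<close> for near
  pairs, by \<open>r * (p + 2) = 2\<close>, and times \<open>t powr (1 - p)\<close> for far pairs.
  The common factor is what two derivatives cost in passing from \<open>ln t\<close> to
  \<open>t\<close>.\<close>

lemma force_split:
  assumes t: "t > 0"
  defines "\<alpha>\<^sub>0 \<equiv> t powr r *\<^sub>R (a + b (ln t))"
  shows "(\<Sum>j\<in>UNIV - {i}. lam j *\<^sub>R attraction p (gap i j (t *\<^sub>R v + \<alpha>\<^sub>0 + w))) =
    (\<Sum>j\<in>near i. lam j *\<^sub>R attraction p (gap i j \<alpha>\<^sub>0)) + (1 / t\<^sup>2) *\<^sub>R (lin w - H (ln t) w) $ i"
proof -
  have t2: "t powr (-2) = 1 / t\<^sup>2" using t by (simp add: powr_minus_divide)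
  have "r * (- p - 1) = - 2 + r" using r(3) by (simp add: algebra_simps)
  then have "(t powr r) powr (- p - 1) = t powr (- 2) * t powr r"
    by (simp only: powr_powr powr_add)
  then have near_scale: "(t powr r) powr (- p - 1) = 1 / t\<^sup>2 * exp (r * ln t)"
    using t unfolding t2 by (simp add: powr_def)
  have "- p - 1 = - 2 + (1 - p)" by simp
  then have "t powr (- p - 1) = t powr (-2) * t powr (1 - p)"
    by (simp only: powr_add)
  then have far_scale: "t powr (- p - 1) = 1 / t\<^sup>2 * exp ((1 - p) * ln t)"
    using t unfolding t2 by (simp add: powr_def)
  have near0: "gap i j \<alpha>\<^sub>0 = t powr r *\<^sub>R (gap i j a + near_arg i j (ln t) 0)" for j
    by (simp add: \<alpha>\<^sub>0_def near_arg_def gap_simps)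
  have tr: "t powr r > 0" using t by simp
  define c where "c = 1 / t\<^sup>2"
  define N where "N j = lam j *\<^sub>R attraction p (gap i j a + near_arg i j (ln t) w)" for j
  define N0 where "N0 j = lam j *\<^sub>R attraction p (gap i j a + near_arg i j (ln t) 0)" for j
  define F where "F j = lam j *\<^sub>R attraction p (gap i j v + far_arg i j (ln t) w)" for j
  have near: "lam j *\<^sub>R attraction p (gap i j (t *\<^sub>R v + \<alpha>\<^sub>0 + w)) = c *\<^sub>R exp (r * ln t) *\<^sub>R N j" if "j \<in> near i" for j
    unfolding \<alpha>\<^sub>0_def gap_near[OF t that] attraction_scaleR[OF tr] near_scale c_def N_def by (simp add: mult_ac)
  have near0: "lam j *\<^sub>R attraction p (gap i j \<alpha>\<^sub>0) = c *\<^sub>R exp (r * ln t) *\<^sub>R N0 j" for j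
    unfolding near0 attraction_scaleR[OF tr] near_scale c_def N0_def by (simp add: mult_ac)
  have far: "lam j *\<^sub>R attraction p (gap i j (t *\<^sub>R v + \<alpha>\<^sub>0 + w)) = c *\<^sub>R exp ((1 - p) * ln t) *\<^sub>R F j" for j
    unfolding \<alpha>\<^sub>0_def gap_far[OF t] attraction_scaleR[OF t] far_scale c_def F_def by (simp add: mult_ac)
  have "UNIV - {i} = near i \<union> far i" "near i \<inter> far i = {}" unfolding near_def far_def by auto
  then have "(\<Sum>j\<in>UNIV - {i}. lam j *\<^sub>R attraction p (gap i j (t *\<^sub>R v + \<alpha>\<^sub>0 + w))) =
      (\<Sum>j\<in>near i. lam j *\<^sub>R attraction p (gap i j (t *\<^sub>R v + \<alpha>\<^sub>0 + w))) +
      (\<Sum>j\<in>far i. lam j *\<^sub>R attraction p (gap i j (t *\<^sub>R v + \<alpha>\<^sub>0 + w)))"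
    by (simp add: sum.union_disjoint)
  also have "(\<Sum>j\<in>near i. lam j *\<^sub>R attraction p (gap i j (t *\<^sub>R v + \<alpha>\<^sub>0 + w))) = c *\<^sub>R exp (r * ln t) *\<^sub>R (\<Sum>j\<in>near i. N j)"
    unfolding scaleR_sum_right by (rule sum.cong[OF refl]) (rule near)
  also have "(\<Sum>j\<in>far i. lam j *\<^sub>R attraction p (gap i j (t *\<^sub>R v + \<alpha>\<^sub>0 + w))) = c *\<^sub>R exp ((1 - p) * ln t) *\<^sub>R (\<Sum>j\<in>far i. F j)"
    unfolding scaleR_sum_right by (rule sum.cong[OF refl]) (rule far)
  finally have total: "(\<Sum>j\<in>UNIV - {i}. lam j *\<^sub>R attraction p (gap i j (t *\<^sub>R v + \<alpha>\<^sub>0 + w))) =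
      c *\<^sub>R exp (r * ln t) *\<^sub>R (\<Sum>j\<in>near i. N j) + c *\<^sub>R exp ((1 - p) * ln t) *\<^sub>R (\<Sum>j\<in>far i. F j)" .
  have base: "(\<Sum>j\<in>near i. lam j *\<^sub>R attraction p (gap i j \<alpha>\<^sub>0)) = c *\<^sub>R exp (r * ln t) *\<^sub>R (\<Sum>j\<in>near i. N0 j)"
    unfolding scaleR_sum_right by (rule sum.cong[OF refl]) (rule near0)
  have "(lin w - H (ln t) w) $ i = exp (r * ln t) *\<^sub>R ((\<Sum>j\<in>near i. N j) - (\<Sum>j\<in>near i. N0 j))
      + exp ((1 - p) * ln t) *\<^sub>R (\<Sum>j\<in>far i. F j)"
    by (simp add: H_def N_def N0_def F_def scaleR_diff_right sum_subtractf)
  then show ?thesis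
    unfolding total base c_def[symmetric] by (simp only: scaleR_add_right scaleR_diff_right) simp
qed

end

section \<open>Return to the original time\<close>

lemma clusters_memI: "{j. v $ i = v $ j} \<in> clusters v"
proof -
  have "{(i, j). v $ i = v $ j} `` {i} \<in> UNIV // {(i, j). v $ i = v $ j}" by (rule quotientI) simp
  then show ?thesis by (simp add: clusters_def Image_def)
qed

lemma scaleR_attraction:
  "(c * d / norm x powr (p + 2)) *\<^sub>R x = c *\<^sub>R (d *\<^sub>R attraction p x)"
  by (simp add: attraction_def)

lemma has_vector_derivative_ln_compose:
  assumes "t > 0" "(W has_vector_derivative W') (at (ln t))"
  shows "((\<lambda>s. W (ln s)) has_vector_derivative (1 / t) *\<^sub>R W') (at t)"
proof -
  have "(ln has_vector_derivative 1 / t) (at t)"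
    using DERIV_ln_divide[OF assms(1)] by (simp add: has_real_derivative_iff_has_vector_derivative)
  from vector_diff_chain_at[OF this assms(2)] show ?thesis by (simp add: o_def)
qed

lemma has_vector_derivative_vec_nth:
  "(f has_vector_derivative f') F \<Longrightarrow> ((\<lambda>x. f x $ i) has_vector_derivative f' $ i) F"
  by (rule bounded_linear.has_vector_derivative[OF bounded_linear_vec_nth])

theorem theorem3:
  fixes lam :: "'n::finite \<Rightarrow> real" and p q :: real
    and v a :: "('d::finite, 'n) config"
    and P0 :: "real \<Rightarrow> ('d, 'n) config \<times> ('d, 'n) config"
  assumes "CARD('n) \<ge> 2"
    and "\<And>i. lam i > 0"
    and "p > 0"
    and "P0 C1_differentiable_on {0<..}"
    and "\<And>I. I \<in> clusters v \<Longrightarrow> solves_body_system lam p I {0<..} P0"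
    and "\<And>i j. i \<noteq> j \<Longrightarrow> v $ i = v $ j \<Longrightarrow> a $ i \<noteq> a $ j"
    and "q < min (2 / (p + 2) + p - 1) (2 / (p + 2))"
    and "(\<lambda>t. norm (fst (P0 t) - (t powr (2 / (p + 2))) *\<^sub>R a)) \<in> O[at_top](\<lambda>t. t powr q)"
  shows "\<exists>\<delta>>0. \<exists>T0>0. \<exists>P :: real \<Rightarrow> ('d, 'n) config \<times> ('d, 'n) config.
           \<exists>f \<in> power_log_space (1 - p).
             solves_body_system lam p UNIV {T0<..} P \<and>
             smallo_plus (\<lambda>t. fst (P t) - (t *\<^sub>R v + fst (P0 t) + f t)) (- \<delta>) \<and>
             (p > 1 \<longrightarrow> smallo_plus (\<lambda>t. fst (P t) - (t *\<^sub>R v + fst (P0 t))) (1 - p))"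
proof -
  define \<rho> where "\<rho> = 2 / (p + 2)"
  \<comment> \<open>Obtained by solving
    \<open>fst (P0 t) = t powr r *\<^sub>R (a + b (ln t))\<close> for \<open>b\<close>, with
    \<open>t = exp x\<close>.\<close>
  define b where "b x = exp (- \<rho> * x) *\<^sub>R fst (P0 (exp x)) - a" for x
  have b_cont: "continuous_on UNIV b"
    unfolding b_def
    by (intro continuous_intros continuous_on_compose2[OF C1_differentiable_imp_continuous_on[OF assms(4)]]) auto
  have b_order: "exp_order (q - \<rho>) b"
  proof -
    obtain c where "\<forall>\<^sub>F t in at_top. norm (norm (fst (P0 t) - t powr \<rho> *\<^sub>R a)) \<le> c * norm (t powr q)"
      using assms(8) unfolding \<rho>_def by (auto elim: landau_o.bigE)
    then have "\<forall>\<^sub>F x in at_top. norm (fst (P0 (exp x)) - exp x powr \<rho> *\<^sub>R a) \<le> c * exp x powr q"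
      using exp_at_top unfolding filterlim_iff by fastforce
    then have "\<forall>\<^sub>F x in at_top. norm (b x) \<le> c * exp ((q - \<rho>) * x)"
    proof eventually_elim
      case (elim x)
      have "b x = exp (- \<rho> * x) *\<^sub>R (fst (P0 (exp x)) - exp x powr \<rho> *\<^sub>R a)"
        by (simp add: b_def scaleR_diff_right powr_def exp_minus)
      then have "norm (b x) = exp (- \<rho> * x) * norm (fst (P0 (exp x)) - exp x powr \<rho> *\<^sub>R a)"
        by simp
      also have "\<dots> \<le> exp (- \<rho> * x) * (c * exp x powr q)"
        using elim by (intro mult_left_mono) auto
      also have "\<dots> = c * (exp (- \<rho> * x) * exp (q * x))" by (simp add: powr_def)
      also have "exp (- \<rho> * x) * exp (q * x) = exp ((q - \<rho>) * x)"
        unfolding exp_add[symmetric] by (simp add: algebra_simps)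
      finally show ?case .
    qed
    then show ?thesis by (rule exp_orderI)
  qed
  interpret clustered_bodies lam p q v a b
    by unfold_locales (use assms b_cont b_order in \<open>auto simp: \<rho>_def\<close>)
  have \<alpha>0: "fst (P0 t) = t powr r *\<^sub>R (a + b (ln t))" if "t > 0" for t
  proof -
    have "t powr r * exp (- \<rho> * ln t) = 1"
      using that by (simp add: \<rho>_def r_def powr_def exp_minus)
    then show ?thesis using that by (simp add: b_def scaleR_diff_right scaleR_add_right)
  qed
  have near_eq: "{j. v $ i = v $ j} - {i} = near i" for i by (auto simp: near_def)
  have P0_sol: "((\<lambda>s. fst (P0 s) $ i) has_vector_derivative snd (P0 t) $ i) (at t)"
    "((\<lambda>s. snd (P0 s) $ i) has_vector_derivative
      - (\<Sum>j\<in>near i. lam j *\<^sub>R attraction p (gap i j (fst (P0 t))))) (at t)"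
    if "t > 0" for t i
  proof -
    have sol: "((\<lambda>s. fst (P0 s) $ i) has_vector_derivative snd (P0 t) $ i) (at t) \<and>
      (\<exists>D. ((\<lambda>s. snd (P0 s) $ i) has_vector_derivative D) (at t) \<and>
        lam i *\<^sub>R D = - (\<Sum>j\<in>near i.
          (lam i * lam j / norm (fst (P0 t) $ i - fst (P0 t) $ j) powr (p + 2)) *\<^sub>R (fst (P0 t) $ i - fst (P0 t) $ j)))"
    proof -
      \<comment> \<open>The hypothesis is read for the cluster of \<open>i\<close>, whose other
        members are \<open>near i\<close>.\<close>
      have *: "t \<in> {0<..}" "i \<in> {j. v $ i = v $ j}" using that by auto
      show ?thesis
        using bspec[OF bspec[OF assms(5)[OF clusters_memI[of v i], unfolded solves_body_system_def] *(1)] *(2)]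
        unfolding near_eq by blast
    qed
    then show "((\<lambda>s. fst (P0 s) $ i) has_vector_derivative snd (P0 t) $ i) (at t)" by blast
    obtain D where D: "((\<lambda>s. snd (P0 s) $ i) has_vector_derivative D) (at t)"
      "lam i *\<^sub>R D = - (\<Sum>j\<in>near i.
          (lam i * lam j / norm (fst (P0 t) $ i - fst (P0 t) $ j) powr (p + 2)) *\<^sub>R (fst (P0 t) $ i - fst (P0 t) $ j))"
      using sol by blast
    have "lam i *\<^sub>R D = lam i *\<^sub>R (- (\<Sum>j\<in>near i. lam j *\<^sub>R attraction p (gap i j (fst (P0 t)))))"
      unfolding D(2) scaleR_attraction gap_def by (simp add: scaleR_sum_right)
    then have "D = - (\<Sum>j\<in>near i. lam j *\<^sub>R attraction p (gap i j (fst (P0 t))))"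
      using assms(2)[of i] by (subst (asm) scaleR_cancel_left) auto
    with D(1) show "((\<lambda>s. snd (P0 s) $ i) has_vector_derivative
      - (\<Sum>j\<in>near i. lam j *\<^sub>R attraction p (gap i j (fst (P0 t))))) (at t)" by simp
  qed
  from asymptotic_solution obtain \<delta> f W W' T where
    W: "\<delta> > 0" "\<delta> > p - 1" "exp_poly (1 - p) f" "exp_order (- \<delta>) (\<lambda>x. W x - f x)"
    and WT: "\<forall>x>T. (W has_vector_derivative W' x) (at x) \<and>
      (W' has_vector_derivative W' x - lin (W x) + H x (W x)) (at x) \<and>
      (\<forall>i j. (j \<in> near i \<longrightarrow> gap i j a + near_arg i j x (W x) \<noteq> 0) \<and>
        (j \<in> far i \<longrightarrow> gap i j v + far_arg i j x (W x) \<noteq> 0))"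
    by (elim exE conjE)
  define \<alpha> where "\<alpha> t = t *\<^sub>R v + fst (P0 t) + W (ln t)" for t
  define \<beta> where "\<beta> t = v + snd (P0 t) + (1 / t) *\<^sub>R W' (ln t)" for t
  have "solves_body_system lam p UNIV {exp T<..} (\<lambda>t. (\<alpha> t, \<beta> t))"
    unfolding solves_body_system_def fst_conv snd_conv
  proof (intro ballI conjI)
    fix t i assume "t \<in> {exp T<..}"
    then have t: "exp T < t" by simp
    then have t0: "t > 0" by (meson exp_gt_zero order_less_trans)
    then have tT: "ln t > T" using t by (metis exp_less_cancel_iff exp_ln)
    have noncoll: "j \<in> near i \<Longrightarrow> gap i j a + near_arg i j (ln t) (W (ln t)) \<noteq> 0"
        "j \<in> far i \<Longrightarrow> gap i j v + far_arg i j (ln t) (W (ln t)) \<noteq> 0" for j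
      using WT tT by blast+
    have W': "(W has_vector_derivative W' (ln t)) (at (ln t))"
        "(W' has_vector_derivative W' (ln t) - lin (W (ln t)) + H (ln t) (W (ln t))) (at (ln t))"
      using WT tT by blast+
    show "\<alpha> t $ i \<noteq> \<alpha> t $ j" if "j \<in> UNIV - {i}" for j
    proof -
      have "gap i j (\<alpha> t) \<noteq> 0"
      proof (cases "j \<in> near i")
        case True
        then show ?thesis
          using noncoll t0 unfolding \<alpha>_def \<alpha>0[OF t0] gap_near[OF t0 True] by auto
      next
        case False
        then have "j \<in> far i" using that by (auto simp: near_def far_def)
        then show ?thesis
          using noncoll t0 unfolding \<alpha>_def \<alpha>0[OF t0] gap_far[OF t0] by auto
      qed
      then show ?thesis by (auto simp: gap_def)
    qed
    have "((\<lambda>s. s *\<^sub>R v $ i + fst (P0 s) $ i + W (ln s) $ i) has_vector_derivative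
        1 *\<^sub>R v $ i + snd (P0 t) $ i + ((1 / t) *\<^sub>R W' (ln t)) $ i) (at t)"
      by (intro has_vector_derivative_add P0_sol[OF t0] has_vector_derivative_vec_nth
          has_vector_derivative_ln_compose t0 W'(1)
          bounded_linear.has_vector_derivative[OF bounded_linear_scaleR_left] has_vector_derivative_id)
    then show "((\<lambda>s. \<alpha> s $ i) has_vector_derivative \<beta> t $ i) (at t)"
      by (simp add: \<alpha>_def \<beta>_def)
    define E where "E = lin (W (ln t)) - H (ln t) (W (ln t))"
    define D where "D = - (\<Sum>j\<in>near i. lam j *\<^sub>R attraction p (gap i j (fst (P0 t)))) - (1 / t\<^sup>2) *\<^sub>R E $ i"
    have inv: "((\<lambda>s. 1 / s) has_real_derivative - (1 / t\<^sup>2)) (at t)"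
      using t0 by (auto intro!: derivative_eq_intros simp: power2_eq_square)
    \<comment> \<open>The derivative of \<open>1 / s\<close> will contribute
      \<open>- W' / t^2\<close>, which cancels the term \<open>W'\<close> of the equation; this is
      why that term occurs in logarithmic time.\<close>
    have "((\<lambda>s. W' (ln s)) has_vector_derivative (1 / t) *\<^sub>R (W' (ln t) - E)) (at t)"
      by (rule has_vector_derivative_ln_compose[OF t0]) (use W'(2) in \<open>simp add: E_def algebra_simps\<close>)
    from has_vector_derivative_scaleR[OF inv this]
    have "((\<lambda>s. (1 / s) *\<^sub>R W' (ln s)) has_vector_derivative - ((1 / t\<^sup>2) *\<^sub>R E)) (at t)"
      by (simp add: power2_eq_square scaleR_diff_right)
    from has_vector_derivative_vec_nth[OF this, of i]
    have "((\<lambda>s. v $ i + snd (P0 s) $ i + ((1 / s) *\<^sub>R W' (ln s)) $ i) has_vector_derivative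
        0 + - (\<Sum>j\<in>near i. lam j *\<^sub>R attraction p (gap i j (fst (P0 t)))) + (- ((1 / t\<^sup>2) *\<^sub>R E)) $ i) (at t)"
      by (intro has_vector_derivative_add has_vector_derivative_const P0_sol[OF t0])
    then have "((\<lambda>s. \<beta> s $ i) has_vector_derivative D) (at t)"
      by (simp add: \<beta>_def D_def)
    moreover have "lam i *\<^sub>R D = - (\<Sum>j\<in>UNIV - {i}.
        (lam i * lam j / norm (\<alpha> t $ i - \<alpha> t $ j) powr (p + 2)) *\<^sub>R (\<alpha> t $ i - \<alpha> t $ j))"
    proof -
      have "D = - (\<Sum>j\<in>UNIV - {i}. lam j *\<^sub>R attraction p (gap i j (\<alpha> t)))"
        unfolding \<alpha>_def \<alpha>0[OF t0] force_split[OF t0] D_def E_def by simp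
      then show ?thesis
        unfolding scaleR_attraction gap_def by (simp add: scaleR_sum_right)
    qed
    ultimately show "\<exists>D. ((\<lambda>s. \<beta> s $ i) has_vector_derivative D) (at t) \<and>
        lam i *\<^sub>R D = - (\<Sum>j\<in>UNIV - {i}.
          (lam i * lam j / norm (\<alpha> t $ i - \<alpha> t $ j) powr (p + 2)) *\<^sub>R (\<alpha> t $ i - \<alpha> t $ j))"
      by blast
  qed
  moreover have "smallo_plus (\<lambda>t. \<alpha> t - (t *\<^sub>R v + fst (P0 t) + f (ln t))) (- \<delta>)"
    by (rule exp_order_smallo_plus[OF W(4)]) (simp add: \<alpha>_def)
  moreover have "smallo_plus (\<lambda>t. \<alpha> t - (t *\<^sub>R v + fst (P0 t))) (1 - p)"
  proof (rule exp_order_smallo_plus)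
    \<comment> \<open>Both the power-log part and, by \<open>\<delta> > p - 1\<close>, the
      correction have order at most \<open>1 - p\<close>.\<close>
    have "exp_order (1 - p) (\<lambda>x. (W x - f x) + f x)"
      by (intro exp_order_add exp_poly_imp_order[OF W(3)] exp_order_mono[OF W(4)]) (use W(2) in simp)
    then show "exp_order (1 - p) W" by simp
  qed (simp add: \<alpha>_def)
  moreover have "(\<lambda>t. f (ln t)) \<in> power_log_space (1 - p)"
    by (rule exp_poly_in_power_log_space[OF W(3)])
  ultimately show ?thesis
    by (intro exI[of _ \<delta>] exI[of _ "exp T"] exI[of _ "\<lambda>t. (\<alpha> t, \<beta> t)"] bexI[of _ "\<lambda>t. f (ln t)"] conjI)
      (use W(1) in auto)
qed

end
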